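(* Consider the linear equation on $\mathbb{R}^d$ $$\mathrm{d}X=(AX+f(t))\,\mathrm{d}t+g(t)\,\mathrm{d}W,\qquad(\ast)$$ where $A$ is a constant $d\times d$ matrix, $f:\mathbb{R}\to\mathbb{R}^d$ and $g:\mathbb{R}\to\mathbb{R}^{d\times m}$ are almost periodic, and $W$ is a given $m$-dimensional (two-sided) Brownian motion. Let $X$ be a strong $L^2$-bounded solution of $(\ast)$ on $\mathbb{R}$ such that, for some $\tau\in\mathbb{R}$, $X(\tau)-X_0(\tau)$ is independent of the pair $(X_0(\tau),W)$, where $X_0$ is the strong minimal solution of $(\ast)$ (for the same $W$). Then $X$ is almost periodic in distribution.
   Context: Almost periodicity: for a complete metric space $(M,d)$, a continuous $h:\mathbb{R}\to M$ is almost periodic if for every $\epsilon>0$ the set $\{\tau\in\mathbb{R}:\sup_{t}d(h(t+\tau),h(t))<\epsilon\}$ is relatively dense, i.e. meets every interval $(a,a+l)$ for some $l=l(\epsilon)>0$. Solutions: a (weak) solution of $(\ast)$ on $\mathbb{R}$ is a pair $(X',W')$ on some filtered probability space $(\Omega',\mathcal{F}',P',\{\mathcal{F}'_t\}_{t\in\mathbb{R}})$, where $W'$ is a two-sided $m$-dimensional $\{\mathcal{F}'_t\}$-Brownian motion (its increments $W'(t)-W'(s)$, $s\le t$, are $\mathcal{F}'_t$-measurable and independent of $\mathcal{F}'_s$) and $X'$ is an $\{\mathcal{F}'_t\}$-adapted $\mathbb{R}^d$-valued process such that almost surely $X'(t)=X'(s)+\int_s^t(AX'(r)+f(r))\mathrm{d}r+\int_s^tg(r)\mathrm{d}W'(r)$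 for all $s\le t$ in $\mathbb{R}$. It is a strong solution if for given $t_0\in\mathbb{R}$ there is a measurable function $h$ with $X'(\cdot)=h(X'(t_0),W'(\cdot))$ on $\mathbb{R}$ almost surely. Put $\|X'\|_\infty=\sup_{t\in\mathbb{R}}(E|X'(t)|^2)^{1/2}$; $X'$ is $L^2$-bounded if $\|X'\|_\infty<\infty$. When $L^2$-bounded solutions exist, the minimal value $\lambda$ of $(\ast)$ is the infimum of $\|X'\|_\infty$ over all $L^2$-bounded (weak) solutions on $\mathbb{R}$, and a minimal solution is a solution $X_0$ with $\|X_0\|_\infty=\lambda$. (For equation $(\ast)$ and given $W$, the strong minimal solution exists and is unique once an $L^2$-bounded solution exists.) Almost periodic in distribution: let $\mathcal{P}(\mathbb{R}^d)$ be the Borel probability measures on $\mathbb{R}^d$ with the complete metric $\rho(\mu,\nu)=\sup\{|\int h\,\mathrm{d}\mu-\int h\,\mathrm{d}\nu|:\|h\|_L+\|h\|_\infty\le1\}$ ($\|h\|_L$ the Lipschitz constant, $\|h\|_\infty$ the sup norm), metrizing weak convergence. A process $X$ is almost periodic in distribution if $t\mapsto\mathcal{L}(X(t))\in\mathcal{P}(\mathbb{R}^d)$ is almost periodic, $\mathcal{L}$ denoting law. *)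

theory Defs
  imports "HOL-Probability.Probability"
begin

section \<open>Almost periodic functions\<close>

definition relatively_dense :: "real set \<Rightarrow> bool" where
  "relatively_dense T \<longleftrightarrow> (\<exists>l>0. \<forall>a. T \<inter> {a<..<a + l} \<noteq> {})"

text \<open>The supremum is taken in the extended reals, so that it is \<open>\<infinity>\<close> when the
  distances are unbounded.\<close>

definition (in Metric_space) almost_periodic :: "(real \<Rightarrow> 'a) \<Rightarrow> bool" where
  "almost_periodic h \<longleftrightarrow>
     continuous_map euclideanreal mtopology h \<and>
     (\<forall>\<epsilon>>0. relatively_dense {\<tau>. (SUP t. ereal (d (h (t + \<tau>)) (h t))) < ereal \<epsilon>})"

section \<open>Almost periodicity in distribution\<close>

definition borel_probabilities :: "'a::topological_space measure set" where
  "borel_probabilities = {\<mu>. prob_space \<mu> \<and> sets \<mu> = sets borel}"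

definition lipschitz_seminorm :: "('a::metric_space \<Rightarrow> real) \<Rightarrow> ereal" where
  "lipschitz_seminorm h = (SUP x. SUP y. ereal (\<bar>h x - h y\<bar> / dist x y))"

definition sup_norm :: "('a \<Rightarrow> real) \<Rightarrow> ereal" where
  "sup_norm h = (SUP x. ereal \<bar>h x\<bar>)"

definition bl_dist :: "'a::metric_space measure \<Rightarrow> 'a measure \<Rightarrow> real" where
  "bl_dist \<mu> \<nu> = real_of_ereal
     (SUP h\<in>{h. lipschitz_seminorm h + sup_norm h \<le> 1}. ereal \<bar>(LINT x|\<mu>. h x) - (LINT x|\<nu>. h x)\<bar>)"

lemma bl_testD:
  fixes h :: "'a::metric_space \<Rightarrow> real"
  assumes "lipschitz_seminorm h + sup_norm h \<le> 1"
  shows "\<bar>h x\<bar> \<le> 1" and "\<bar>h x - h y\<bar> \<le> dist x y"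
proof -
  have L: "ereal (\<bar>h x - h y\<bar> / dist x y) \<le> lipschitz_seminorm h" for x y
    unfolding lipschitz_seminorm_def by (meson SUP_upper2 UNIV_I order_refl)
  have S: "ereal \<bar>h x\<bar> \<le> sup_norm h" for x
    unfolding sup_norm_def by (rule SUP_upper) simp
  have L0: "0 \<le> lipschitz_seminorm h" using L[of x x] by (simp add: zero_ereal_def)
  have S0: "0 \<le> sup_norm h" using S[of x] by (rule order_trans[rotated]) simp
  have "ereal \<bar>h x\<bar> \<le> 1"
    using order_trans[OF add_mono[OF L0 S[of x]] assms] by simp
  then show "\<bar>h x\<bar> \<le> 1" by simp
  have "ereal (\<bar>h x - h y\<bar> / dist x y) \<le> 1"
    using order_trans[OF add_mono[OF L[of x y] S0] assms] by simp
  then show "\<bar>h x - h y\<bar> \<le> dist x y"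
    by (cases "x = y") (auto simp: divide_le_eq)
qed

lemma bl_testI:
  fixes h :: "'a::metric_space \<Rightarrow> real"
  assumes "\<And>x y. \<bar>h x - h y\<bar> \<le> L * dist x y" "\<And>x. \<bar>h x\<bar> \<le> B" "L + B \<le> 1" "0 \<le> L"
  shows "lipschitz_seminorm h + sup_norm h \<le> 1"
proof -
  have "\<bar>h x - h y\<bar> / dist x y \<le> L" for x y
    using assms(1)[of x y] assms(4) by (cases "x = y") (auto simp: divide_le_eq)
  then have "lipschitz_seminorm h \<le> ereal L"
    unfolding lipschitz_seminorm_def by (intro SUP_least) simp
  moreover have "sup_norm h \<le> ereal B"
    unfolding sup_norm_def using assms(2) by (intro SUP_least) simp
  ultimately have "lipschitz_seminorm h + sup_norm h \<le> ereal L + ereal B" by (rule add_mono)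
  also have "\<dots> \<le> 1" using assms(3) by simp
  finally show ?thesis .
qed

lemma bl_test_integrable:
  fixes h :: "'a::metric_space \<Rightarrow> real"
  assumes "lipschitz_seminorm h + sup_norm h \<le> 1" "\<mu> \<in> borel_probabilities"
  shows "integrable \<mu> h" and "\<bar>LINT x|\<mu>. h x\<bar> \<le> 1"
proof -
  interpret prob_space \<mu> using assms(2) by (simp add: borel_probabilities_def)
  have [measurable_cong]: "sets \<mu> = sets borel" using assms(2) by (simp add: borel_probabilities_def)
  have "1-lipschitz_on UNIV h"
    using bl_testD(2)[OF assms(1)] by (intro lipschitz_onI) (auto simp: dist_real_def)
  then have "continuous_on UNIV h" by (rule lipschitz_on_continuous_on)
  then have h[measurable]: "h \<in> borel_measurable borel" by (rule borel_measurable_continuous_onI)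
  show i: "integrable \<mu> h"
    by (rule integrable_const_bound[where B=1]) (use bl_testD(1)[OF assms(1)] in auto)
  have "\<bar>LINT x|\<mu>. h x\<bar> \<le> (LINT x|\<mu>. \<bar>h x\<bar>)" by (rule integral_abs_bound)
  also have "\<dots> \<le> (LINT x|\<mu>. 1)"
    by (rule integral_mono) (use i bl_testD(1)[OF assms(1)] in auto)
  finally show "\<bar>LINT x|\<mu>. h x\<bar> \<le> 1" by (simp add: prob_space)
qed

lemma bl_dist_bounds:
  fixes \<mu> \<nu> :: "'a::metric_space measure"
  assumes "\<mu> \<in> borel_probabilities" "\<nu> \<in> borel_probabilities"
  shows "ereal (bl_dist \<mu> \<nu>) =
    (SUP h\<in>{h. lipschitz_seminorm h + sup_norm h \<le> 1}. ereal \<bar>(LINT x|\<mu>. h x) - (LINT x|\<nu>. h x)\<bar>)"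
    (is "_ = ?S")
proof -
  have "?S \<le> ereal 2"
  proof (rule SUP_least)
    fix h :: "'a \<Rightarrow> real" assume "h \<in> {h. lipschitz_seminorm h + sup_norm h \<le> 1}"
    then show "ereal \<bar>(LINT x|\<mu>. h x) - (LINT x|\<nu>. h x)\<bar> \<le> ereal 2"
      using bl_test_integrable(2)[of h \<mu>] bl_test_integrable(2)[of h \<nu>] assms by auto
  qed
  moreover have "?S \<ge> 0"
    by (rule SUP_upper2[where i="\<lambda>_. 0"]) (auto intro!: bl_testI[of _ 0 0])
  ultimately have "\<bar>?S\<bar> \<noteq> \<infinity>" by (cases ?S) auto
  then show ?thesis unfolding bl_dist_def by (simp add: ereal_real')
qed

lemma borel_probabilities_eqI:
  fixes \<mu> \<nu> :: "'a::metric_space measure"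
  assumes \<mu>: "\<mu> \<in> borel_probabilities" and \<nu>: "\<nu> \<in> borel_probabilities"
    and eq: "\<And>h::'a \<Rightarrow> real. lipschitz_seminorm h + sup_norm h \<le> 1 \<Longrightarrow> (LINT x|\<mu>. h x) = (LINT x|\<nu>. h x)"
  shows "\<mu> = \<nu>"
proof -
  define u where "u C n x = max 0 (1 - real n * infdist x C)" for C :: "'a set" and n x
  have lip: "\<bar>u C n x - u C n y\<bar> \<le> real n * dist x y" for C n x y
  proof -
    have "\<bar>u C n x - u C n y\<bar> \<le> \<bar>real n * infdist x C - real n * infdist y C\<bar>"
      by (auto simp: u_def)
    also have "\<dots> = real n * \<bar>infdist x C - infdist y C\<bar>"
      by (metis abs_mult abs_of_nat right_diff_distrib)
    also have "\<dots> \<le> real n * dist x y"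
      by (intro mult_left_mono infdist_triangle_abs) simp
    finally show ?thesis .
  qed
  have u01: "0 \<le> u C n x" "u C n x \<le> 1" for C n x
    by (auto simp: u_def infdist_nonneg)
  have test: "lipschitz_seminorm (\<lambda>x. u C n x / (real n + 1)) + sup_norm (\<lambda>x. u C n x / (real n + 1)) \<le> 1"
    for C n
  proof (rule bl_testI[where L="real n / (real n + 1)" and B="1 / (real n + 1)"])
    show "\<bar>u C n x / (real n + 1) - u C n y / (real n + 1)\<bar> \<le> real n / (real n + 1) * dist x y" for x y
      using lip[of C n x y] by (simp add: diff_divide_distrib[symmetric] abs_divide divide_right_mono)
    show "\<bar>u C n x / (real n + 1)\<bar> \<le> 1 / (real n + 1)" for x
      using u01[of C n x] by (simp add: abs_divide divide_right_mono)
  qed (simp_all add: add_divide_distrib[symmetric])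
  have ueq: "(LINT x|\<mu>. u C n x) = (LINT x|\<nu>. u C n x)" for C n
    using eq[OF test[of C n]] by simp
  have lim: "(\<lambda>n. LINT x|\<kappa>. u C n x) \<longlonglongrightarrow> measure \<kappa> C"
    if C: "closed C" "C \<noteq> {}" and \<kappa>: "\<kappa> \<in> borel_probabilities" for C and \<kappa> :: "'a measure"
  proof -
    interpret prob_space \<kappa> using \<kappa> by (simp add: borel_probabilities_def)
    have [measurable_cong]: "sets \<kappa> = sets borel" using \<kappa> by (simp add: borel_probabilities_def)
    have [measurable]: "C \<in> sets borel" using C by simp
    have "(\<lambda>x. infdist x C) \<in> borel_measurable borel"
      by (intro borel_measurable_continuous_onI continuous_intros)
    then have m[measurable]: "u C n \<in> borel_measurable borel" for n
      unfolding u_def by measurable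
    have "(\<lambda>n. LINT x|\<kappa>. u C n x) \<longlonglongrightarrow> (LINT x|\<kappa>. indicator C x)"
    proof (rule integral_dominated_convergence[where w="\<lambda>_. 1"])
      show "AE x in \<kappa>. (\<lambda>n. u C n x) \<longlonglongrightarrow> indicator C x"
      proof (rule AE_I2)
        fix x
        show "(\<lambda>n. u C n x) \<longlonglongrightarrow> indicator C x"
        proof (cases "x \<in> C")
          case True
          then show ?thesis using C in_closed_iff_infdist_zero[of C x] by (simp add: u_def)
        next
          case False
          then have p: "infdist x C > 0" using C infdist_pos_not_in_closed by blast
          then obtain N where N: "1 < real N * infdist x C" using reals_Archimedean3 by blast
          have "u C n x = 0" if "n \<ge> N" for n
          proof -
            have "real N * infdist x C \<le> real n * infdist x C"
              using that p by (intro mult_right_mono) auto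
            with N show ?thesis by (simp add: u_def)
          qed
          then have "eventually (\<lambda>n. u C n x = indicator C x) sequentially"
            using False by (auto simp: eventually_sequentially)
          then show ?thesis by (rule tendsto_eventually)
        qed
      qed
    qed (use u01 in auto)
    then show ?thesis by simp
  qed
  have sets: "sets \<mu> = sigma_sets UNIV (Collect closed)" "sets \<nu> = sigma_sets UNIV (Collect closed)"
    using \<mu> \<nu> by (simp_all add: borel_probabilities_def borel_eq_closed)
  interpret M: prob_space \<mu> using \<mu> by (simp add: borel_probabilities_def)
  interpret N: prob_space \<nu> using \<nu> by (simp add: borel_probabilities_def)
  show ?thesis
  proof (rule measure_eqI_generator_eq[where E="Collect closed" and \<Omega>=UNIV and A="\<lambda>_. UNIV"])
    show "emeasure \<mu> C = emeasure \<nu> C" if "C \<in> Collect closed" for C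
    proof (cases "C = {}")
      case False
      with that have "measure \<mu> C = measure \<nu> C"
        using lim[OF _ _ \<mu>, of C] lim[OF _ _ \<nu>, of C] ueq by (auto intro: LIMSEQ_unique)
      then show ?thesis by (simp add: M.emeasure_eq_measure N.emeasure_eq_measure)
    qed simp
  qed (use sets in \<open>auto simp: Int_stable_def\<close>)
qed

lemma Metric_space_bl_dist:
  "Metric_space (borel_probabilities :: 'a::metric_space measure set) bl_dist"
proof
  let ?T = "{h::'a \<Rightarrow> real. lipschitz_seminorm h + sup_norm h \<le> 1}"
  fix \<mu> \<nu> :: "'a measure"
  have "0 \<le> (SUP h\<in>?T. ereal \<bar>(LINT x|\<mu>. h x) - (LINT x|\<nu>. h x)\<bar>)"
    by (rule SUP_upper2[where i="\<lambda>_. 0"]) (auto intro!: bl_testI[of _ 0 0])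
  then show "0 \<le> bl_dist \<mu> \<nu>" unfolding bl_dist_def by (rule real_of_ereal_pos)
  show "bl_dist \<mu> \<nu> = bl_dist \<nu> \<mu>" unfolding bl_dist_def by (simp add: abs_minus_commute)
  have le: "\<bar>(LINT x|\<mu>. h x) - (LINT x|\<nu>. h x)\<bar> \<le> bl_dist \<mu> \<nu>"
    if "\<mu> \<in> borel_probabilities" "\<nu> \<in> borel_probabilities" "h \<in> ?T" for \<mu> \<nu> h
  proof -
    have "ereal \<bar>(LINT x|\<mu>. h x) - (LINT x|\<nu>. h x)\<bar> \<le> ereal (bl_dist \<mu> \<nu>)"
      unfolding bl_dist_bounds[OF that(1,2)] using that(3) by (rule SUP_upper)
    then show ?thesis by simp
  qed
  assume \<mu>: "\<mu> \<in> borel_probabilities" and \<nu>: "\<nu> \<in> borel_probabilities"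
  show "bl_dist \<mu> \<nu> = 0 \<longleftrightarrow> \<mu> = \<nu>"
  proof
    assume "bl_dist \<mu> \<nu> = 0"
    then show "\<mu> = \<nu>" using le[OF \<mu> \<nu>] by (intro borel_probabilities_eqI[OF \<mu> \<nu>]) fastforce
  next
    assume "\<mu> = \<nu>"
    moreover have "?T \<noteq> {}" by (auto intro!: exI[of _ "\<lambda>_. 0"] bl_testI[of _ 0 0])
    ultimately show "bl_dist \<mu> \<nu> = 0"
      by (simp add: bl_dist_def zero_ereal_def[symmetric])
  qed
  fix \<kappa> :: "'a measure" assume \<kappa>: "\<kappa> \<in> borel_probabilities"
  have "ereal (bl_dist \<mu> \<kappa>) \<le> ereal (bl_dist \<mu> \<nu> + bl_dist \<nu> \<kappa>)"
    unfolding bl_dist_bounds[OF \<mu> \<kappa>]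
  proof (rule SUP_least)
    fix h assume "h \<in> ?T"
    from le[OF \<mu> \<nu> this] le[OF \<nu> \<kappa> this]
    show "ereal \<bar>(LINT x|\<mu>. h x) - (LINT x|\<kappa>. h x)\<bar> \<le> ereal (bl_dist \<mu> \<nu> + bl_dist \<nu> \<kappa>)" by simp
  qed
  then show "bl_dist \<mu> \<kappa> \<le> bl_dist \<mu> \<nu> + bl_dist \<nu> \<kappa>" by simp
qed

definition almost_periodic_in_distribution ::
    "'w measure \<Rightarrow> (real \<Rightarrow> 'w \<Rightarrow> 'a::metric_space) \<Rightarrow> bool" where
  "almost_periodic_in_distribution M X \<longleftrightarrow>
     Metric_space.almost_periodic borel_probabilities bl_dist (\<lambda>t. distr M borel (X t))"

section \<open>Two-sided Brownian motion\<close>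

locale filtered_prob_space = prob_space M + filtration "space M" F
  for M :: "'w measure" and F :: "real \<Rightarrow> 'w measure" +
  assumes subalgebra_F: "subalgebra M (F t)"

text \<open>The library's \<open>indep_var\<close> requires both random variables to have the same
  value type, so independence is expressed through the generated \<open>\<sigma>\<close>-algebras.\<close>

definition indep_rv ::
    "'w measure \<Rightarrow> 'a measure \<Rightarrow> ('w \<Rightarrow> 'a) \<Rightarrow> 'b measure \<Rightarrow> ('w \<Rightarrow> 'b) \<Rightarrow> bool" where
  "indep_rv M N Y K Z \<longleftrightarrow>
     Y \<in> measurable M N \<and> Z \<in> measurable M K \<and>
     prob_space.indep_set M (sets (vimage_algebra (space M) Y N)) (sets (vimage_algebra (space M) Z K))"

text \<open>For \<open>s < t\<close> the increment is required to have the law \<open>N(0, (t - s) I)\<close>, given by its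
  density. Only increments, not \<open>W t\<close> itself, are \<open>F t\<close>-measurable.\<close>

definition brownian_motion ::
    "'w measure \<Rightarrow> (real \<Rightarrow> 'w measure) \<Rightarrow> (real \<Rightarrow> 'w \<Rightarrow> real^'m) \<Rightarrow> bool" where
  "brownian_motion M F W \<longleftrightarrow>
     (\<forall>t. W t \<in> borel_measurable M) \<and>
     (AE \<omega> in M. W 0 \<omega> = 0) \<and>
     (AE \<omega> in M. continuous_on UNIV (\<lambda>t. W t \<omega>)) \<and>
     (\<forall>s t. s < t \<longrightarrow> distributed M lborel (\<lambda>\<omega>. W t \<omega> - W s \<omega>)
        (\<lambda>x. ennreal (\<Prod>i\<in>UNIV. normal_density 0 (sqrt (t - s)) (x $ i)))) \<and>
     (\<forall>s t. s \<le> t \<longrightarrow>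
        (\<lambda>\<omega>. W t \<omega> - W s \<omega>) \<in> borel_measurable (F t) \<and>
        prob_space.indep_set M
          (sets (vimage_algebra (space M) (\<lambda>\<omega>. W t \<omega> - W s \<omega>) borel)) (sets (F s)))"

section \<open>Stochastic integral of a deterministic integrand\<close>

text \<open>The integrands that occur here are deterministic. For them the Ito integral over
  \<open>[s, t]\<close> is the limit in \<open>L\<^sup>2(M)\<close> of the elementary integrals of step functions
  \<open>\<Sum>i<n. C i\<cdot>1\<^bsub>(p i, p (i + 1)]\<^esub>\<close> that converge to the integrand in \<open>L\<^sup>2([s, t])\<close>.
  Being an \<open>L\<^sup>2\<close>-limit, it is determined up to almost sure equality only, hence a predicate.\<close>

definition partition_of :: "real \<Rightarrow> real \<Rightarrow> nat \<Rightarrow> (nat \<Rightarrow> real) \<Rightarrow> bool" where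
  "partition_of s t n p \<longleftrightarrow> p 0 = s \<and> p n = t \<and> (\<forall>i<n. p i \<le> p (Suc i))"

definition step_function :: "nat \<Rightarrow> (nat \<Rightarrow> real) \<Rightarrow> (nat \<Rightarrow> real^'m^'d) \<Rightarrow> real \<Rightarrow> real^'m^'d" where
  "step_function n p C r = (\<Sum>i<n. indicator {p i<..p (Suc i)} r *\<^sub>R C i)"

definition elementary_integral ::
    "(real \<Rightarrow> 'w \<Rightarrow> real^'m) \<Rightarrow> nat \<Rightarrow> (nat \<Rightarrow> real) \<Rightarrow> (nat \<Rightarrow> real^'m^'d) \<Rightarrow> 'w \<Rightarrow> real^'d" where
  "elementary_integral W n p C \<omega> = (\<Sum>i<n. C i *v (W (p (Suc i)) \<omega> - W (p i) \<omega>))"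

definition is_stochastic_integral ::
    "'w measure \<Rightarrow> (real \<Rightarrow> 'w \<Rightarrow> real^'m) \<Rightarrow> (real \<Rightarrow> real^'m^'d) \<Rightarrow> real \<Rightarrow> real \<Rightarrow> ('w \<Rightarrow> real^'d) \<Rightarrow> bool"
  where
  "is_stochastic_integral M W g s t Y \<longleftrightarrow>
     Y \<in> borel_measurable M \<and>
     (\<exists>n p C.
        (\<forall>k. partition_of s t (n k) (p k)) \<and>
        (\<lambda>k. \<integral>\<^sup>+r\<in>{s..t}. ennreal ((norm (step_function (n k) (p k) (C k) r - g r))\<^sup>2) \<partial>lborel) \<longlonglongrightarrow> 0 \<and>
        (\<lambda>k. \<integral>\<^sup>+\<omega>. ennreal ((norm (elementary_integral W (n k) (p k) (C k) \<omega> - Y \<omega>))\<^sup>2) \<partial>M) \<longlonglongrightarrow> 0)"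

text \<open>The continuous version of the indefinite integral, up to an additive random constant;
  only the increments \<open>I t - I s\<close> are used.\<close>

definition stochastic_integral_process ::
    "'w measure \<Rightarrow> (real \<Rightarrow> 'w \<Rightarrow> real^'m) \<Rightarrow> (real \<Rightarrow> real^'m^'d) \<Rightarrow> (real \<Rightarrow> 'w \<Rightarrow> real^'d) \<Rightarrow> bool"
  where
  "stochastic_integral_process M W g I \<longleftrightarrow>
     (AE \<omega> in M. continuous_on UNIV (\<lambda>t. I t \<omega>)) \<and>
     (\<forall>s t. s \<le> t \<longrightarrow> is_stochastic_integral M W g s t (\<lambda>\<omega>. I t \<omega> - I s \<omega>))"

section \<open>Solutions of the linear equation\<close>

definition weak_solution ::
    "real^'d^'d \<Rightarrow> (real \<Rightarrow> real^'d) \<Rightarrow> (real \<Rightarrow> real^'m^'d) \<Rightarrow>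
     'w measure \<Rightarrow> (real \<Rightarrow> 'w measure) \<Rightarrow> (real \<Rightarrow> 'w \<Rightarrow> real^'d) \<Rightarrow> (real \<Rightarrow> 'w \<Rightarrow> real^'m) \<Rightarrow> bool"
  where
  "weak_solution A f g M F X W \<longleftrightarrow>
     filtered_prob_space M F \<and>
     brownian_motion M F W \<and>
     (\<forall>t. X t \<in> borel_measurable (F t)) \<and>
     (\<exists>I. stochastic_integral_process M W g I \<and>
        (AE \<omega> in M. \<forall>s t. s \<le> t \<longrightarrow>
           set_integrable lborel {s..t} (\<lambda>r. A *v X r \<omega> + f r) \<and>
           X t \<omega> = X s \<omega> + (LINT r:{s..t}|lborel. A *v X r \<omega> + f r) + (I t \<omega> - I s \<omega>)))"

text \<open>Path spaces carry the product (cylinder) \<open>\<sigma>\<close>-algebra. Its trace on the continuous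
  paths is the Borel \<open>\<sigma>\<close>-algebra of locally uniform convergence, and almost all paths of
  \<open>X\<close> and \<open>W\<close> are continuous.\<close>

abbreviation path_algebra :: "(real \<Rightarrow> 'a::topological_space) measure" where
  "path_algebra \<equiv> PiM UNIV (\<lambda>_. borel)"

definition strong_solution ::
    "real^'d^'d \<Rightarrow> (real \<Rightarrow> real^'d) \<Rightarrow> (real \<Rightarrow> real^'m^'d) \<Rightarrow>
     'w measure \<Rightarrow> (real \<Rightarrow> 'w measure) \<Rightarrow> (real \<Rightarrow> 'w \<Rightarrow> real^'d) \<Rightarrow> (real \<Rightarrow> 'w \<Rightarrow> real^'m) \<Rightarrow> bool"
  where
  "strong_solution A f g M F X W \<longleftrightarrow>
     weak_solution A f g M F X W \<and>
     (\<forall>t0. \<exists>h \<in> measurable (borel \<Otimes>\<^sub>M path_algebra) path_algebra.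
        AE \<omega> in M. (\<lambda>t. X t \<omega>) = h (X t0 \<omega>, \<lambda>t. W t \<omega>))"

definition L2_bounded :: "'w measure \<Rightarrow> (real \<Rightarrow> 'w \<Rightarrow> real^'d) \<Rightarrow> bool" where
  "L2_bounded M X \<longleftrightarrow>
     (\<forall>t. integrable M (\<lambda>\<omega>. (norm (X t \<omega>))\<^sup>2)) \<and>
     bdd_above (range (\<lambda>t. sqrt (LINT \<omega>|M. (norm (X t \<omega>))\<^sup>2)))"

definition L2_sup_norm :: "'w measure \<Rightarrow> (real \<Rightarrow> 'w \<Rightarrow> real^'d) \<Rightarrow> real" where
  "L2_sup_norm M X = (SUP t. sqrt (LINT \<omega>|M. (norm (X t \<omega>))\<^sup>2))"

text \<open>A definition cannot quantify over types, so the infimum ranges over all filtered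
  probability spaces whose sample space is of a given type \<open>'w\<close>. For a solution \<open>X\<close> on a space of
  this type nothing is lost: if \<open>L2_sup_norm M X\<close> is minimal among all weak solutions
  whatsoever, then it is also the infimum over those on \<open>'w\<close>, as \<open>X\<close> itself is one of these.\<close>

definition minimal_value ::
    "'w itself \<Rightarrow> real^'d^'d \<Rightarrow> (real \<Rightarrow> real^'d) \<Rightarrow> (real \<Rightarrow> real^'m^'d) \<Rightarrow> real" where
  "minimal_value _ A f g =
     Inf {L2_sup_norm M X |(M :: 'w measure) F X W. weak_solution A f g M F X W \<and> L2_bounded M X}"

definition strong_minimal_solution ::
    "real^'d^'d \<Rightarrow> (real \<Rightarrow> real^'d) \<Rightarrow> (real \<Rightarrow> real^'m^'d) \<Rightarrow>
     'w measure \<Rightarrow> (real \<Rightarrow> 'w measure) \<Rightarrow> (real \<Rightarrow> 'w \<Rightarrow> real^'d) \<Rightarrow> (real \<Rightarrow> 'w \<Rightarrow> real^'m) \<Rightarrow> bool"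
  where
  "strong_minimal_solution A f g M F X W \<longleftrightarrow>
     strong_solution A f g M F X W \<and> L2_bounded M X \<and>
     L2_sup_norm M X = minimal_value TYPE('w) A f g"

end

theory Submission
  imports Defs
    "HOL-Computational_Algebra.Fundamental_Theorem_Algebra"
    "HOL-Real_Asymp.Real_Asymp"
begin

text \<open>Write \<open>U(t) = exp(tA)\<close>. By variation of constants, the characteristic function
  \<open>\<phi>\<^sub>t(\<theta>) = E exp(i \<theta> \<bullet> X(t))\<close> of a solution satisfies, for \<open>s \<le> t\<close>,
  \<open>\<phi>\<^sub>t(\<theta>) = exp(i \<theta> \<bullet> \<integral> U(t - r) f(r) dr) E exp(i \<theta> \<bullet> U(t - s) X(s)) exp(- Q / 2)\<close>, where
  \<open>Q = \<integral> |\<theta> U(t - r) g(r)|\<^sup>2 dr\<close> and both integrals extend over \<open>[s, t]\<close>. Boundedness of the second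
  moments keeps \<open>Q\<close> bounded in \<open>s\<close> and \<open>t\<close>; as \<open>g\<close> is almost periodic, this forces \<open>g\<close> into the
  stable directions of \<open>A\<close>, so \<open>U(u) g(r)\<close> decays exponentially in \<open>u\<close>. Hence the centred
  variables \<open>U(n) (X(-n) - E X(-n))\<close> converge almost surely to some \<open>\<eta>\<close> with bounded \<open>E |U(t) \<eta>|\<^sup>2\<close>,
  and letting \<open>s\<close> tend to \<open>-\<infinity>\<close> writes \<open>\<phi>\<^sub>t(\<theta>)\<close> as the product of \<open>exp(i \<theta> \<bullet> E X(t))\<close>,
  \<open>E exp(i \<theta> \<bullet> U(t) \<eta>)\<close> and a Gaussian factor. The mean is almost periodic by the
  Bohr--Neugebauer theorem, and so is \<open>U(t) \<eta>\<close>, as \<open>\<eta>\<close> almost surely has a bounded orbit; the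
  Gaussian factor inherits almost periodicity from \<open>g\<close>. Gaussian smoothing turns closeness of the
  characteristic functions into closeness of the laws.\<close>

text \<open>Only laws at single times are at stake, so independence of the noise from the past
  enters solely as a factorisation: \<open>E (Z exp(i \<theta> \<bullet> J))\<close> splits for
  every bounded \<open>Z\<close> of the past, \<open>J\<close> being the noise accumulated since.
  The obstacle is that \<open>A\<close> may have spectrum on both sides of the imaginary axis and on
  it, with Jordan blocks, so that neither \<open>U(t - s) X(s)\<close> nor the forcing integral need
  converge as \<open>s\<close> tends to \<open>-\<infinity>\<close>. Centring removes the forcing,
  and the propagated centred values differ by pure noise, which decays; hence the limit \<eta>
  exists. Boundedness of \<open>Q\<close> comes from the factorisation itself: the modulus of the
  characteristic function is at most \<open>exp(- Q / 2)\<close>, while for small \<theta> a bounded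
  first moment keeps it above \<open>1/2\<close>. If a functional saw \<open>g\<close> along a
  direction that does not decay, the limiting amplitude would be an almost periodic function with
  bounded square integral, hence zero. Since \<open>E |U(t) \<eta>|^2\<close> stays bounded for
  negative and positive \<open>t\<close> alike, \<eta> avoids the unbounded orbits.\<close>

section \<open>The exponential of a matrix and the flow of the linear equation\<close>

text \<open>A copy of the bounded operators that is a Banach algebra, to have \<open>exp\<close> available.\<close>

typedef (overloaded) ('a::"{banach,perfect_space}") endo = "UNIV :: ('a \<Rightarrow>\<^sub>L 'a) set"
  morphisms blinfun_of_endo endo_of_blinfun ..

setup_lifting type_definition_endo

instantiation endo :: ("{banach,perfect_space}") real_normed_vector
begin

lift_definition zero_endo :: "'a endo" is 0 .
lift_definition plus_endo :: "'a endo \<Rightarrow> 'a endo \<Rightarrow> 'a endo" is "(+)" .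
lift_definition minus_endo :: "'a endo \<Rightarrow> 'a endo \<Rightarrow> 'a endo" is "(-)" .
lift_definition uminus_endo :: "'a endo \<Rightarrow> 'a endo" is uminus .
lift_definition scaleR_endo :: "real \<Rightarrow> 'a endo \<Rightarrow> 'a endo" is scaleR .
lift_definition norm_endo :: "'a endo \<Rightarrow> real" is norm .
lift_definition dist_endo :: "'a endo \<Rightarrow> 'a endo \<Rightarrow> real" is dist .
lift_definition sgn_endo :: "'a endo \<Rightarrow> 'a endo" is sgn .

definition uniformity_endo :: "('a endo \<times> 'a endo) filter" where
  "uniformity_endo = (INF e\<in>{0<..}. principal {(x, y). dist x y < e})"

definition open_endo :: "'a endo set \<Rightarrow> bool" where
  "open_endo S = (\<forall>x\<in>S. \<forall>\<^sub>F (x', y) in uniformity. x' = x \<longrightarrow> y \<in> S)"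

instance
  by standard (fact uniformity_endo_def open_endo_def |
    (transfer; simp add: scaleR_add_left scaleR_add_right sgn_div_norm dist_norm norm_triangle_ineq))+

end

instance endo :: ("{banach,perfect_space}") banach
proof
  fix X :: "nat \<Rightarrow> 'a endo"
  assume "Cauchy X"
  then have "Cauchy (\<lambda>n. blinfun_of_endo (X n))"
    unfolding Cauchy_def by transfer
  then obtain L where "(\<lambda>n. blinfun_of_endo (X n)) \<longlonglongrightarrow> L"
    using Cauchy_convergent convergent_def by blast
  then have "X \<longlonglongrightarrow> endo_of_blinfun L"
    unfolding lim_sequentially dist_endo_def by (simp add: endo_of_blinfun_inverse)
  then show "convergent X" by (auto simp: convergent_def)
qed

instantiation endo :: ("{banach,perfect_space}") real_normed_algebra_1
begin

lift_definition one_endo :: "'a endo" is id_blinfun .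
lift_definition times_endo :: "'a endo \<Rightarrow> 'a endo \<Rightarrow> 'a endo" is blinfun_compose .

instance
proof
  \<comment> \<open>Here \<open>perfect_space\<close> enters: the identity has norm 1 only on a
    nontrivial space.\<close>
  show "(0 :: 'a endo) \<noteq> 1"
    by transfer (metis norm_blinfun_id norm_zero zero_neq_one)
qed (transfer; auto intro!: blinfun_eqI simp: blinfun.bilinear_simps norm_blinfun_compose)+

end

lift_definition endo_apply :: "'a::{banach,perfect_space} endo \<Rightarrow> 'a \<Rightarrow> 'a" is blinfun_apply .

lemma endo_apply_mult: "endo_apply (S * T) v = endo_apply S (endo_apply T v)"
  by transfer simp

lemma endo_apply_one: "endo_apply 1 v = v"
  by transfer simp

lemma bounded_bilinear_endo_apply: "bounded_bilinear endo_apply"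
  by (standard; (transfer; simp add: blinfun.bilinear_simps)?)
     (rule exI[of _ 1], transfer, simp add: norm_blinfun)

interpretation endo_apply: bounded_bilinear endo_apply
  by (rule bounded_bilinear_endo_apply)

lemma norm_endo_apply: "norm (endo_apply S v) \<le> norm S * norm v"
  by transfer (rule norm_blinfun)

definition endo_of_matrix :: "real^'n^'n \<Rightarrow> (real^'n) endo" where
  "endo_of_matrix A = endo_of_blinfun (Blinfun ((*v) A))"

lemma endo_apply_endo_of_matrix: "endo_apply (endo_of_matrix A) v = A *v v"
  unfolding endo_of_matrix_def endo_apply_def
  by (simp add: endo_of_blinfun_inverse bounded_linear_Blinfun_apply matrix_vector_mul_bounded_linear)

text \<open>This is \<open>U(t)\<close>, with the vector as a separate argument so that linearity
  and continuity can be stated for \<open>flow A t\<close>.\<close>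

definition flow :: "real^'n^'n \<Rightarrow> real \<Rightarrow> real^'n \<Rightarrow> real^'n" where
  "flow A t v = endo_apply (exp (t *\<^sub>R endo_of_matrix A)) v"

lemma bounded_linear_flow: "bounded_linear (flow A t)"
  unfolding flow_def by (rule endo_apply.bounded_linear_right)

lemmas linear_flow = bounded_linear.linear[OF bounded_linear_flow]

lemma flow_0 [simp]: "flow A 0 v = v"
  by (simp add: flow_def endo_apply_one)

lemma flow_add: "flow A (s + t) v = flow A s (flow A t v)"
  unfolding flow_def endo_apply_mult[symmetric] scaleR_add_left
  by (subst exp_add_commuting) (simp_all add: algebra_simps)

lemma norm_flow: "norm (flow A t v) \<le> exp (\<bar>t\<bar> * norm (endo_of_matrix A)) * norm v"
proof -
  have "norm (flow A t v) \<le> norm (exp (t *\<^sub>R endo_of_matrix A)) * norm v"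
    unfolding flow_def by (rule norm_endo_apply)
  also have "norm (exp (t *\<^sub>R endo_of_matrix A)) \<le> exp (norm (t *\<^sub>R endo_of_matrix A))"
    by (rule norm_exp)
  finally show ?thesis by (simp add: mult_right_mono)
qed

lemma flow_matrix_commute: "flow A t (A *v v) = A *v flow A t v"
  unfolding flow_def endo_apply_endo_of_matrix[symmetric] endo_apply_mult[symmetric]
  by (simp add: exp_times_scaleR_commute)

text \<open>Product rule, with the derivative collected under a single \<open>flow A t\<close>.
  Applied to a time-reversed solution the two \<open>A\<close> terms cancel, and this is variation
  of constants.\<close>

lemma has_vector_derivative_flow_comp:
  assumes "(w has_vector_derivative w') (at t within S)"
  shows "((\<lambda>t. flow A t (w t)) has_vector_derivative flow A t (A *v w t + w')) (at t within S)"
proof -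
  have "((\<lambda>t. endo_apply (exp (t *\<^sub>R endo_of_matrix A)) (w t)) has_vector_derivative
      endo_apply (exp (t *\<^sub>R endo_of_matrix A)) w' + endo_apply (exp (t *\<^sub>R endo_of_matrix A) * endo_of_matrix A) (w t))
      (at t within S)"
    by (rule endo_apply.has_vector_derivative[OF exp_scaleR_has_vector_derivative_right assms])
  then show ?thesis
    by (simp add: flow_def endo_apply_mult endo_apply_endo_of_matrix endo_apply.add_right add.commute)
qed

lemma has_vector_derivative_flow:
  "((\<lambda>t. flow A t v) has_vector_derivative A *v flow A t v) (at t within S)"
  using has_vector_derivative_flow_comp[of "\<lambda>_. v" 0 t S A] by (simp add: flow_matrix_commute)

lemma continuous_on_flow [continuous_intros]:
  assumes "continuous_on S \<tau>" "continuous_on S w"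
  shows "continuous_on S (\<lambda>x. flow A (\<tau> x) (w x))"
proof -
  have "continuous_on UNIV (\<lambda>t. exp (t *\<^sub>R endo_of_matrix A))"
    by (rule continuous_on_vector_derivative) (rule exp_scaleR_has_vector_derivative_right)
  from continuous_on_compose2[OF this assms(1)] show ?thesis
    unfolding flow_def by (intro endo_apply.continuous_on assms) auto
qed

section \<open>Almost periodic functions in Bochner's sense\<close>

text \<open>A pointwise non-strict bound instead of a strict bound on the supremum; halving the
  tolerance passes from one to the other.\<close>

definition periods :: "(real \<Rightarrow> 'a::metric_space) \<Rightarrow> real \<Rightarrow> real set" where
  "periods h e = {\<sigma>. \<forall>t. dist (h (t + \<sigma>)) (h t) \<le> e}"

text \<open>Bochner's form of almost periodicity: the translates of \<open>h\<close> are totally bounded in the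
  uniform metric. Unlike relative density of the periods, it passes to finite families at once.\<close>

definition bochner_ap :: "(real \<Rightarrow> 'a::metric_space) \<Rightarrow> bool" where
  "bochner_ap h \<longleftrightarrow> continuous_on UNIV h \<and>
     (\<forall>e>0. \<exists>T. finite T \<and> (\<forall>s. \<exists>r\<in>T. \<forall>t. dist (h (t + s)) (h (t + r)) \<le> e))"

lemma relatively_dense_mono: "relatively_dense S \<Longrightarrow> S \<subseteq> T \<Longrightarrow> relatively_dense T"
  unfolding relatively_dense_def by blast

lemma periodsD: "\<sigma> \<in> periods h e \<Longrightarrow> dist (h (t + \<sigma>)) (h t) \<le> e"
  by (simp add: periods_def)

lemma bochner_ap_continuous: "bochner_ap h \<Longrightarrow> continuous_on UNIV h"
  by (simp add: bochner_ap_def)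

text \<open>If two translates are within \<open>e\<close> of each other, their shifts differ by an
  \<open>e\<close>-period. The representatives lie in \<open>[-B, B]\<close>, so comparing the
  centre \<open>a + B + 1\<close> of the window with its representative puts a period inside the
  window.\<close>

lemma bochner_ap_periods:
  assumes "bochner_ap h" "e > 0"
  shows "relatively_dense (periods h e)"
proof -
  obtain T where T: "finite T" "\<And>s. \<exists>r\<in>T. \<forall>t. dist (h (t + s)) (h (t + r)) \<le> e"
    using assms unfolding bochner_ap_def by meson
  obtain B where B: "B > 0" "\<And>r. r \<in> T \<Longrightarrow> \<bar>r\<bar> \<le> B"
    using finite_imp_bounded[OF T(1)] unfolding bounded_pos by auto
  show ?thesis
    unfolding relatively_dense_def
  proof (intro exI[of _ "2 * B + 2"] conjI allI)
    fix a
    obtain r where r: "r \<in> T" "\<And>t. dist (h (t + (a + B + 1))) (h (t + r)) \<le> e"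
      using T(2)[of "a + B + 1"] by blast
    have "dist (h (t + (a + B + 1 - r))) (h t) \<le> e" for t
      using r(2)[of "t - r"] by (simp add: algebra_simps)
    then have "a + B + 1 - r \<in> periods h e" by (simp add: periods_def)
    moreover have "a + B + 1 - r \<in> {a<..<a + (2 * B + 2)}"
      using B(2)[OF r(1)] by (auto simp: abs_le_iff)
    ultimately show "periods h e \<inter> {a<..<a + (2 * B + 2)} \<noteq> {}" by blast
  qed (use B in auto)
qed

text \<open>An almost period carries \<open>x\<close> into \<open>[0, l]\<close>, where compactness
  applies; the margin 1 leaves room for the neighbour \<open>y\<close>. Two translations and one
  comparison cost \<open>e / 4\<close> each.\<close>

lemma uniformly_continuous_of_periods:
  assumes cont: "continuous_on UNIV h" and dense: "\<And>e. e > 0 \<Longrightarrow> relatively_dense (periods h e)"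
  shows "uniformly_continuous_on UNIV h"
  unfolding uniformly_continuous_on_def
proof (intro allI impI)
  fix e :: real assume "e > 0"
  then obtain l where l: "l > 0" "\<And>a. periods h (e / 4) \<inter> {a<..<a + l} \<noteq> {}"
    using dense[of "e / 4"] by (auto simp: relatively_dense_def)
  have "uniformly_continuous_on {-1..l + 1} h"
    by (intro compact_uniformly_continuous continuous_on_subset[OF cont]) auto
  then obtain d where d: "d > 0"
    "\<And>x y. x \<in> {-1..l + 1} \<Longrightarrow> y \<in> {-1..l + 1} \<Longrightarrow> dist y x < d \<Longrightarrow> dist (h y) (h x) < e / 4"
    unfolding uniformly_continuous_on_def using \<open>e > 0\<close>
    by (auto dest!: spec[of _ "e / 4"])
  show "\<exists>d>0. \<forall>x\<in>UNIV. \<forall>x'\<in>UNIV. dist x' x < d \<longrightarrow> dist (h x') (h x) < e"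
  proof (intro exI[of _ "min d 1"] conjI ballI impI)
    fix x y :: real assume xy: "dist y x < min d 1"
    obtain p where p: "p \<in> periods h (e / 4)" "x - l < p" "p < x"
      using l(2)[of "x - l"] by auto
    have "dist (h (y - p)) (h (x - p)) < e / 4"
      by (rule d(2)) (use xy p in \<open>auto simp: dist_real_def abs_less_iff\<close>)
    moreover have "dist (h x) (h (x - p)) \<le> e / 4" "dist (h y) (h (y - p)) \<le> e / 4"
      using periodsD[OF p(1), of "x - p"] periodsD[OF p(1), of "y - p"] by simp_all
    ultimately have "dist (h y) (h x) < e / 4 + e / 4 + e / 4"
      using dist_triangle[of "h y" "h x" "h (y - p)"] dist_triangle[of "h (y - p)" "h x" "h (x - p)"]
      by (simp add: dist_commute)
    then show "dist (h y) (h x) < e" using \<open>e > 0\<close> by simp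
  qed (use d in auto)
qed

text \<open>Every shift is an \<open>e / 2\<close>-period plus a remainder in \<open>(0, l)\<close>.
  Rounding the remainder down to a multiple of the modulus of uniform continuity \<open>d\<close>
  costs another \<open>e / 2\<close>, and only finitely many multiples occur.\<close>

lemma bochner_apI_periods:
  assumes cont: "continuous_on UNIV h" and dense: "\<And>e. e > 0 \<Longrightarrow> relatively_dense (periods h e)"
  shows "bochner_ap h"
  unfolding bochner_ap_def
proof (intro conjI allI impI cont)
  fix e :: real assume "e > 0"
  then obtain l where l: "l > 0" "\<And>a. periods h (e / 2) \<inter> {a<..<a + l} \<noteq> {}"
    using dense[of "e / 2"] by (auto simp: relatively_dense_def)
  obtain d where d: "d > 0" "\<And>x y. dist y x < d \<Longrightarrow> dist (h y) (h x) < e / 2"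
    using uniformly_continuous_of_periods[OF assms, unfolded uniformly_continuous_on_def,
        THEN spec, of "e / 2"] \<open>e > 0\<close> by (auto simp del: less_divide_eq_numeral1)
  obtain N :: nat where N: "l / d < real N" using reals_Archimedean2 by blast
  show "\<exists>T. finite T \<and> (\<forall>s. \<exists>r\<in>T. \<forall>t. dist (h (t + s)) (h (t + r)) \<le> e)"
  proof (intro exI[of _ "(\<lambda>k. real k * d) ` {..N}"] conjI allI)
    fix s
    obtain p where p: "p \<in> periods h (e / 2)" "s - l < p" "p < s"
      using l(2)[of "s - l"] by auto
    define k where "k = nat \<lfloor>(s - p) / d\<rfloor>"
    have k: "real k * d \<le> s - p" "s - p < real k * d + d"
    proof -
      have "0 \<le> (s - p) / d" using p d by simp
      then have "real k \<le> (s - p) / d" "(s - p) / d < real k + 1"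
        unfolding k_def by linarith+
      then show "real k * d \<le> s - p" "s - p < real k * d + d"
        using d by (simp_all add: field_simps)
    qed
    have "l < real N * d" using N d by (simp add: field_simps)
    then have "real k * d < real N * d"
      using k(1) p by linarith
    then have "k \<le> N" using d by simp
    moreover have "dist (h (t + s)) (h (t + real k * d)) \<le> e" for t
    proof -
      have "dist (h (t + s - p)) (h (t + real k * d)) < e / 2"
        by (rule d(2)) (use k in \<open>auto simp: dist_real_def abs_less_iff\<close>)
      moreover have "dist (h (t + s)) (h (t + s - p)) \<le> e / 2"
        using periodsD[OF p(1), of "t + s - p"] by simp
      ultimately show ?thesis
        using dist_triangle[of "h (t + s)" "h (t + real k * d)" "h (t + s - p)"] by simp
    qed
    ultimately show "\<exists>r\<in>(\<lambda>k. real k * d) ` {..N}. \<forall>t. dist (h (t + s)) (h (t + r)) \<le> e"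
      by blast
  qed simp
qed

lemma bochner_ap_control:
  assumes "bochner_ap h" "continuous_on UNIV k"
    and "\<And>e. e > 0 \<Longrightarrow> \<exists>d>0. periods h d \<subseteq> periods k e"
  shows "bochner_ap k"
  using assms by (meson bochner_apI_periods bochner_ap_periods relatively_dense_mono)

lemma bochner_ap_compose:
  assumes "bochner_ap h" "continuous_on UNIV (\<lambda>t. F (h t))"
    and "\<And>e. e > 0 \<Longrightarrow> \<exists>d>0. \<forall>s t. dist (h s) (h t) \<le> d \<longrightarrow> dist (F (h s)) (F (h t)) \<le> e"
  shows "bochner_ap (\<lambda>t. F (h t))"
  using assms(1,2)
proof (rule bochner_ap_control)
  fix e :: real assume "e > 0"
  then obtain d where "d > 0" "\<And>s t. dist (h s) (h t) \<le> d \<Longrightarrow> dist (F (h s)) (F (h t)) \<le> e"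
    using assms(3) by blast
  then show "\<exists>d>0. periods h d \<subseteq> periods (\<lambda>t. F (h t)) e"
    by (intro exI[of _ d]) (auto simp: periods_def)
qed

lemma bochner_ap_bounded:
  fixes h :: "real \<Rightarrow> 'a::metric_space"
  assumes "bochner_ap h" shows "bounded (range h)"
proof -
  obtain T where T: "finite T" "\<And>s. \<exists>r\<in>T. \<forall>t. dist (h (t + s)) (h (t + r)) \<le> 1"
    using assms unfolding bochner_ap_def by (meson zero_less_one)
  have "bounded (h ` T)" using T(1) by (intro finite_imp_bounded) auto
  then obtain x B where B: "\<And>r. r \<in> T \<Longrightarrow> dist x (h r) \<le> B" unfolding bounded_def by auto
  have "dist x (h s) \<le> B + 1" for s
  proof -
    obtain r where "r \<in> T" "dist (h s) (h r) \<le> 1" using T(2)[of s] by (metis add_0)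
    then show ?thesis using B[of r] dist_triangle[of x "h s" "h r"] by (simp add: dist_commute)
  qed
  then show ?thesis unfolding bounded_def by auto
qed

text \<open>Total boundedness recast as a finite colouring of the shifts. Colourings of several
  functions combine by forming tuples, which is how pairs and vectors are treated. Here the colour
  of a shift is its representative in an \<open>e / 2\<close>-net.\<close>

lemma bochner_ap_classes:
  fixes h :: "real \<Rightarrow> 'a::metric_space"
  assumes "bochner_ap h" "e > 0"
  obtains c :: "real \<Rightarrow> real" where "finite (range c)"
    "\<And>s r t. c s = c r \<Longrightarrow> dist (h (t + s)) (h (t + r)) \<le> e"
proof -
  obtain T where T: "finite T" "\<And>s. \<exists>r\<in>T. \<forall>t. dist (h (t + s)) (h (t + r)) \<le> e / 2"
    using assms unfolding bochner_ap_def by (meson half_gt_zero)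
  then obtain c where c: "\<And>s. c s \<in> T" "\<And>s t. dist (h (t + s)) (h (t + c s)) \<le> e / 2" by metis
  show ?thesis
  proof
    show "finite (range c)" using c(1) T(1) by (meson finite_subset image_subsetI)
    show "dist (h (t + s)) (h (t + r)) \<le> e" if "c s = c r" for s r t
      using c(2)[of t s] c(2)[of t r] dist_triangle[of "h (t + s)" "h (t + r)" "h (t + c s)"] that
      by (simp add: dist_commute)
  qed
qed

text \<open>One shift chosen from each colour class, by \<open>inv c\<close>, forms the net.\<close>

lemma bochner_apI_classes:
  fixes h :: "real \<Rightarrow> 'a::metric_space"
  assumes "continuous_on UNIV h"
    and "\<And>e. e > 0 \<Longrightarrow> \<exists>c :: real \<Rightarrow> 'c. finite (range c) \<and>
      (\<forall>s r t. c s = c r \<longrightarrow> dist (h (t + s)) (h (t + r)) \<le> e)"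
  shows "bochner_ap h"
  unfolding bochner_ap_def
proof (intro conjI allI impI assms(1))
  fix e :: real assume "e > 0"
  then obtain c :: "real \<Rightarrow> 'c" where c: "finite (range c)"
    "\<And>s r t. c s = c r \<Longrightarrow> dist (h (t + s)) (h (t + r)) \<le> e"
    using assms(2) by blast
  have "\<exists>r\<in>inv c ` range c. \<forall>t. dist (h (t + s)) (h (t + r)) \<le> e" for s
  proof (rule bexI[of _ "inv c (c s)"])
    have "c s = c (inv c (c s))" by (simp add: f_inv_into_f)
    then show "\<forall>t. dist (h (t + s)) (h (t + inv c (c s))) \<le> e" by (blast intro: c(2))
  qed auto
  then show "\<exists>T. finite T \<and> (\<forall>s. \<exists>r\<in>T. \<forall>t. dist (h (t + s)) (h (t + r)) \<le> e)"
    using c(1) by (meson finite_imageI)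
qed

lemma bochner_ap_Pair:
  assumes "bochner_ap h" "bochner_ap k"
  shows "bochner_ap (\<lambda>t. (h t, k t))"
proof (rule bochner_apI_classes[where 'c="real \<times> real"])
  show "continuous_on UNIV (\<lambda>t. (h t, k t))"
    using assms by (intro continuous_intros bochner_ap_continuous)
  fix e :: real assume "e > 0"
  then obtain c c' :: "real \<Rightarrow> real" where c: "finite (range c)" "finite (range c')"
    "\<And>s r t. c s = c r \<Longrightarrow> dist (h (t + s)) (h (t + r)) \<le> e / 2"
    "\<And>s r t. c' s = c' r \<Longrightarrow> dist (k (t + s)) (k (t + r)) \<le> e / 2"
    using bochner_ap_classes[OF assms(1), of "e / 2"] bochner_ap_classes[OF assms(2), of "e / 2"]
    by (metis half_gt_zero)
  have "finite (range (\<lambda>s. (c s, c' s)))"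
    by (rule finite_subset[of _ "range c \<times> range c'"]) (use c in auto)
  moreover have "dist (h (t + s), k (t + s)) (h (t + r), k (t + r)) \<le> e"
    if "c s = c r" "c' s = c' r" for s r t
    unfolding dist_Pair_Pair
    using c(3)[OF that(1), of t] c(4)[OF that(2), of t]
    by (intro order_trans[OF sqrt_sum_squares_le_sum]) auto
  ultimately show "\<exists>c :: real \<Rightarrow> real \<times> real. finite (range c) \<and>
      (\<forall>s r t. c s = c r \<longrightarrow> dist (h (t + s), k (t + s)) (h (t + r), k (t + r)) \<le> e)"
    by (intro exI[of _ "\<lambda>s. (c s, c' s)"]) auto
qed

lemma bochner_ap_vec:
  fixes h :: "real \<Rightarrow> 'a::metric_space^'n"
  assumes "\<And>i. bochner_ap (\<lambda>t. h t $ i)"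
  shows "bochner_ap h"
proof (rule bochner_apI_classes[where 'c="'n \<Rightarrow> real"])
  show "continuous_on UNIV h"
    using continuous_on_vec_lambda[where S=UNIV and f="\<lambda>i t. h t $ i"] assms[THEN bochner_ap_continuous] by simp
  fix e :: real assume "e > 0"
  then have "\<exists>c :: real \<Rightarrow> real. finite (range c) \<and>
      (\<forall>s r t. c s = c r \<longrightarrow> dist (h (t + s) $ i) (h (t + r) $ i) \<le> e / CARD('n))" for i
    using bochner_ap_classes[OF assms, of "e / CARD('n)" i] by (metis divide_pos_pos of_nat_0_less_iff zero_less_card_finite)
  then obtain c :: "'n \<Rightarrow> real \<Rightarrow> real" where c: "\<And>i. finite (range (c i))"
    "\<And>i s r t. c i s = c i r \<Longrightarrow> dist (h (t + s) $ i) (h (t + r) $ i) \<le> e / CARD('n)" by metis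
  have "finite (range (\<lambda>s i. c i s))"
    by (rule finite_subset[of _ "PiE UNIV (\<lambda>i. range (c i))"]) (use c in \<open>auto intro!: finite_PiE\<close>)
  moreover have "dist (h (t + s)) (h (t + r)) \<le> e" if "(\<lambda>i. c i s) = (\<lambda>i. c i r)" for s r t
  proof -
    have "dist (h (t + s)) (h (t + r)) \<le> (\<Sum>i\<in>UNIV. dist (h (t + s) $ i) (h (t + r) $ i))"
      unfolding dist_vec_def by (intro L2_set_le_sum) auto
    also have "\<dots> \<le> (\<Sum>i\<in>(UNIV::'n set). e / CARD('n))"
      using that by (intro sum_mono c(2)) (auto dest: fun_cong)
    finally show ?thesis by simp
  qed
  ultimately show "\<exists>c :: real \<Rightarrow> 'n \<Rightarrow> real. finite (range c) \<and>
      (\<forall>s r t. c s = c r \<longrightarrow> dist (h (t + s)) (h (t + r)) \<le> e)" by blast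
qed

lemma bochner_ap_bounded_linear:
  assumes "bochner_ap h" "bounded_linear F"
  shows "bochner_ap (\<lambda>t. F (h t))"
proof (rule bochner_ap_compose[OF assms(1)])
  interpret bounded_linear F by fact
  show "continuous_on UNIV (\<lambda>t. F (h t))"
    by (intro continuous_on assms bochner_ap_continuous)
  fix e :: real assume "e > 0"
  obtain K where K: "K > 0" "\<And>x. norm (F x) \<le> norm x * K" using pos_bounded by blast
  show "\<exists>d>0. \<forall>s t. dist (h s) (h t) \<le> d \<longrightarrow> dist (F (h s)) (F (h t)) \<le> e"
  proof (intro exI[of _ "e / K"] conjI allI impI)
    fix s t assume "dist (h s) (h t) \<le> e / K"
    then show "dist (F (h s)) (F (h t)) \<le> e"
      using K(2)[of "h s - h t"] K(1) by (simp add: dist_norm diff[symmetric] field_simps)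
  qed (use K \<open>e > 0\<close> in auto)
qed

lemma bochner_ap_add:
  fixes h k :: "real \<Rightarrow> 'a::real_normed_vector"
  assumes "bochner_ap h" "bochner_ap k"
  shows "bochner_ap (\<lambda>t. h t + k t)"
  using bochner_ap_bounded_linear[OF bochner_ap_Pair[OF assms], of "\<lambda>z. fst z + snd z"]
  by (simp add: bounded_linear_add bounded_linear_fst bounded_linear_snd)

lemma bochner_ap_mult:
  fixes h k :: "real \<Rightarrow> 'a::real_normed_algebra"
  assumes "bochner_ap h" "bochner_ap k"
  shows "bochner_ap (\<lambda>t. h t * k t)"
proof -
  obtain B where B: "B > 0" "\<And>t. norm (h t) \<le> B" "\<And>t. norm (k t) \<le> B"
  proof -
    from assms obtain B1 B2 where "B1 > 0" "B2 > 0" "\<And>t. norm (h t) \<le> B1" "\<And>t. norm (k t) \<le> B2"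
      by (metis (no_types) bochner_ap_bounded bounded_pos rangeI)
    then show ?thesis by (intro that[of "max B1 B2"]) (auto simp: le_max_iff_disj)
  qed
  show ?thesis
  proof (rule bochner_ap_compose[OF bochner_ap_Pair[OF assms], of "\<lambda>z. fst z * snd z", simplified])
    show "continuous_on UNIV (\<lambda>t. h t * k t)"
      by (intro continuous_intros bochner_ap_continuous assms)
    fix e :: real assume "e > 0"
    show "\<exists>d>0. \<forall>s t. dist (h s, k s) (h t, k t) \<le> d \<longrightarrow> dist (h s * k s) (h t * k t) \<le> e"
    proof (intro exI[of _ "e / (2 * B)"] conjI allI impI)
      fix s t assume d: "dist (h s, k s) (h t, k t) \<le> e / (2 * B)"
      have d1: "norm (h s - h t) \<le> e / (2 * B)" "norm (k s - k t) \<le> e / (2 * B)"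
        using order_trans[OF dist_fst_le d] order_trans[OF dist_snd_le d] by (simp_all add: dist_norm)
      have "h s * k s - h t * k t = (h s - h t) * k s + h t * (k s - k t)"
        by (simp add: algebra_simps)
      then have "norm (h s * k s - h t * k t) \<le> norm ((h s - h t) * k s) + norm (h t * (k s - k t))"
        by (metis norm_triangle_ineq)
      also have "\<dots> \<le> norm (h s - h t) * norm (k s) + norm (h t) * norm (k s - k t)"
        by (intro add_mono norm_mult_ineq)
      also have "\<dots> \<le> e / (2 * B) * B + B * (e / (2 * B))"
        using B d1 \<open>e > 0\<close> by (intro add_mono mult_mono) auto
      also have "\<dots> = e" using B by (simp add: field_simps)
      finally show "dist (h s * k s) (h t * k t) \<le> e" by (simp add: dist_norm)
    qed (use B \<open>e > 0\<close> in auto)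
  qed
qed

lemma bochner_ap_cis: "bochner_ap (\<lambda>t. cis (\<omega> * t))"
proof (cases "\<omega> = 0")
  case True
  have "relatively_dense UNIV"
    unfolding relatively_dense_def by (rule exI[of _ 1]) (simp add: ex_in_conv[symmetric])
  then show ?thesis
    using True by (intro bochner_apI_periods) (simp_all add: periods_def)
next
  case False
  show ?thesis
  proof (rule bochner_apI_periods)
    show "continuous_on UNIV (\<lambda>t. cis (\<omega> * t))" by (intro continuous_intros)
    fix e :: real assume "e > 0"
    define p where "p = 2 * pi / \<bar>\<omega>\<bar>"
    have p: "p > 0" using False by (simp add: p_def)
    have per: "cis (\<omega> * (t + real_of_int n * p)) = cis (\<omega> * t)" for t n
    proof -
      have "\<omega> * (real_of_int n * p) = 2 * pi * real_of_int (n * (if \<omega> > 0 then 1 else -1))"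
        using False by (auto simp: p_def)
      then have "cis (\<omega> * (real_of_int n * p)) = 1"
        by (simp only: cis_multiple_2pi[OF Ints_of_int])
      then show ?thesis by (simp add: distrib_left cis_mult[symmetric])
    qed
    show "relatively_dense (periods (\<lambda>t. cis (\<omega> * t)) e)"
      unfolding relatively_dense_def
    proof (intro exI[of _ "2 * p"] conjI allI)
      fix a
      define n where "n = \<lfloor>a / p\<rfloor> + 1"
      have "a / p < real_of_int n" "real_of_int n \<le> a / p + 1" unfolding n_def by linarith+
      then have "real_of_int n * p \<in> {a<..<a + 2 * p}" using p by (simp add: field_simps)
      moreover have "real_of_int n * p \<in> periods (\<lambda>t. cis (\<omega> * t)) e"
        using \<open>e > 0\<close> by (simp add: periods_def per)
      ultimately show "periods (\<lambda>t. cis (\<omega> * t)) e \<inter> {a<..<a + 2 * p} \<noteq> {}" by blast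
    qed (use p in simp)
  qed
qed

lemma bochner_ap_of_almost_periodic:
  fixes h :: "real \<Rightarrow> 'a::metric_space"
  assumes "Metric_space.almost_periodic UNIV dist h"
  shows "bochner_ap h"
proof (rule bochner_apI_periods)
  note ap = assms[unfolded Met_TC.almost_periodic_def mtopology_is_euclidean]
  show "continuous_on UNIV h" using ap by (simp add: continuous_map_iff_continuous2)
  fix e :: real assume "e > 0"
  then have "relatively_dense {\<tau>. (SUP t. ereal (dist (h (t + \<tau>)) (h t))) < ereal e}"
    using ap by blast
  then show "relatively_dense (periods h e)"
  proof (rule relatively_dense_mono)
    show "{\<tau>. (SUP t. ereal (dist (h (t + \<tau>)) (h t))) < ereal e} \<subseteq> periods h e"
    proof
      fix \<sigma> assume \<sigma>: "\<sigma> \<in> {\<tau>. (SUP t. ereal (dist (h (t + \<tau>)) (h t))) < ereal e}"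
      have "ereal (dist (h (t + \<sigma>)) (h t)) \<le> ereal e" for t
        by (rule order_trans[OF SUP_upper[of t UNIV "\<lambda>t. ereal (dist (h (t + \<sigma>)) (h t))"]])
           (use \<sigma> in simp_all)
      then show "\<sigma> \<in> periods h e" by (simp add: periods_def)
    qed
  qed
qed

section \<open>Derivative estimates and antiderivatives\<close>

lemma norm_diff_le_of_derivative:
  fixes w :: "real \<Rightarrow> 'a::real_normed_vector"
  assumes "\<And>x. (w has_vector_derivative w' x) (at x)" "\<And>x. norm (w' x) \<le> c"
  shows "norm (w b - w a) \<le> c * \<bar>b - a\<bar>"
proof -
  have less: "norm (w b - w a) \<le> c * (b - a)" if "a < b" for a b
  proof -
    have "norm (w b - w a) \<le> c * b - c * a"
    proof (rule differentiable_bound_general[OF that, where f'=w' and \<phi>'="\<lambda>_. c"])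
      show "continuous_on {a..b} w"
        by (rule continuous_on_vector_derivative[OF has_vector_derivative_at_within[OF assms(1)]])
      show "((*) c has_vector_derivative c) (at x)" for x
        by (auto intro!: derivative_eq_intros simp: has_real_derivative_iff_has_vector_derivative[symmetric])
    qed (use assms in \<open>auto intro!: continuous_intros\<close>)
    then show ?thesis by (simp add: right_diff_distrib)
  qed
  consider "a < b" | "a = b" | "b < a" by linarith
  then show ?thesis
    using less[of a b] less[of b a] by cases (auto simp: norm_minus_commute)
qed

text \<open>Comparison with the antiderivative \<open>c / \<beta> * exp (\<beta> * x)\<close>. The
  sign of \<beta> is left open: positive rates serve for growth bounds, negative ones for tails in
  Cauchy arguments.\<close>

lemma norm_diff_le_of_exp_derivative:
  fixes w :: "real \<Rightarrow> 'a::real_normed_vector"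
  assumes "\<And>x. (w has_vector_derivative w' x) (at x)"
    and "\<And>x. a \<le> x \<Longrightarrow> norm (w' x) \<le> c * exp (\<beta> * x)" "\<beta> \<noteq> 0" "a \<le> b"
  shows "norm (w b - w a) \<le> c / \<beta> * (exp (\<beta> * b) - exp (\<beta> * a))"
proof (cases "a = b")
  case False
  then have "a < b" using assms by simp
  have "norm (w b - w a) \<le> c / \<beta> * exp (\<beta> * b) - c / \<beta> * exp (\<beta> * a)"
  proof (rule differentiable_bound_general[OF \<open>a < b\<close>, where f'=w' and \<phi>'="\<lambda>x. c * exp (\<beta> * x)"])
    show "continuous_on {a..b} w"
      by (rule continuous_on_vector_derivative[OF has_vector_derivative_at_within[OF assms(1)]])
    show "((\<lambda>x. c / \<beta> * exp (\<beta> * x)) has_vector_derivative c * exp (\<beta> * x)) (at x)" for x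
      using assms(3)
      by (auto intro!: derivative_eq_intros simp: has_real_derivative_iff_has_vector_derivative[symmetric])
  qed (use assms in \<open>auto intro!: continuous_intros\<close>)
  then show ?thesis by (simp add: right_diff_distrib)
qed simp

lemma continuous_antiderivative:
  fixes h :: "real \<Rightarrow> 'a::banach"
  assumes "continuous_on UNIV h"
  obtains F where "\<And>t. (F has_vector_derivative h t) (at t)"
proof
  \<comment> \<open>The oriented integral from 0 to \<open>t\<close>: of the two terms, one always
    vanishes.\<close>
  define F where "F t = integral {0..t} h - integral {t..0} h" for t
  show "(F has_vector_derivative h t) (at t)" for t
  proof -
    define N where "N = \<bar>t\<bar> + 1"
    have int: "h integrable_on {a..b}" for a b
      by (intro integrable_continuous_real continuous_on_subset[OF assms]) simp
    have F: "F s = integral {-N..s} h - integral {-N..0} h" if "s \<in> {-N<..<N}" for s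
    proof (cases "s \<ge> 0")
      case True
      then show ?thesis
        using Henstock_Kurzweil_Integration.integral_combine[of "-N" 0 s h] int that
        by (cases "s = 0") (auto simp: F_def N_def algebra_simps)
    next
      case False
      then show ?thesis
        using Henstock_Kurzweil_Integration.integral_combine[of "-N" s 0 h] int that
        by (auto simp: F_def N_def algebra_simps)
    qed
    have "((\<lambda>s. integral {-N..s} h) has_vector_derivative h t) (at t within {-N..N})"
      by (intro integral_has_vector_derivative continuous_on_subset[OF assms]) (auto simp: N_def)
    then have "((\<lambda>s. integral {-N..s} h) has_vector_derivative h t) (at t within {-N<..<N})"
      by (rule has_vector_derivative_within_subset) auto
    then have "((\<lambda>s. integral {-N..s} h - integral {-N..0} h) has_vector_derivative h t) (at t within {-N<..<N})"
      using has_vector_derivative_diff[OF _ has_vector_derivative_const] by fastforce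
    then have "(F has_vector_derivative h t) (at t within {-N<..<N})"
      by (rule has_vector_derivative_transform[rotated 2]) (auto simp: F N_def)
    then show ?thesis
      by (subst (asm) at_within_open) (auto simp: N_def)
  qed
qed

lemma has_vector_derivative_translate:
  assumes "(F has_vector_derivative F') (at (t + \<sigma>))"
  shows "((\<lambda>t. F (t + \<sigma>)) has_vector_derivative F') (at t)"
proof -
  have "((\<lambda>t. t + \<sigma>) has_vector_derivative 1 + 0) (at t)"
    by (intro has_vector_derivative_add has_vector_derivative_id has_vector_derivative_const)
  from vector_diff_chain_at[OF this] assms show ?thesis by (auto simp: o_def)
qed

lemma has_vector_derivative_reflect:
  assumes "(F has_vector_derivative F') (at (- t))"
  shows "((\<lambda>t. F (- t)) has_vector_derivative - F') (at t)"
proof -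
  have "(uminus has_vector_derivative - 1) (at t)"
    by (intro has_vector_derivative_minus has_vector_derivative_id)
  from vector_diff_chain_at[OF this] assms show ?thesis by (auto simp: o_def)
qed

section \<open>The theorems of Bohr and of Bohr and Neugebauer\<close>

text \<open>Bohr's theorem. For an almost period \<sigma> of \<open>h\<close> the increment
  \<open>F (t + \<sigma>) - F t\<close> varies slowly in \<open>t\<close>. Within a fixed distance
  of any \<open>t\<close> the function \<open>F\<close> comes close to its infimum, where the
  increment cannot be very negative, and close to its supremum, where it cannot be very positive;
  hence it is small at \<open>t\<close>.\<close>

lemma bochner_ap_antiderivative:
  fixes F :: "real \<Rightarrow> real"
  assumes F: "\<And>t. (F has_vector_derivative h t) (at t)" and h: "bochner_ap h" and bdd: "bounded (range F)"
  shows "bochner_ap F"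
proof (rule bochner_ap_control[OF h])
  show "continuous_on UNIV F"
    by (rule continuous_on_vector_derivative[OF has_vector_derivative_at_within[OF F]])
  have diff: "\<bar>(F (s + \<sigma>) - F s) - (F (t + \<sigma>) - F t)\<bar> \<le> d * \<bar>s - t\<bar>" if "\<sigma> \<in> periods h d" for \<sigma> d s t
  proof -
    have "((\<lambda>t. F (t + \<sigma>)) has_vector_derivative h (t + \<sigma>)) (at t)" for t
      by (rule has_vector_derivative_translate[OF F])
    then have "((\<lambda>t. F (t + \<sigma>) - F t) has_vector_derivative h (t + \<sigma>) - h t) (at t)" for t
      by (intro has_vector_derivative_diff F)
    then show ?thesis
      using norm_diff_le_of_derivative[of "\<lambda>t. F (t + \<sigma>) - F t" "\<lambda>t. h (t + \<sigma>) - h t" d s t]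
        periodsD[OF that] by (simp add: dist_real_def)
  qed
  fix e :: real assume "e > 0"
  define S I where "S = Sup (range F)" and "I = Inf (range F)"
  have above: "bdd_above (range F)" and below: "bdd_below (range F)"
    using bdd by (auto intro: bounded_imp_bdd_above bounded_imp_bdd_below)
  have S: "F t \<le> S" and I: "I \<le> F t" for t
    unfolding S_def I_def by (auto intro: cSUP_upper cINF_lower above below)
  obtain t1 where t1: "F t1 < I + e / 8"
    using cInf_lessD[of "range F" "I + e / 8"] \<open>e > 0\<close> by (auto simp: I_def)
  obtain t2 where t2: "F t2 > S - e / 8"
    using less_cSupD[of "range F" "S - e / 8"] \<open>e > 0\<close> by (auto simp: S_def)
  \<comment> \<open>The summand 1 only keeps the divisor of \<open>d\<close> positive. The
    near-extremality of \<open>t1\<close>, that of \<open>t2\<close> and the drift over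
    \<open>\<bar>t2 - t1\<bar>\<close> cost \<open>e / 8\<close> each, in total less than
    \<open>e / 2\<close>.\<close>
  define q where "q = \<bar>t2 - t1\<bar> + 1"
  define d where "d = e / (8 * q)"
  have q: "q > 0" "\<bar>t2 - t1\<bar> \<le> q" by (auto simp: q_def add_nonneg_pos)
  have d: "d > 0" "d * \<bar>t2 - t1\<bar> \<le> e / 8"
    using q \<open>e > 0\<close> mult_left_mono[OF q(2), of d] by (auto simp: d_def)
  obtain l where l: "l > 0" "\<And>a. periods h d \<inter> {a<..<a + l} \<noteq> {}"
    using bochner_ap_periods[OF h d(1)] by (auto simp: relatively_dense_def)
  text \<open>Translation by an almost period of \<open>h\<close> hardly changes \<open>F t2 - F t1 \<approx> S - I\<close>, so \<open>F\<close>
    is again near its extremes at the translated points.\<close>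
  have extreme: "\<exists>r1 r2. \<bar>r1 - t\<bar> \<le> l \<and> F r1 < I + e / 2 \<and> \<bar>r2 - t\<bar> \<le> l \<and> F r2 > S - e / 2" for t
  proof -
    obtain \<sigma> where \<sigma>: "\<sigma> \<in> periods h d" "t - t1 < \<sigma>" "\<sigma> < t - t1 + l"
      using l(2)[of "t - t1"] by auto
    obtain \<sigma>' where \<sigma>': "\<sigma>' \<in> periods h d" "t - t2 < \<sigma>'" "\<sigma>' < t - t2 + l"
      using l(2)[of "t - t2"] by auto
    have "F (t1 + \<sigma>) < I + e / 2"
      using diff[OF \<sigma>(1), of t2 t1] d(2) t1 t2 S[of "t2 + \<sigma>"] \<open>e > 0\<close> by linarith
    moreover have "F (t2 + \<sigma>') > S - e / 2"
      using diff[OF \<sigma>'(1), of t2 t1] d(2) t1 t2 I[of "t1 + \<sigma>'"] \<open>e > 0\<close> by linarith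
    ultimately show ?thesis
      using \<sigma> \<sigma>' by (intro exI[of _ "t1 + \<sigma>"] exI[of _ "t2 + \<sigma>'"]) auto
  qed
  show "\<exists>d>0. periods h d \<subseteq> periods F e"
  \<comment> \<open>Over a distance of at most \<open>l\<close> the increment changes by at most
    \<open>e / 2\<close>; the other \<open>e / 2\<close> is the distance of \<open>F\<close> from
    its extremes at \<open>r1\<close> and \<open>r2\<close>.\<close>
  proof (intro exI[of _ "e / (2 * l)"] conjI subsetI)
    fix \<sigma> assume \<sigma>: "\<sigma> \<in> periods h (e / (2 * l))"
    have "\<bar>F (t + \<sigma>) - F t\<bar> \<le> e" for t
    proof -
      obtain r1 r2 where r: "\<bar>r1 - t\<bar> \<le> l" "F r1 < I + e / 2" "\<bar>r2 - t\<bar> \<le> l" "F r2 > S - e / 2"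
        using extreme by blast
      have "e / (2 * l) * \<bar>r - t\<bar> \<le> e / 2" if "\<bar>r - t\<bar> \<le> l" for r
      proof -
        have "e / (2 * l) * \<bar>r - t\<bar> \<le> e / (2 * l) * l"
          using that l \<open>e > 0\<close> by (intro mult_left_mono) auto
        then show ?thesis using l by simp
      qed
      note small = this[OF r(1)] this[OF r(3)]
      show ?thesis
        using small diff[OF \<sigma>, of r1 t] diff[OF \<sigma>, of r2 t] r I[of "r1 + \<sigma>"] S[of "r2 + \<sigma>"]
        unfolding abs_le_iff by linarith
    qed
    then show "\<sigma> \<in> periods F e" by (simp add: periods_def dist_real_def)
  qed (use l \<open>e > 0\<close> in auto)
qed

lemma has_vector_derivative_exp_mult:
  fixes y :: "real \<Rightarrow> complex"
  assumes "(y has_vector_derivative \<mu> * y t + k) (at t)"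
  shows "((\<lambda>t. exp (- \<mu> * of_real t) * y t) has_vector_derivative exp (- \<mu> * of_real t) * k) (at t)"
proof -
  have "((\<lambda>t. exp (- \<mu> * complex_of_real t)) has_vector_derivative - \<mu> * exp (- \<mu> * of_real t)) (at t)"
    by (rule has_vector_derivative_real_field) (auto intro!: derivative_eq_intros)
  from has_vector_derivative_mult[OF this assms] show ?thesis
    by (simp add: algebra_simps)
qed

text \<open>For \<open>Re \<mu> > 0\<close> the function \<open>exp(- \<mu> t) z(t)\<close> is
  compared at \<open>t\<close> and at a late time \<open>T\<close>, whose contribution vanishes
  because \<open>z\<close> is bounded. The bound obtained is proportional to the forcing and free of
  \<open>B\<close>, so good periods of a forcing become good periods of the solution.\<close>

lemma bounded_solution_le:
  fixes z :: "real \<Rightarrow> complex"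
  assumes "\<And>t. (z has_vector_derivative \<mu> * z t + k t) (at t)"
    and "\<And>t. norm (k t) \<le> e" "\<And>t. norm (z t) \<le> B" "Re \<mu> \<noteq> 0"
  shows "norm (z t) \<le> e / \<bar>Re \<mu>\<bar>"
proof -
  have pos: "norm (z t) \<le> e / Re \<mu>"
    if z: "\<And>t. (z has_vector_derivative \<mu> * z t + k t) (at t)"
      and k: "\<And>t. norm (k t) \<le> e" and B: "\<And>t. norm (z t) \<le> B" and "Re \<mu> > 0" for z \<mu> k t
  proof -
    define w where "w t = exp (- \<mu> * of_real t) * z t" for t
    have "norm (z t) \<le> B * exp (- Re \<mu> * (T - t)) + e / Re \<mu>" if "t \<le> T" for T
    proof -
      have "norm (w T - w t) \<le> e / (- Re \<mu>) * (exp (- Re \<mu> * T) - exp (- Re \<mu> * t))"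
        unfolding w_def using k \<open>Re \<mu> > 0\<close> that
        by (intro norm_diff_le_of_exp_derivative[OF has_vector_derivative_exp_mult[OF z]])
           (auto simp: norm_mult mult.commute)
      then have "norm (w t) \<le> norm (w T) + e / (- Re \<mu>) * (exp (- Re \<mu> * T) - exp (- Re \<mu> * t))"
        using norm_triangle_sub[of "w t" "w T"] by (simp add: norm_minus_commute)
      also have "norm (w T) \<le> exp (- Re \<mu> * T) * B"
        using B by (simp add: w_def norm_mult)
      also have "e / (- Re \<mu>) * (exp (- Re \<mu> * T) - exp (- Re \<mu> * t)) \<le> e / Re \<mu> * exp (- Re \<mu> * t)"
        using \<open>Re \<mu> > 0\<close> order_trans[OF norm_ge_zero k] by (simp add: field_simps)
      finally have "exp (Re \<mu> * t) * norm (w t) \<le> exp (Re \<mu> * t) * (exp (- Re \<mu> * T) * B + e / Re \<mu> * exp (- Re \<mu> * t))"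
        by simp
      moreover have "exp (Re \<mu> * t) * norm (w t) = norm (z t)"
        by (simp add: w_def norm_mult mult.assoc[symmetric] exp_add[symmetric])
      moreover have "exp (Re \<mu> * t) * (exp (- Re \<mu> * T) * B + e / Re \<mu> * exp (- Re \<mu> * t))
          = B * exp (- Re \<mu> * (T - t)) + e / Re \<mu>"
      proof -
        have "exp (Re \<mu> * t) * exp (- Re \<mu> * T) = exp (- Re \<mu> * (T - t))"
          "exp (Re \<mu> * t) * exp (- Re \<mu> * t) = 1"
          by (simp_all add: exp_add[symmetric] algebra_simps)
        moreover have "p * (q * B + c * r) = B * h + c" if "p * q = h" "p * r = 1" for p q r c h :: real
        proof -
          have "p * (q * B + c * r) = B * (p * q) + c * (p * r)" by (simp add: algebra_simps)
          then show ?thesis using that by simp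
        qed
        ultimately show ?thesis by blast
      qed
      ultimately show ?thesis by simp
    qed
    then have "eventually (\<lambda>T. norm (z t) \<le> B * exp (- Re \<mu> * (T - t)) + e / Re \<mu>) at_top"
      by (auto simp: eventually_at_top_linorder)
    moreover have "((\<lambda>T. B * exp (- Re \<mu> * (T - t)) + e / Re \<mu>) \<longlongrightarrow> B * 0 + e / Re \<mu>) at_top"
    proof (intro tendsto_intros filterlim_compose[OF exp_at_bot])
      show "LIM T at_top. - Re \<mu> * (T - t) :> at_bot"
        using \<open>Re \<mu> > 0\<close>
        by (intro filterlim_tendsto_neg_mult_at_bot[OF tendsto_const])
           (auto intro!: filterlim_at_top_add_at_top simp: filterlim_at_top eventually_at_top_linorder le_diff_eq)
    qed
    ultimately show ?thesis
      using tendsto_lowerbound by fastforce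
  qed
  show ?thesis
  proof (cases "Re \<mu> > 0")
    case True
    then show ?thesis using pos[OF assms(1-3)] by simp
  next
    case False
    \<comment> \<open>Reversing time changes the sign of \<mu>.\<close>
    have "((\<lambda>t. z (- t)) has_vector_derivative (- \<mu>) * z (- t) + - k (- t)) (at t)" for t
      using has_vector_derivative_reflect[OF assms(1), of t] by simp
    from pos[OF this, of "- t"] show ?thesis
      using assms False by auto
  qed
qed

text \<open>Off the imaginary axis, \<open>y (t + \<sigma>) - y t\<close> is a bounded solution with
  a small forcing. On the axis, the rotation \<open>cis (- \<omega> * t)\<close> removes the term
  \<open>\<mu> * y\<close>, and Bohr's theorem applies to real and imaginary part of a bounded
  antiderivative; rotating back preserves almost periodicity.\<close>

lemma bochner_ap_linear_ode:
  fixes y :: "real \<Rightarrow> complex"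
  assumes y: "\<And>t. (y has_vector_derivative \<mu> * y t + h t) (at t)"
    and h: "bochner_ap h" and bdd: "bounded (range y)"
  shows "bochner_ap y"
proof (cases "Re \<mu> = 0")
  case False
  obtain B where B: "\<And>t. norm (y t) \<le> B" using bdd by (auto simp: bounded_iff)
  show ?thesis
  proof (rule bochner_ap_control[OF h])
    show "continuous_on UNIV y"
      by (rule continuous_on_vector_derivative[OF has_vector_derivative_at_within[OF y]])
    fix e :: real assume "e > 0"
    show "\<exists>d>0. periods h d \<subseteq> periods y e"
    proof (intro exI[of _ "e * \<bar>Re \<mu>\<bar>"] conjI subsetI)
      fix \<sigma> assume \<sigma>: "\<sigma> \<in> periods h (e * \<bar>Re \<mu>\<bar>)"
      have "((\<lambda>t. y (t + \<sigma>)) has_vector_derivative \<mu> * y (t + \<sigma>) + h (t + \<sigma>)) (at t)" for t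
        by (rule has_vector_derivative_translate[OF y])
      then have "((\<lambda>t. y (t + \<sigma>) - y t) has_vector_derivative \<mu> * (y (t + \<sigma>) - y t) + (h (t + \<sigma>) - h t)) (at t)" for t
        using has_vector_derivative_diff[OF _ y, of "\<lambda>t. y (t + \<sigma>)" _ t] by (fastforce simp: algebra_simps)
      then have "norm (y (t + \<sigma>) - y t) \<le> (e * \<bar>Re \<mu>\<bar>) / \<bar>Re \<mu>\<bar>" for t
        by (rule bounded_solution_le)
           (use periodsD[OF \<sigma>] B False in \<open>auto simp: dist_norm intro: norm_triangle_le_diff[OF add_mono]\<close>)
      then show "\<sigma> \<in> periods y e" using False by (simp add: periods_def dist_norm)
    qed (use False \<open>e > 0\<close> in auto)
  qed
next
  case True
  define \<omega> where "\<omega> = Im \<mu>"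
  have rot: "exp (- \<mu> * of_real t) = cis (- \<omega> * t)" for t
    using True by (simp add: cis_conv_exp \<omega>_def complex_eq_iff Re_exp Im_exp)
  define u where "u t = cis (- \<omega> * t) * y t" for t
  have u: "(u has_vector_derivative cis (- \<omega> * t) * h t) (at t)" for t
    using has_vector_derivative_exp_mult[OF y[of t]] unfolding u_def rot .
  have ap: "bochner_ap (\<lambda>t. cis (- \<omega> * t) * h t)"
    by (intro bochner_ap_mult bochner_ap_cis h)
  have norm: "norm (u t) = norm (y t)" for t by (simp add: u_def norm_mult)
  have part: "bochner_ap (\<lambda>t. R (u t))" if R: "bounded_linear R" for R :: "complex \<Rightarrow> real"
  proof (rule bochner_ap_antiderivative)
    show "((\<lambda>t. R (u t)) has_vector_derivative R (cis (- \<omega> * t) * h t)) (at t)" for t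
      by (rule bounded_linear.has_vector_derivative[OF R u])
    show "bochner_ap (\<lambda>t. R (cis (- \<omega> * t) * h t))"
      by (rule bochner_ap_bounded_linear[OF ap R])
    have "bounded (range u)" using bdd by (auto simp: bounded_iff norm)
    then have "bounded (R ` range u)" by (rule bounded_linear_image[OF _ R])
    then show "bounded (range (\<lambda>t. R (u t)))" by (simp add: image_image)
  qed
  have "bochner_ap (\<lambda>t. of_real (Re (u t)) + \<i> * of_real (Im (u t)))"
    by (intro bochner_ap_add bochner_ap_bounded_linear[OF part[OF bounded_linear_Re]]
        bochner_ap_bounded_linear[OF part[OF bounded_linear_Im]]
        bounded_linear_of_real bounded_linear_const_mult)
  then have "bochner_ap u" by (simp add: complex_eq[symmetric])
  then have "bochner_ap (\<lambda>t. cis (\<omega> * t) * u t)"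
    by (intro bochner_ap_mult bochner_ap_cis)
  then show ?thesis
    by (simp add: u_def mult.assoc[symmetric] cis_mult)
qed

section \<open>Reduction to eigenfunctionals\<close>

text \<open>The powers of \<open>A\<close> are linearly dependent in the finite-dimensional space of
  matrices. The relation is tested with complex-valued functionals, because the polynomial has to be
  complex in order to split while \<open>A\<close> acts on real vectors.\<close>

lemma ex_annihilating_poly:
  fixes A :: "real^'n^'n"
  obtains p :: "complex poly" where "p \<noteq> 0"
    "\<And>l v. linear l \<Longrightarrow> (\<Sum>k\<le>degree p. coeff p k * l (((*v) A ^^ k) v)) = 0"
proof -
  define N where "N = DIM(real^'n^'n)"
  define B where "B k = (((**) A) ^^ k) (mat 1)" for k
  have B: "B k *v v = ((*v) A ^^ k) v" for k v
    by (induction k) (auto simp: B_def matrix_vector_mul_assoc[symmetric])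
  have "\<exists>c :: nat \<Rightarrow> real. (\<exists>k\<le>N. c k \<noteq> 0) \<and> (\<Sum>k\<le>N. c k *\<^sub>R B k) = 0"
  \<comment> \<open>Dependence concerns sets of vectors, so coinciding powers are treated
    separately: then the difference of two of them is the relation.\<close>
  proof (cases "inj_on B {..N}")
    case True
    then have "dependent (B ` {..N})"
      by (intro dependent_biggerset) (auto simp: card_image N_def)
    then obtain u where "\<exists>b\<in>B ` {..N}. u b \<noteq> 0" "(\<Sum>b\<in>B ` {..N}. u b *\<^sub>R b) = 0"
      by (subst (asm) dependent_finite) auto
    then show ?thesis
      using True by (intro exI[of _ "u \<circ> B"]) (auto simp: sum.reindex)
  next
    case False
    then obtain i j where ij: "i \<le> N" "j \<le> N" "i \<noteq> j" "B i = B j" by (auto simp: inj_on_def)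
    define c :: "nat \<Rightarrow> real" where "c k = (if k = i then 1 else 0) - (if k = j then 1 else 0)" for k
    have "(\<Sum>k\<le>N. c k *\<^sub>R B k) = 0"
      using ij by (simp add: c_def scaleR_left_diff_distrib sum_subtractf if_distrib[where f="\<lambda>x. x *\<^sub>R _"] cong: if_cong)
    moreover have "c i \<noteq> 0" using ij by (simp add: c_def)
    ultimately show ?thesis using ij by blast
  qed
  then obtain c k0 where c: "k0 \<le> N" "c k0 \<noteq> 0" "(\<Sum>k\<le>N. c k *\<^sub>R B k) = 0" by blast
  define p where "p = (\<Sum>k\<le>N. monom (complex_of_real (c k)) k)"
  have coeff: "coeff p k = (if k \<le> N then of_real (c k) else 0)" for k
    by (simp add: p_def coeff_sum)
  show ?thesis
  proof
    show "p \<noteq> 0" using coeff[of k0] c by auto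
    fix l :: "real^'n \<Rightarrow> complex" and v assume l: "linear l"
    have "degree p \<le> N" by (intro degree_le) (auto simp: coeff)
    then have "(\<Sum>k\<le>degree p. coeff p k * l (((*v) A ^^ k) v)) = (\<Sum>k\<le>N. coeff p k * l (((*v) A ^^ k) v))"
      by (intro sum.mono_neutral_left) (auto simp: coeff_eq_0)
    also have "\<dots> = (\<Sum>k\<le>N. l ((c k *\<^sub>R B k) *v v))"
    proof (rule sum.cong)
      fix k assume "k \<in> {..N}"
      have "l ((c k *\<^sub>R B k) *v v) = c k *\<^sub>R l (B k *v v)"
        by (simp only: scaleR_matrix_vector_assoc[symmetric] linear_cmul[OF l])
      then show "coeff p k * l (((*v) A ^^ k) v) = l ((c k *\<^sub>R B k) *v v)"
        using \<open>k \<in> {..N}\<close> by (simp add: coeff B scaleR_conv_of_real)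
    qed simp
    also have "\<dots> = l ((\<Sum>k\<le>N. c k *\<^sub>R B k) *v v)"
    proof -
      have "linear (\<lambda>M::real^'n^'n. M *v v)"
        by (intro linearI) (auto simp: matrix_vector_mult_add_rdistrib scaleR_matrix_vector_assoc)
      then have "(\<Sum>k\<le>N. c k *\<^sub>R B k) *v v = (\<Sum>k\<le>N. (c k *\<^sub>R B k) *v v)"
        by (rule linear_sum)
      then show ?thesis by (simp only: linear_sum[OF l])
    qed
    finally show "(\<Sum>k\<le>degree p. coeff p k * l (((*v) A ^^ k) v)) = 0"
      using c by (simp add: linear_0[OF l])
  qed
qed

text \<open>A linear factor is moved from the polynomial to the sequence. For
  \<open>x k = l (A^k v)\<close> this replaces \<open>l\<close> by
  \<open>l \<circ> A - \<mu> l\<close>.\<close>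

lemma sum_coeff_linear_factor:
  fixes q :: "complex poly"
  assumes "q \<noteq> 0"
  shows "(\<Sum>k\<le>degree ([:-\<mu>, 1:] * q). coeff ([:-\<mu>, 1:] * q) k * x k) =
    (\<Sum>k\<le>degree q. coeff q k * (x (Suc k) - \<mu> * x k))"
proof -
  have deg: "degree ([:-\<mu>, 1:] * q) = Suc (degree q)"
    using assms by (subst degree_mult_eq) auto
  have coeff: "coeff ([:-\<mu>, 1:] * q) k = (case k of 0 \<Rightarrow> 0 | Suc j \<Rightarrow> coeff q j) - \<mu> * coeff q k" for k
    by (simp add: coeff_pCons split: nat.split)
  have "(\<Sum>k\<le>Suc (degree q). (case k of 0 \<Rightarrow> 0 | Suc j \<Rightarrow> coeff q j) * x k) = (\<Sum>k\<le>degree q. coeff q k * x (Suc k))"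
    by (subst sum.atMost_Suc_shift) simp
  moreover have "(\<Sum>k\<le>Suc (degree q). \<mu> * coeff q k * x k) = (\<Sum>k\<le>degree q. \<mu> * coeff q k * x k)"
    by (simp add: coeff_eq_0)
  ultimately show ?thesis
    unfolding deg coeff left_diff_distrib right_diff_distrib sum_subtractf by (simp add: mult_ac)
qed

text \<open>Every functional is killed by a product of factors \<open>l \<mapsto> l \<circ> A - \<mu> l\<close> by the
  fundamental theorem of algebra. Stripping off one factor at a time replaces a Jordan
  decomposition of \<open>A\<close>.\<close>

lemma functional_induct [consumes 1, case_names zero step]:
  fixes A :: "real^'n^'n" and P :: "(real^'n \<Rightarrow> complex) \<Rightarrow> bool"
  assumes "linear l"
    and zero: "P (\<lambda>_. 0)"
    and step: "\<And>l \<mu>. linear l \<Longrightarrow> P (\<lambda>v. l (A *v v) - \<mu> * l v) \<Longrightarrow> P l"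
  shows "P l"
proof -
  have main: "P l" if "p \<noteq> 0" "linear l" "\<And>v. (\<Sum>k\<le>degree p. coeff p k * l (((*v) A ^^ k) v)) = 0"
    for p :: "complex poly" and l
    using that
  proof (induction "degree p" arbitrary: p l)
    case 0
    \<comment> \<open>A nonzero constant annihilates only the zero functional.\<close>
    then have "coeff p 0 \<noteq> 0" by (metis leading_coeff_0_iff)
    then have "l = (\<lambda>_. 0)" using 0 by (auto simp: fun_eq_iff)
    then show ?case using zero by simp
  next
    case (Suc n)
    then have "\<not> constant (poly p)" by (simp add: constant_degree)
    then obtain \<mu> where "poly p \<mu> = 0" using fundamental_theorem_of_algebra by blast
    then obtain q where q: "p = [:-\<mu>, 1:] * q" by (auto simp: poly_eq_0_iff_dvd)
    with \<open>p \<noteq> 0\<close> have "q \<noteq> 0" by auto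
    have deg: "n = degree q" using Suc(2) \<open>q \<noteq> 0\<close> by (simp add: q degree_mult_eq del: mult_pCons_left)
    define l' where "l' v = l (A *v v) - \<mu> * l v" for v
    have "linear l'"
      unfolding l'_def using Suc.prems(2)
      by (intro linear_compose_sub linear_compose[unfolded o_def, of "(*v) A" l]
          linear_compose[unfolded o_def, of l "(*) \<mu>"] matrix_vector_mul_linear linear_times)
    moreover have "(\<Sum>k\<le>degree q. coeff q k * l' (((*v) A ^^ k) v)) = 0" for v
      using Suc.prems(3)[of v] sum_coeff_linear_factor[OF \<open>q \<noteq> 0\<close>, of \<mu> "\<lambda>k. l (((*v) A ^^ k) v)"]
      by (simp add: q l'_def del: mult_pCons_left)
    ultimately have "P l'" using Suc.hyps(1)[OF deg \<open>q \<noteq> 0\<close>] by blast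
    then show ?case using step[OF Suc.prems(2)] unfolding l'_def by blast
  qed
  obtain p :: "complex poly" where "p \<noteq> 0"
    "\<And>l v. linear l \<Longrightarrow> (\<Sum>k\<le>degree p. coeff p k * l (((*v) A ^^ k) v)) = 0"
    using ex_annihilating_poly by blast
  then show ?thesis using main[of p l] assms(1) by blast
qed

text \<open>The Bohr--Neugebauer theorem. For a functional \<open>l\<close>, the scalar function
  \<open>l (m t)\<close> solves an equation with coefficient \<mu> whose forcing consists of
  \<open>l (f t)\<close> and the functional \<open>l \<circ> A - \<mu> l\<close> at
  \<open>m t\<close>; the latter is almost periodic by induction. Coordinates are
  functionals.\<close>

lemma bochner_ap_bounded_ode_solution:
  fixes A :: "real^'n^'n"
  assumes m: "\<And>t. (m has_vector_derivative A *v m t + f t) (at t)"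
    and f: "bochner_ap f" and bdd: "bounded (range m)"
  shows "bochner_ap m"
proof -
  have "bochner_ap (\<lambda>t. l (m t))" if "linear l" for l :: "real^'n \<Rightarrow> complex"
    using that
  proof (induction rule: functional_induct[where A=A])
    case zero
    show ?case using bochner_ap_bounded_linear[OF f, of "\<lambda>_. 0 :: complex"] by simp
  next
    case (step l \<mu>)
    have l: "bounded_linear l" using step(1) by (simp add: linear_conv_bounded_linear)
    show ?case
    proof (rule bochner_ap_linear_ode)
      show "((\<lambda>t. l (m t)) has_vector_derivative
          \<mu> * l (m t) + ((l (A *v m t) - \<mu> * l (m t)) + l (f t))) (at t)" for t
        using bounded_linear.has_vector_derivative[OF l m] by (simp add: linear_add[OF step(1)])
      show "bochner_ap (\<lambda>t. l (A *v m t) - \<mu> * l (m t) + l (f t))"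
        by (intro bochner_ap_add step bochner_ap_bounded_linear[OF f l])
      show "bounded (range (\<lambda>t. l (m t)))"
        using bounded_linear_image[OF bdd l] by (simp add: image_image)
    qed
  qed
  from bochner_ap_bounded_linear[OF this bounded_linear_Re]
  have re: "bochner_ap (\<lambda>t. Re (l (m t)))" if "linear l" for l :: "real^'n \<Rightarrow> complex" using that .
  show ?thesis
  proof (rule bochner_ap_vec)
    fix i
    have "linear (\<lambda>v::real^'n. complex_of_real (v $ i))"
      by (intro linearI) (simp_all add: scaleR_conv_of_real[where 'a=complex])
    from re[OF this] show "bochner_ap (\<lambda>t. m t $ i)" by simp
  qed
qed

section \<open>Decay of square integrable forcing\<close>

lemma bochner_ap_uniform_limit:
  fixes h :: "real \<Rightarrow> 'a::metric_space"
  assumes "\<And>e. e > 0 \<Longrightarrow> \<exists>k. bochner_ap k \<and> (\<forall>t. dist (h t) (k t) \<le> e)"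
  shows "bochner_ap h"
proof (rule bochner_apI_periods)
  have uniform: "\<exists>k :: real \<Rightarrow> 'a. bochner_ap k \<and> (\<forall>s t. dist (h s) (h t) \<le> e / 2 + dist (k s) (k t))"
    if e: "e > 0" for e
  proof -
    obtain k where k: "bochner_ap k" "\<And>t. dist (h t) (k t) \<le> e / 4" using assms[of "e / 4"] e by fastforce
    have "dist (h s) (h t) \<le> e / 2 + dist (k s) (k t)" for s t
      using dist_triangle[of "h s" "h t" "k s"] dist_triangle[of "k s" "h t" "k t"] k(2)[of s] k(2)[of t]
      by (simp add: dist_commute)
    then show ?thesis using k(1) by blast
  qed
  show "continuous_on UNIV h"
    unfolding continuous_on_iff
  proof (intro ballI allI impI)
    fix t e :: real assume "e > 0"
    obtain k :: "real \<Rightarrow> 'a" where k: "bochner_ap k" "\<And>s t. dist (h s) (h t) \<le> e / 2 + dist (k s) (k t)"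
      using uniform[OF \<open>e > 0\<close>] by blast
    then obtain d where d: "d > 0" "\<And>s. dist s t < d \<Longrightarrow> dist (k s) (k t) < e / 2"
      using bochner_ap_continuous[OF k(1)] \<open>e > 0\<close> unfolding continuous_on_iff
      by (metis UNIV_I half_gt_zero)
    have "dist (h s) (h t) < e" if "dist s t < d" for s
      using k(2)[of s t] d(2)[OF that] by linarith
    then show "\<exists>d>0. \<forall>s\<in>UNIV. dist s t < d \<longrightarrow> dist (h s) (h t) < e" using d(1) by blast
  qed
  fix e :: real assume "e > 0"
  obtain k :: "real \<Rightarrow> 'a" where k: "bochner_ap k" "\<And>s t. dist (h s) (h t) \<le> e / 2 + dist (k s) (k t)"
    using uniform[OF \<open>e > 0\<close>] by blast
  have "periods k (e / 2) \<subseteq> periods h e"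
  proof
    fix \<sigma> assume \<sigma>: "\<sigma> \<in> periods k (e / 2)"
    have "dist (h (t + \<sigma>)) (h t) \<le> e" for t
      using k(2)[of "t + \<sigma>" t] periodsD[OF \<sigma>, of t] by linarith
    then show "\<sigma> \<in> periods h e" by (simp add: periods_def)
  qed
  then show "relatively_dense (periods h e)"
    using bochner_ap_periods[OF k(1), of "e / 2"] \<open>e > 0\<close> relatively_dense_mono by simp
qed

text \<open>The antiderivative \<open>F\<close> of the squared norm is nondecreasing, and bounded
  because every window carries at most \<open>C\<close>; by Bohr's theorem it is almost periodic. A
  monotone almost periodic function is constant.\<close>

lemma bochner_ap_square_integrable_eq_0:
  fixes c :: "real \<Rightarrow> 'a::real_normed_vector"
  assumes c: "bochner_ap c" and bdd: "\<And>t L. L \<ge> 0 \<Longrightarrow> integral {0..L} (\<lambda>u. (norm (c (t - u)))\<^sup>2) \<le> C"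
  shows "c t = 0"
proof -
  let ?h = "\<lambda>t. (norm (c t))\<^sup>2"
  have cont: "continuous_on UNIV ?h"
    by (intro continuous_intros bochner_ap_continuous[OF c])
  have ap: "bochner_ap ?h"
  proof -
    have n: "bochner_ap (\<lambda>t. norm (c t))"
    proof (rule bochner_ap_compose[OF c])
      show "continuous_on UNIV (\<lambda>t. norm (c t))" by (intro continuous_intros bochner_ap_continuous[OF c])
      show "\<exists>d>0. \<forall>s t. dist (c s) (c t) \<le> d \<longrightarrow> dist (norm (c s)) (norm (c t)) \<le> e" if "e > 0" for e
        using that norm_triangle_ineq3[of "c _" "c _"]
        by (intro exI[of _ e]) (auto simp: dist_norm intro: order_trans)
    qed
    show ?thesis using bochner_ap_mult[OF n n] by (simp add: power2_eq_square)
  qed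
  obtain F where F: "\<And>t. (F has_vector_derivative ?h t) (at t)"
    using continuous_antiderivative[OF cont] by blast
  have FL: "F t - F (t - L) \<le> C" if "L \<ge> 0" for t L
  proof -
    have "((\<lambda>u. - F (t - u)) has_vector_derivative ?h (t - u)) (at u)" for u
    proof -
      have "((\<lambda>u. F (u + t)) has_vector_derivative ?h (- u + t)) (at (- u))"
        by (rule has_vector_derivative_translate[OF F])
      from has_vector_derivative_minus[OF has_vector_derivative_reflect[OF this]]
      show ?thesis by simp
    qed
    then have "((\<lambda>u. ?h (t - u)) has_integral - F (t - L) - - F (t - 0)) {0..L}"
      by (intro fundamental_theorem_of_calculus that) (rule has_vector_derivative_at_within)
    then show ?thesis using bdd[OF that, of t] by (simp add: integral_unique)
  qed
  have mono: "F s \<le> F t" if "s \<le> t" for s t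
  proof -
    have "(?h has_integral F t - F s) {s..t}"
      by (intro fundamental_theorem_of_calculus that) (rule has_vector_derivative_at_within[OF F])
    then have "0 \<le> F t - F s" by (rule has_integral_nonneg) simp
    then show ?thesis by simp
  qed
  have "F t \<in> {F 0 - C..F 0 + C}" for t
    using FL[of t t] FL[of "- t" 0] mono[of 0 t] mono[of t 0]
    by (cases "t \<ge> 0") auto
  then have "range F \<subseteq> {F 0 - C..F 0 + C}" by blast
  then have "bounded (range F)" by (rule bounded_subset[OF bounded_closed_interval])
  then have "bochner_ap F" using bochner_ap_antiderivative[OF F ap] by blast
  \<comment> \<open>An almost period exceeding \<open>t - s\<close> carries \<open>s\<close> beyond
    \<open>t\<close> while hardly changing the value of \<open>F\<close>.\<close>
  have le: "F t \<le> F s" if "s \<le> t" for s t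
  proof (rule field_le_epsilon)
    fix e :: real assume "e > 0"
    then obtain \<sigma> where \<sigma>: "\<sigma> \<in> periods F e" "t - s < \<sigma>"
      using bochner_ap_periods[OF \<open>bochner_ap F\<close>, of e] unfolding relatively_dense_def by fastforce
    have "F t \<le> F (s + \<sigma>)" using \<sigma> by (intro mono) auto
    then show "F t \<le> F s + e" using periodsD[OF \<sigma>(1), of s] by (simp add: dist_real_def abs_le_iff)
  qed
  have "F = (\<lambda>_. F 0)"
  proof
    fix t show "F t = F 0" using mono[of t 0] mono[of 0 t] le[of t 0] le[of 0 t] by (cases "t \<ge> 0") auto
  qed
  then have "?h t = 0"
    using vector_derivative_unique_at[OF F[of t], of 0] has_vector_derivative_const by metis
  then show ?thesis by simp
qed

text \<open>The scalar function \<open>y r u = l (flow A u (v r))\<close> satisfies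
  \<open>y' = \<mu> y + k\<close>, where \<open>k\<close> decays exponentially by the induction
  hypothesis for \<open>l \<circ> A - \<mu> l\<close>. If \<open>Re \<mu> < 0\<close>, then
  \<open>y\<close> decays as well. Otherwise \<open>y r u\<close> is
  \<open>exp (\<mu> u) c r\<close> up to a decaying error, and square integrability along
  \<open>r = t - u\<close> forces the amplitude \<open>c\<close> to vanish. All constants have to be
  uniform in \<open>r\<close>.\<close>

lemma functional_flow_decay:
  fixes A :: "real^'n^'n" and l :: "real^'n \<Rightarrow> complex"
  assumes v: "bochner_ap v"
    and sq: "\<And>l :: real^'n \<Rightarrow> complex. linear l \<Longrightarrow> \<exists>C. \<forall>t. \<forall>L\<ge>0.
      integral {0..L} (\<lambda>u. (norm (l (flow A u (v (t - u)))))\<^sup>2) \<le> C"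
    and l: "linear l"
  shows "\<exists>K \<alpha>. \<alpha> > 0 \<and> (\<forall>u\<ge>0. \<forall>r. norm (l (flow A u (v r))) \<le> K * exp (- \<alpha> * u))"
  using l
proof (induction rule: functional_induct[where A=A])
  case zero
  show ?case by (intro exI[of _ 0] exI[of _ 1]) auto
next
  case (step l \<mu>)
  have l: "bounded_linear l" using step(1) by (simp add: linear_conv_bounded_linear)
  define k where "k r u = l (A *v flow A u (v r)) - \<mu> * l (flow A u (v r))" for r u
  obtain K \<alpha> where "\<alpha> > 0" and K: "\<And>u r. u \<ge> 0 \<Longrightarrow> norm (k r u) \<le> K * exp (- \<alpha> * u)"
    using step(2) unfolding k_def by blast
  have "K \<ge> 0" using order_trans[OF norm_ge_zero K[of 0]] by simp
  define y where "y r u = l (flow A u (v r))" for r u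
  define z where "z r u = exp (- \<mu> * of_real u) * y r u" for r u
  have y: "(y r has_vector_derivative \<mu> * y r u + k r u) (at u)" for r u
    using bounded_linear.has_vector_derivative[OF l has_vector_derivative_flow[of A "v r" u UNIV]]
    by (simp add: y_def[abs_def] k_def)
  have z: "(z r has_vector_derivative exp (- \<mu> * of_real u) * k r u) (at u)" for r u
    using has_vector_derivative_exp_mult[OF y] unfolding z_def .
  have z': "norm (exp (- \<mu> * of_real u) * k r u) \<le> K * exp ((- Re \<mu> - \<beta>) * u)"
    if "u \<ge> 0" "\<beta> \<le> \<alpha>" for r u \<beta>
  proof -
    have "norm (exp (- \<mu> * of_real u) * k r u) \<le> exp (- Re \<mu> * u) * (K * exp (- \<alpha> * u))"
      using K[OF that(1), of r] by (simp add: norm_mult)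
    also have "\<dots> = K * exp ((- Re \<mu> - \<alpha>) * u)"
      by (simp add: exp_add[symmetric] algebra_simps)
    also have "\<dots> \<le> K * exp ((- Re \<mu> - \<beta>) * u)"
      using that \<open>K \<ge> 0\<close> by (intro mult_left_mono) (auto intro: mult_right_mono)
    finally show ?thesis .
  qed
  have norm_y: "norm (y r u) = exp (Re \<mu> * u) * norm (z r u)" for r u
    by (simp add: z_def norm_mult mult.assoc[symmetric] exp_add[symmetric])
  obtain B where B: "\<And>r. norm (l (v r)) \<le> B"
    using bochner_ap_bounded[OF bochner_ap_bounded_linear[OF v l]] by (auto simp: bounded_iff)
  show ?case
  proof (cases "Re \<mu> < 0")
    case True
    \<comment> \<open>Half of \<open>- Re \<mu>\<close> keeps \<open>- Re \<mu> - \<beta>\<close>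
      positive even when \<alpha> equals \<open>- Re \<mu>\<close>, where resonance would produce a
      factor \<open>u\<close>.\<close>
    define \<beta> where "\<beta> = min \<alpha> (- Re \<mu> / 2)"
    have \<beta>: "\<beta> > 0" "\<beta> \<le> \<alpha>" "- Re \<mu> - \<beta> > 0" using True \<open>\<alpha> > 0\<close> by (auto simp: \<beta>_def min_def)
    define K' where "K' = K / (- Re \<mu> - \<beta>)"
    have "norm (y r u) \<le> (B + K') * exp (- \<beta> * u)" if "u \<ge> 0" for r u
    proof -
      have "norm (z r u - z r 0) \<le> K' * (exp ((- Re \<mu> - \<beta>) * u) - exp ((- Re \<mu> - \<beta>) * 0))"
        unfolding K'_def using z' \<beta> that by (intro norm_diff_le_of_exp_derivative[OF z]) auto
      also have "\<dots> \<le> K' * exp ((- Re \<mu> - \<beta>) * u)"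
        using \<beta> \<open>K \<ge> 0\<close> by (intro mult_left_mono) (auto simp: K'_def)
      finally have "norm (z r u) \<le> B + K' * exp ((- Re \<mu> - \<beta>) * u)"
        using norm_triangle_sub[of "z r u" "z r 0"] B[of r] by (simp add: z_def y_def)
      then have "norm (y r u) \<le> exp (Re \<mu> * u) * (B + K' * exp ((- Re \<mu> - \<beta>) * u))"
        unfolding norm_y by (intro mult_left_mono) auto
      also have "\<dots> = B * exp (Re \<mu> * u) + K' * exp (- \<beta> * u)"
        by (simp add: distrib_left exp_add[symmetric] algebra_simps)
      also have "B * exp (Re \<mu> * u) \<le> B * exp (- \<beta> * u)"
        using mult_right_mono[of "Re \<mu>" "- \<beta>" u] \<beta> that order_trans[OF norm_ge_zero B]
        by (intro mult_left_mono) auto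
      finally show ?thesis by (simp add: distrib_right)
    qed
    then show ?thesis using \<beta>(1) unfolding y_def by blast
  next
    case False
    \<comment> \<open>The derivative of \<open>z = exp (- \<mu> u) y\<close> decays at this rate, so
      \<open>z r\<close> has a limit as \<open>u\<close> grows.\<close>
    define \<beta> where "\<beta> = Re \<mu> + \<alpha>"
    have \<beta>: "\<beta> > 0" "\<alpha> \<le> \<beta>" using False \<open>\<alpha> > 0\<close> by (auto simp: \<beta>_def)
    have zz: "norm (z r b - z r a) \<le> K / \<alpha> * exp (- \<beta> * a)" if "0 \<le> a" "a \<le> b" for r a b
    proof -
      have "norm (z r b - z r a) \<le> K / (- \<beta>) * (exp (- \<beta> * b) - exp (- \<beta> * a))"
      proof (rule norm_diff_le_of_exp_derivative[OF z])
        show "norm (exp (- \<mu> * of_real x) * k r x) \<le> K * exp (- \<beta> * x)" if "a \<le> x" for x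
          using z'[of x \<alpha> r] \<open>0 \<le> a\<close> that by (simp add: \<beta>_def)
      qed (use \<beta> that in auto)
      also have "\<dots> = K / \<beta> * (exp (- \<beta> * a) - exp (- \<beta> * b))"
        using \<beta> by (simp add: field_simps)
      also have "\<dots> \<le> K / \<alpha> * exp (- \<beta> * a)"
        using \<beta> \<open>\<alpha> > 0\<close> \<open>K \<ge> 0\<close> that by (intro mult_mono) (auto intro!: divide_left_mono mult_left_mono)
      finally show ?thesis .
    qed
    have lim0: "(\<lambda>n. K / \<alpha> * exp (- \<beta> * real n)) \<longlonglongrightarrow> 0"
      using \<beta> by real_asymp
    have "\<exists>c. \<forall>u\<ge>0. norm (z r u - c) \<le> K / \<alpha> * exp (- \<beta> * u)" for r
    proof -
      have "Cauchy (\<lambda>n. z r (real n))"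
      proof (rule metric_CauchyI)
        fix e :: real assume "e > 0"
        then obtain N where N: "\<And>n. n \<ge> N \<Longrightarrow> K / \<alpha> * exp (- \<beta> * real n) < e"
          using order_tendstoD(2)[OF lim0] unfolding eventually_sequentially by blast
        have *: "dist (z r (real m)) (z r (real n)) < e" if "N \<le> m" "m \<le> n" for m n
          using zz[of "real m" "real n" r] N[of m] that by (simp add: dist_norm norm_minus_commute)
        show "\<exists>M. \<forall>m\<ge>M. \<forall>n\<ge>M. dist (z r (real m)) (z r (real n)) < e"
        proof (intro exI[of _ N] allI impI)
          fix m n assume "m \<ge> N" "n \<ge> N"
          then show "dist (z r (real m)) (z r (real n)) < e"
            using *[of m n] *[of n m] by (cases "m \<le> n") (auto simp: dist_commute)
        qed
      qed
      then obtain c where c: "(\<lambda>n. z r (real n)) \<longlonglongrightarrow> c" by (auto simp: Cauchy_convergent_iff convergent_def)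
      have "norm (z r u - c) \<le> K / \<alpha> * exp (- \<beta> * u)" if "u \<ge> 0" for u
      proof (rule tendsto_upperbound)
        show "(\<lambda>n. norm (z r u - z r (real n))) \<longlonglongrightarrow> norm (z r u - c)" by (intro tendsto_intros c)
        obtain N where "u \<le> real N" using real_arch_simple by blast
        then have "norm (z r u - z r (real n)) \<le> K / \<alpha> * exp (- \<beta> * u)" if "n \<ge> N" for n
          using zz[of u "real n" r] \<open>u \<ge> 0\<close> that by (simp add: norm_minus_commute)
        then show "eventually (\<lambda>n. norm (z r u - z r (real n)) \<le> K / \<alpha> * exp (- \<beta> * u)) sequentially"
          unfolding eventually_sequentially by blast
      qed simp
      then show ?thesis by blast
    qed
    then obtain c where c: "\<And>r u. u \<ge> 0 \<Longrightarrow> norm (z r u - c r) \<le> K / \<alpha> * exp (- \<beta> * u)" by metis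
    \<comment> \<open>For fixed \<open>u\<close> the value \<open>z r u\<close> is a linear function
      of \<open>v r\<close>, hence almost periodic in \<open>r\<close>, and the convergence is
      uniform in \<open>r\<close>.\<close>
    have "bochner_ap c"
    proof (rule bochner_ap_uniform_limit)
      fix e :: real assume "e > 0"
      then obtain n where n: "K / \<alpha> * exp (- \<beta> * real n) < e"
        using order_tendstoD(2)[OF lim0] unfolding eventually_sequentially by blast
      have "bounded_linear (\<lambda>x. exp (- \<mu> * of_real (real n)) * l (flow A (real n) x))"
        by (intro bounded_linear_const_mult bounded_linear_compose[OF l] bounded_linear_flow)
      then have "bochner_ap (\<lambda>r. z r (real n))"
        using bochner_ap_bounded_linear[OF v] unfolding z_def y_def by blast
      moreover have "dist (c r) (z r (real n)) \<le> e" for r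
        using c[of "real n" r] n by (simp add: dist_norm norm_minus_commute)
      ultimately show "\<exists>k. bochner_ap k \<and> (\<forall>t. dist (c t) (k t) \<le> e)" by blast
    qed
    have close: "norm (y r u - exp (\<mu> * of_real u) * c r) \<le> K / \<alpha> * exp (- \<alpha> * u)" if "u \<ge> 0" for r u
    proof -
      have "y r u - exp (\<mu> * of_real u) * c r = exp (\<mu> * of_real u) * (z r u - c r)"
        by (simp add: z_def right_diff_distrib mult.assoc[symmetric] exp_add[symmetric])
      then have "norm (y r u - exp (\<mu> * of_real u) * c r) = exp (Re \<mu> * u) * norm (z r u - c r)"
        by (simp add: norm_mult)
      also have "\<dots> \<le> exp (Re \<mu> * u) * (K / \<alpha> * exp (- \<beta> * u))"
        using c[OF that] by (intro mult_left_mono) auto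
      also have "\<dots> = K / \<alpha> * exp (- \<alpha> * u)"
        by (simp add: \<beta>_def exp_add[symmetric] algebra_simps)
      finally show ?thesis .
    qed
    obtain C where C: "\<And>t L. L \<ge> 0 \<Longrightarrow> integral {0..L} (\<lambda>u. (norm (y (t - u) u))\<^sup>2) \<le> C"
      using sq[OF step(1)] unfolding y_def by blast
    \<comment> \<open>Since \<open>Re \<mu> \<ge> 0\<close>, the amplitude is dominated by
      \<open>exp (\<mu> u) c\<close>, hence by \<open>y\<close> plus the decaying error; both have
      bounded square integrals.\<close>
    have "c r = 0" for r
    proof (rule bochner_ap_square_integrable_eq_0[OF \<open>bochner_ap c\<close>])
      fix t L :: real assume "L \<ge> 0"
      have cv: "continuous_on UNIV v" "continuous_on UNIV c"
        using v \<open>bochner_ap c\<close> by (auto intro: bochner_ap_continuous)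
      have cy: "continuous_on {0..L} (\<lambda>u. y (t - u) u)"
        unfolding y_def
        by (intro bounded_linear.continuous_on[OF l] continuous_on_flow continuous_on_compose2[OF cv(1)] continuous_intros) auto
      have exp_integral: "integral {0..L} (\<lambda>u. exp (- \<alpha> * u)) \<le> 1 / \<alpha>"
      proof -
        have "((\<lambda>u. exp (- \<alpha> * u)) has_integral (- exp (- \<alpha> * L) / \<alpha> - (- exp (- \<alpha> * 0) / \<alpha>))) {0..L}"
          using \<open>L \<ge> 0\<close> \<open>\<alpha> > 0\<close>
          by (intro fundamental_theorem_of_calculus)
             (auto intro!: derivative_eq_intros simp: has_real_derivative_iff_has_vector_derivative[symmetric])
        then show ?thesis using \<open>\<alpha> > 0\<close> by (simp add: integral_unique diff_divide_distrib[symmetric] divide_right_mono)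
      qed
      have "integral {0..L} (\<lambda>u. (norm (c (t - u)))\<^sup>2)
        \<le> integral {0..L} (\<lambda>u. 2 * (norm (y (t - u) u))\<^sup>2 + 2 * (K / \<alpha>)\<^sup>2 * exp (- \<alpha> * u))"
      proof (rule integral_le)
        show "(\<lambda>u. (norm (c (t - u)))\<^sup>2) integrable_on {0..L}"
          by (intro integrable_continuous_real continuous_intros continuous_on_compose2[OF cv(2)]) auto
        show "(\<lambda>u. 2 * (norm (y (t - u) u))\<^sup>2 + 2 * (K / \<alpha>)\<^sup>2 * exp (- \<alpha> * u)) integrable_on {0..L}"
          by (intro integrable_continuous_real continuous_intros cy)
        fix u assume u: "u \<in> {0..L}"
        define a where "a = norm (y (t - u) u)"
        define b where "b = K / \<alpha> * exp (- \<alpha> * u)"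
        have "norm (c (t - u)) \<le> exp (Re \<mu> * u) * norm (c (t - u))"
          using False u mult_right_mono[of 1 "exp (Re \<mu> * u)" "norm (c (t - u))"] by simp
        also have "\<dots> = norm (exp (\<mu> * of_real u) * c (t - u))" by (simp add: norm_mult)
        also have "\<dots> \<le> a + b"
          using close[of u "t - u"] u norm_triangle_sub[of "exp (\<mu> * of_real u) * c (t - u)" "y (t - u) u"]
          by (simp add: a_def b_def norm_minus_commute)
        finally have "(norm (c (t - u)))\<^sup>2 \<le> (a + b)\<^sup>2" by (intro power_mono) auto
        also have "\<dots> \<le> 2 * a\<^sup>2 + 2 * b\<^sup>2"
          using sum_squares_ge_zero[of "a - b" 0] by (simp add: power2_eq_square algebra_simps)
        also have "b\<^sup>2 \<le> (K / \<alpha>)\<^sup>2 * exp (- \<alpha> * u)"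
        proof -
          have "exp (- \<alpha> * u) * exp (- \<alpha> * u) \<le> 1 * exp (- \<alpha> * u)"
            using u \<open>\<alpha> > 0\<close> by (intro mult_right_mono) auto
          then show ?thesis
            unfolding b_def power_mult_distrib by (intro mult_left_mono) (simp_all add: power2_eq_square)
        qed
        finally show "(norm (c (t - u)))\<^sup>2 \<le> 2 * (norm (y (t - u) u))\<^sup>2 + 2 * (K / \<alpha>)\<^sup>2 * exp (- \<alpha> * u)"
          by (simp add: a_def mult.assoc)
      qed
      also have "\<dots> = 2 * integral {0..L} (\<lambda>u. (norm (y (t - u) u))\<^sup>2)
          + 2 * (K / \<alpha>)\<^sup>2 * integral {0..L} (\<lambda>u. exp (- \<alpha> * u))"
        by (subst integral_add)
           (auto intro!: integrable_continuous_real continuous_intros cy simp: mult.assoc)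
      also have "\<dots> \<le> 2 * C + 2 * (K / \<alpha>)\<^sup>2 * (1 / \<alpha>)"
        using C[OF \<open>L \<ge> 0\<close>, of t] by (intro add_mono mult_left_mono exp_integral) auto
      finally show "integral {0..L} (\<lambda>u. (norm (c (t - u)))\<^sup>2) \<le> 2 * C + 2 * (K / \<alpha>)\<^sup>2 * (1 / \<alpha>)" .
    qed
    then show ?thesis
      using close \<open>\<alpha> > 0\<close> unfolding y_def by (intro exI[of _ "K / \<alpha>"] exI[of _ \<alpha>]) auto
  qed
qed

lemma flow_decay:
  fixes A :: "real^'n^'n"
  assumes "bochner_ap v"
    and "\<And>l :: real^'n \<Rightarrow> complex. linear l \<Longrightarrow> \<exists>C. \<forall>t. \<forall>L\<ge>0.
      integral {0..L} (\<lambda>u. (norm (l (flow A u (v (t - u)))))\<^sup>2) \<le> C"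
  shows "\<exists>K \<alpha>. K > 0 \<and> \<alpha> > 0 \<and> (\<forall>u\<ge>0. \<forall>r. norm (flow A u (v r)) \<le> K * exp (- \<alpha> * u))"
proof -
  have lin: "linear (\<lambda>v::real^'n. complex_of_real (v $ i))" for i
    by (intro linearI) (simp_all add: scaleR_conv_of_real[where 'a=complex])
  have "\<exists>K \<alpha>. \<alpha> > 0 \<and> (\<forall>u\<ge>0. \<forall>r. \<bar>flow A u (v r) $ i\<bar> \<le> K * exp (- \<alpha> * u))" for i
    using functional_flow_decay[OF assms lin[of i]] by simp
  then obtain K \<alpha> where \<alpha>: "\<And>i. \<alpha> i > 0"
    and K: "\<And>i u r. u \<ge> 0 \<Longrightarrow> \<bar>flow A u (v r) $ i\<bar> \<le> K i * exp (- \<alpha> i * u)" by metis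
  define a where "a = Min (range \<alpha>)"
  have a: "a > 0" "\<And>i. a \<le> \<alpha> i" using \<alpha> by (auto simp: a_def)
  have K0: "K i \<ge> 0" for i using order_trans[OF abs_ge_zero K[of 0 _ i]] by simp
  have "norm (flow A u (v r)) \<le> (sum K UNIV + 1) * exp (- a * u)" if "u \<ge> 0" for u r
  proof -
    have "norm (flow A u (v r)) \<le> (\<Sum>i\<in>UNIV. \<bar>flow A u (v r) $ i\<bar>)" by (rule norm_le_l1_cart)
    also have "\<dots> \<le> (\<Sum>i\<in>UNIV. K i * exp (- a * u))"
    proof (rule sum_mono)
      fix i
      have "K i * exp (- \<alpha> i * u) \<le> K i * exp (- a * u)"
        using a that K0 by (intro mult_left_mono) (auto intro: mult_right_mono)
      with K[OF that, of r i] show "\<bar>flow A u (v r) $ i\<bar> \<le> K i * exp (- a * u)" by linarith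
    qed
    also have "\<dots> \<le> (sum K UNIV + 1) * exp (- a * u)"
      by (simp add: sum_distrib_right[symmetric] distrib_right)
    finally show ?thesis .
  qed
  moreover have "sum K UNIV + 1 > 0" using K0 by (simp add: add_nonneg_pos sum_nonneg)
  ultimately show ?thesis using a(1) by blast
qed

section \<open>Gaussian densities and characteristic functions\<close>

lemma measurable_cis [measurable]:
  "f \<in> borel_measurable M \<Longrightarrow> (\<lambda>x. cis (f x)) \<in> borel_measurable M"
  by (rule borel_measurable_continuous_on) (intro continuous_intros)

lemma norm_cis_diff_le: "norm (cis a - cis b) \<le> \<bar>a - b\<bar>"
proof -
  have "(cis has_vector_derivative \<i> * cis t) (at t)" for t
    using has_vector_derivative_real_field[of "\<lambda>z. exp (\<i> * z)" "\<i> * exp (\<i> * of_real t)" t UNIV]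
    by (auto simp: cis_conv_exp[abs_def] intro!: derivative_eq_intros)
  from norm_diff_le_of_derivative[OF this, of 1 a b] show ?thesis by (simp add: norm_mult)
qed

text \<open>Lebesgue measure on vectors is the image of a product measure indexed by
  \<open>Basis\<close>. The bijection \<open>e\<close> from indices to basis vectors reduces the
  claim to Fubini for finite products.\<close>

lemma
  fixes f :: "'n::finite \<Rightarrow> real \<Rightarrow> complex"
  assumes f: "\<And>i. integrable lborel (f i)"
  shows integrable_lborel_prod_vec: "integrable lborel (\<lambda>x::real^'n. \<Prod>i\<in>UNIV. f i (x $ i))"
    and integral_lborel_prod_vec:
      "(LINT x|lborel. (\<Prod>i\<in>UNIV. f i ((x::real^'n) $ i))) = (\<Prod>i\<in>UNIV. LINT x|lborel. f i x)"
proof -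
  define e :: "'n \<Rightarrow> real^'n" where "e i = axis i 1" for i
  have inj: "inj e" and Basis: "Basis = range e"
    by (auto simp: e_def inj_on_def axis_eq_axis Basis_vec_def)
  interpret product_sigma_finite "\<lambda>_::real^'n. lborel :: real measure" ..
  define F where "F x = (\<Prod>i\<in>UNIV. f i (x $ i))" for x :: "real^'n"
  have [measurable]: "f i \<in> borel_measurable borel" for i using f[of i] by auto
  have [measurable]: "F \<in> borel_measurable borel" unfolding F_def by measurable
  have comp: "(\<Sum>b\<in>Basis. g b *\<^sub>R b) $ i = g (e i)" for g :: "real^'n \<Rightarrow> real" and i
  proof -
    have "(\<Sum>b\<in>Basis. g b *\<^sub>R b) $ i = (\<Sum>b\<in>Basis. g b *\<^sub>R b) \<bullet> e i"
      by (simp add: e_def inner_axis)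
    also have "\<dots> = g (e i)" by (rule inner_sum_left_Basis) (simp add: Basis)
    finally show ?thesis .
  qed
  have reindex: "(\<Prod>i\<in>UNIV. h (e i) i) = (\<Prod>b\<in>Basis. h b (inv e b))" for h :: "real^'n \<Rightarrow> 'n \<Rightarrow> complex"
    unfolding Basis by (subst prod.reindex[OF inj]) (simp add: inj)
  have F: "F (\<Sum>b\<in>Basis. g b *\<^sub>R b) = (\<Prod>b\<in>Basis. f (inv e b) (g b))" for g
    unfolding F_def comp using reindex[of "\<lambda>b i. f i (g b)"] .
  have "integrable (PiM Basis (\<lambda>_. lborel)) (\<lambda>g. F (\<Sum>b\<in>Basis. g b *\<^sub>R b))"
    unfolding F by (intro product_integrable_prod f) simp
  then have "integrable lborel F"
    by (subst lborel_eq) (simp add: integrable_distr_eq)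
  then show "integrable lborel (\<lambda>x::real^'n. \<Prod>i\<in>UNIV. f i (x $ i))" by (simp add: F_def[abs_def])
  have "integral\<^sup>L lborel F = (LINT g|PiM Basis (\<lambda>_. lborel). F (\<Sum>b\<in>Basis. g b *\<^sub>R b))"
    by (subst lborel_eq) (simp add: integral_distr)
  also have "\<dots> = (\<Prod>b\<in>Basis. LINT x|lborel. f (inv e b) x)"
    unfolding F by (intro product_integral_prod f) simp
  also have "\<dots> = (\<Prod>i\<in>UNIV. LINT x|lborel. f i x)"
    using reindex[of "\<lambda>_ i. LINT x|lborel. f i x"] by simp
  finally show "(LINT x|lborel. (\<Prod>i\<in>UNIV. f i ((x::real^'n) $ i))) = (\<Prod>i\<in>UNIV. LINT x|lborel. f i x)"
    by (simp add: F_def[abs_def])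
qed

text \<open>The substitution \<open>x \<mapsto> \<sigma> x\<close> reduces to the characteristic
  function of the standard normal law.\<close>

lemma
  assumes "\<sigma> > 0"
  shows integrable_normal_density_cis: "integrable lborel (\<lambda>x. of_real (normal_density 0 \<sigma> x) * cis (t * x))"
    and integral_normal_density_cis:
      "(LINT x|lborel. of_real (normal_density 0 \<sigma> x) * cis (t * x)) = of_real (exp (- (\<sigma> * t)\<^sup>2 / 2))"
proof -
  have int: "integrable lborel (normal_density 0 s)" if "s > 0" for s using that by simp
  have int': "integrable lborel (\<lambda>x. of_real (normal_density 0 s x) * cis (u * x))" if "s > 0" for s u
    by (rule Bochner_Integration.integrable_bound[OF int[OF that]]) (auto simp: norm_mult)
  then show "integrable lborel (\<lambda>x. of_real (normal_density 0 \<sigma> x) * cis (t * x))" using assms by blast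
  have std: "(LINT x|lborel. of_real (std_normal_density x) * cis (u * x)) = of_real (exp (- u\<^sup>2 / 2))" for u
  proof -
    have "char std_normal_distribution u = (LINT x|lborel. std_normal_density x *\<^sub>R iexp (u * x))"
      unfolding char_def by (subst integral_density) auto
    then show ?thesis
      using fun_cong[OF char_std_normal_distribution, of u]
      by (simp add: cis_conv_exp scaleR_conv_of_real)
  qed
  have scale: "normal_density 0 \<sigma> (\<sigma> * x) = std_normal_density x / \<sigma>" for x
    using assms by (simp add: normal_density_def real_sqrt_mult power_mult_distrib)
  have "(LINT x|lborel. of_real (normal_density 0 \<sigma> x) * cis (t * x)) =
    \<bar>\<sigma>\<bar> *\<^sub>R (LINT x|lborel. of_real (normal_density 0 \<sigma> (0 + \<sigma> * x)) * cis (t * (0 + \<sigma> * x)))"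
    using assms by (intro lborel_integral_real_affine) simp
  also have "\<dots> = (LINT x|lborel. \<sigma> *\<^sub>R (of_real (std_normal_density x / \<sigma>) * cis ((\<sigma> * t) * x)))"
    using assms by (simp only: add_0_left scale abs_of_pos integral_scaleR_right) (simp add: mult.assoc mult.left_commute)
  also have "\<dots> = (LINT x|lborel. of_real (std_normal_density x) * cis ((\<sigma> * t) * x))"
    using assms by (intro Bochner_Integration.integral_cong) (auto simp: scaleR_conv_of_real)
  also have "\<dots> = of_real (exp (- (\<sigma> * t)\<^sup>2 / 2))" by (rule std)
  finally show "(LINT x|lborel. of_real (normal_density 0 \<sigma> x) * cis (t * x)) = of_real (exp (- (\<sigma> * t)\<^sup>2 / 2))" .
qed

lemma cis_sum: "cis (sum f A) = (\<Prod>i\<in>A. cis (f i))"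
  by (induction A rule: infinite_finite_induct) (auto simp: cis_mult[symmetric])

lemma
  fixes \<theta> :: "real^'n"
  assumes "\<sigma> > 0"
  shows integrable_gaussian_cis:
      "integrable lborel (\<lambda>x. of_real (\<Prod>i\<in>UNIV. normal_density 0 \<sigma> (x $ i)) * cis (\<theta> \<bullet> x))"
    and integral_gaussian_cis:
      "(LINT x|lborel. of_real (\<Prod>i\<in>UNIV. normal_density 0 \<sigma> (x $ i)) * cis (\<theta> \<bullet> x)) =
        of_real (exp (- (\<sigma> * norm \<theta>)\<^sup>2 / 2))"
proof -
  have eq: "of_real (\<Prod>i\<in>UNIV. normal_density 0 \<sigma> (x $ i)) * cis (\<theta> \<bullet> x) =
      (\<Prod>i\<in>UNIV. of_real (normal_density 0 \<sigma> (x $ i)) * cis (\<theta> $ i * x $ i))" for x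
    by (simp add: inner_vec_def cis_sum prod.distrib)
  show "integrable lborel (\<lambda>x. of_real (\<Prod>i\<in>UNIV. normal_density 0 \<sigma> (x $ i)) * cis (\<theta> \<bullet> x))"
    unfolding eq by (intro integrable_lborel_prod_vec integrable_normal_density_cis assms)
  have "(norm \<theta>)\<^sup>2 = (\<Sum>i\<in>UNIV. (\<theta> $ i)\<^sup>2)"
    by (simp add: norm_vec_def L2_set_def sum_nonneg)
  then have "- (\<sigma> * norm \<theta>)\<^sup>2 / 2 = (\<Sum>i\<in>UNIV. - (\<sigma> * \<theta> $ i)\<^sup>2 / 2)"
    by (simp add: power_mult_distrib sum_distrib_left sum_divide_distrib sum_negf)
  then have "(\<Prod>i\<in>UNIV. complex_of_real (exp (- (\<sigma> * \<theta> $ i)\<^sup>2 / 2))) = of_real (exp (- (\<sigma> * norm \<theta>)\<^sup>2 / 2))"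
    by (simp only: of_real_prod[symmetric] exp_sum[OF finite, symmetric])
  then show "(LINT x|lborel. of_real (\<Prod>i\<in>UNIV. normal_density 0 \<sigma> (x $ i)) * cis (\<theta> \<bullet> x)) =
        of_real (exp (- (\<sigma> * norm \<theta>)\<^sup>2 / 2))"
    unfolding eq using assms
    by (subst integral_lborel_prod_vec[of "\<lambda>i y. of_real (normal_density 0 \<sigma> y) * cis (\<theta> $ i * y)"])
       (simp_all add: integrable_normal_density_cis integral_normal_density_cis)
qed

definition std_gaussian :: "(real^'n) measure" where
  "std_gaussian = density lborel (\<lambda>x. ennreal (\<Prod>i\<in>UNIV. std_normal_density (x $ i)))"

lemma sets_std_gaussian [measurable_cong, simp]: "sets std_gaussian = sets borel"
  and space_std_gaussian [simp]: "space std_gaussian = UNIV"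
  by (simp_all add: std_gaussian_def)

lemma std_gaussian_cis:
  "(LINT x|std_gaussian. cis (\<theta> \<bullet> x)) = of_real (exp (- (norm \<theta>)\<^sup>2 / 2))"
  unfolding std_gaussian_def using integral_gaussian_cis[of 1 \<theta>]
  by (subst integral_density) (auto simp: scaleR_conv_of_real prod_nonneg)

lemma prob_space_std_gaussian: "prob_space (std_gaussian :: (real^'n) measure)"
proof
  have "integrable lborel (\<lambda>x::real^'n. complex_of_real (\<Prod>i\<in>UNIV. std_normal_density (x $ i)))"
    using integrable_gaussian_cis[of 1 "0::real^'n"] by simp
  then have "integrable lborel (\<lambda>x::real^'n. \<Prod>i\<in>UNIV. std_normal_density (x $ i))"
    by (simp only: complex_of_real_integrable_eq)
  moreover have "(LINT x|lborel. complex_of_real (\<Prod>i\<in>UNIV. std_normal_density ((x::real^'n) $ i))) = 1"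
    using integral_gaussian_cis[of 1 "0::real^'n"] by simp
  then have "(LINT x|lborel. (\<Prod>i\<in>UNIV. std_normal_density ((x::real^'n) $ i))) = 1"
    by (simp only: integral_complex_of_real of_real_eq_1_iff)
  ultimately show "emeasure std_gaussian (space (std_gaussian :: (real^'n) measure)) = 1"
    unfolding std_gaussian_def
    by (simp add: emeasure_density nn_integral_eq_integral prod_nonneg)
qed

lemma integrable_bounded:
  fixes f :: "'a \<Rightarrow> 'b::{banach, second_countable_topology}"
  assumes "finite_measure M" "f \<in> borel_measurable M" "\<And>x. norm (f x) \<le> B"
  shows "integrable M f"
  by (intro finite_measure.integrable_const_bound[OF assms(1), where B=B] AE_I2 assms(2,3))

lemma Fubini_bounded:
  fixes f :: "'a \<Rightarrow> 'b \<Rightarrow> 'c::{banach, second_countable_topology}"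
  assumes "finite_measure M" "finite_measure N"
    and "case_prod f \<in> borel_measurable (M \<Otimes>\<^sub>M N)" "\<And>x y. norm (f x y) \<le> B"
  shows "(LINT y|N. LINT x|M. f x y) = (LINT x|M. LINT y|N. f x y)"
proof -
  interpret M: finite_measure M by fact
  interpret N: finite_measure N by fact
  interpret pair_sigma_finite M N ..
  have "finite_measure (M \<Otimes>\<^sub>M N)" by (rule finite_measure_pair_measure[OF assms(2,1)])
  then show ?thesis
    using assms by (intro Fubini_integral integrable_bounded[of _ _ B]) auto
qed

lemma integral_lborel_affine:
  fixes F :: "'a::euclidean_space \<Rightarrow> real"
  assumes [measurable]: "F \<in> borel_measurable borel" and "c > 0"
  shows "(LINT y|lborel. F y) = c ^ DIM('a) * (LINT x|lborel. F (t + c *\<^sub>R x))"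
proof -
  have "(LINT y|lborel. F y) = (LINT y|density (distr lborel borel (\<lambda>x. t + c *\<^sub>R x)) (\<lambda>_. \<bar>c\<bar>^DIM('a)). F y)"
    using lborel_affine[of c t] assms by simp
  also have "\<dots> = c ^ DIM('a) * (LINT x|lborel. F (t + c *\<^sub>R x))"
    by (subst integral_density) (use assms in \<open>auto simp: integral_distr\<close>)
  finally show ?thesis .
qed

section \<open>Convergence in the bounded Lipschitz metric from characteristic functions\<close>

text \<open>Convolving a compactly supported test function with a Gaussian of width \<open>\<delta>\<close> and writing the
  Gaussian kernel as the characteristic function of another Gaussian expresses its integral
  through the characteristic function of \<open>\<mu>\<close>.\<close>

lemma gaussian_smoothing_bound:
  fixes \<mu> \<nu> :: "(real^'n) measure" and h :: "real^'n \<Rightarrow> real"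
  assumes \<mu>: "\<mu> \<in> borel_probabilities" and \<nu>: "\<nu> \<in> borel_probabilities"
    and [measurable]: "h \<in> borel_measurable borel"
    and h1: "\<And>x. \<bar>h x\<bar> \<le> 1" and supp: "\<And>x. norm x > R \<Longrightarrow> h x = 0"
    and lip: "\<And>x y. \<bar>h x - h y\<bar> \<le> 2 * dist x y" and "\<delta> > 0"
  shows "\<bar>(LINT x|\<mu>. h x) - (LINT x|\<nu>. h x)\<bar> \<le> 2 * (LINT z|(std_gaussian :: (real^'n) measure). min 2 (2 * \<delta> * norm z))
    + measure lborel (cball (0::real^'n) R) / \<delta> ^ CARD('n) *
      (LINT z|std_gaussian. norm ((LINT x|\<mu>. cis ((z /\<^sub>R - \<delta>) \<bullet> x)) - (LINT x|\<nu>. cis ((z /\<^sub>R - \<delta>) \<bullet> x))))"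
    (is "_ \<le> 2 * ?\<omega> + ?V / _ * ?D")
proof -
  define \<gamma> :: "(real^'n) measure" where "\<gamma> = std_gaussian"
  have [measurable_cong]: "sets \<gamma> = sets borel" by (simp add: \<gamma>_def)
  interpret \<gamma>: prob_space \<gamma> unfolding \<gamma>_def by (rule prob_space_std_gaussian)
  have fin_\<gamma>: "finite_measure \<gamma>" by (rule \<gamma>.finite_measure_axioms)
  define g where "g z = (\<Prod>i\<in>UNIV. std_normal_density (z $ i))" for z :: "real^'n"
  have [measurable]: "g \<in> borel_measurable borel" unfolding g_def by measurable
  define c where "c = (1 / sqrt (2 * pi)) ^ CARD('n)"
  have c: "0 \<le> c" "c \<le> 1"
  proof -
    have "1 \<le> sqrt (2 * pi)" using pi_gt3 by (intro real_le_rsqrt) simp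
    then have "1 / sqrt (2 * pi) \<le> 1" by simp
    then show "0 \<le> c" "c \<le> 1" unfolding c_def by (auto intro!: power_le_one)
  qed
  have g: "g z = c * exp (- (norm z)\<^sup>2 / 2)" for z
  proof -
    have n: "(norm z)\<^sup>2 = (\<Sum>i\<in>UNIV. (z $ i)\<^sup>2)"
      by (simp add: norm_vec_def L2_set_def sum_nonneg)
    have e: "exp (- (norm z)\<^sup>2 / 2) = (\<Prod>i\<in>UNIV. exp (- (z $ i)\<^sup>2 / 2))"
      unfolding n by (simp add: exp_sum[symmetric] sum_divide_distrib sum_negf)
    have "std_normal_density x = (1 / sqrt (2 * pi)) * exp (- x\<^sup>2 / 2)" for x
      by (simp add: std_normal_density_def)
    then show ?thesis
      unfolding g_def c_def e by (simp only: prod.distrib prod_constant)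
  qed
  have g01: "0 \<le> g z" "g z \<le> 1" for z
    using c mult_mono[of c 1 "exp (- (norm z)\<^sup>2 / 2)" 1] by (auto simp: g)
  \<comment> \<open>Up to the constant \<open>c\<close> the Gaussian density is its own
    characteristic function. This turns the smoothing kernel into a superposition of characters, to
    which \<open>x\<close> and \<open>y\<close> contribute separate factors.\<close>
  have g_cis: "complex_of_real (g z) = of_real c * (LINT u|\<gamma>. cis (u \<bullet> z))" for z
    using std_gaussian_cis[of z] by (simp add: g \<gamma>_def inner_commute)
  define S where "S x = (LINT z|\<gamma>. h (x + \<delta> *\<^sub>R z))" for x
  have bdd_h: "integrable \<gamma> (\<lambda>z. h (x + \<delta> *\<^sub>R z))" for x
    using h1 by (intro integrable_bounded[OF fin_\<gamma>, of _ 1]) auto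
  have Sh: "\<bar>S x - h x\<bar> \<le> ?\<omega>" for x
  proof -
    have "S x - h x = (LINT z|\<gamma>. h (x + \<delta> *\<^sub>R z) - h x)"
      unfolding S_def using bdd_h by (simp add: \<gamma>.prob_space)
    also have "\<bar>\<dots>\<bar> \<le> (LINT z|\<gamma>. \<bar>h (x + \<delta> *\<^sub>R z) - h x\<bar>)" by (rule integral_abs_bound)
    also have "\<dots> \<le> (LINT z|\<gamma>. min 2 (2 * \<delta> * norm z))"
    proof (rule integral_mono)
      show "integrable \<gamma> (\<lambda>z. \<bar>h (x + \<delta> *\<^sub>R z) - h x\<bar>)" using bdd_h by auto
      show "integrable \<gamma> (\<lambda>z. min 2 (2 * \<delta> * norm z))"
      proof (rule integrable_bounded[OF fin_\<gamma>])
        have "0 \<le> 2 * \<delta> * norm z" for z :: "real^'n" using \<open>\<delta> > 0\<close> by simp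
        then show "norm (min 2 (2 * \<delta> * norm z)) \<le> 2" for z :: "real^'n"
          by (simp add: abs_of_nonneg)
      qed measurable
      fix z
      have "\<bar>h (x + \<delta> *\<^sub>R z) - h x\<bar> \<le> 2 * \<delta> * norm z"
        using lip[of "x + \<delta> *\<^sub>R z" x] \<open>\<delta> > 0\<close> by (simp add: dist_norm)
      moreover have "\<bar>h (x + \<delta> *\<^sub>R z) - h x\<bar> \<le> 2"
        using h1[of "x + \<delta> *\<^sub>R z"] h1[of x] by linarith
      ultimately show "\<bar>h (x + \<delta> *\<^sub>R z) - h x\<bar> \<le> min 2 (2 * \<delta> * norm z)" by simp
    qed
    finally show ?thesis by (simp add: \<gamma>_def)
  qed
  \<comment> \<open>Lebesgue measure on the ball supporting \<open>h\<close>. Being finite, it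
    allows Fubini for merely bounded integrands.\<close>
  define \<beta> where "\<beta> = density lborel (\<lambda>y::real^'n. ennreal (indicator (cball 0 R) y))"
  have cball[measurable]: "cball (0::real^'n) R \<in> sets borel" by simp
  have \<beta>: "emeasure \<beta> UNIV = emeasure lborel (cball (0::real^'n) R)" "space \<beta> = UNIV"
    unfolding \<beta>_def ennreal_indicator by (subst emeasure_density) auto
  have fin_\<beta>: "finite_measure \<beta>"
    using emeasure_bounded_finite[OF bounded_cball, of "0::real^'n" R]
    by (intro finite_measureI) (simp add: \<beta>)
  have S: "S x = (LINT y|\<beta>. h y * g ((y - x) /\<^sub>R \<delta>)) / \<delta> ^ CARD('n)" for x
  proof -
    have "S x = (LINT z|lborel. h (x + \<delta> *\<^sub>R z) * g z)"
      unfolding S_def \<gamma>_def std_gaussian_def g_def[symmetric]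
      by (subst integral_density) (auto simp: g01 mult.commute)
    also have "\<dots> = (LINT z|lborel. h (x + \<delta> *\<^sub>R z) * g (((x + \<delta> *\<^sub>R z) - x) /\<^sub>R \<delta>))"
      using \<open>\<delta> > 0\<close> by simp
    also have "\<dots> = (LINT y|lborel. h y * g ((y - x) /\<^sub>R \<delta>)) / \<delta> ^ CARD('n)"
      using \<open>\<delta> > 0\<close> by (subst integral_lborel_affine[where c=\<delta> and t=x]) auto
    also have "(LINT y|lborel. h y * g ((y - x) /\<^sub>R \<delta>)) = (LINT y:cball 0 R|lborel. h y * g ((y - x) /\<^sub>R \<delta>))"
      unfolding set_lebesgue_integral_def using supp
      by (intro Bochner_Integration.integral_cong) (auto simp: indicator_def not_le)
    also have "\<dots> = (LINT y|\<beta>. h y * g ((y - x) /\<^sub>R \<delta>))"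
      unfolding \<beta>_def set_lebesgue_integral_def by (subst integral_density) auto
    finally show ?thesis .
  qed
  have [measurable_cong]: "sets \<beta> = sets borel" by (simp add: \<beta>_def)
  \<comment> \<open>The density at \<open>y\<close> of \<kappa> smoothed at width \<delta>, without
    the normalising powers of \<delta>.\<close>
  define P where "P \<kappa> y = (LINT x|\<kappa>. g ((y - x) /\<^sub>R \<delta>))" for \<kappa> y
  have int_S: "(LINT x|\<kappa>. S x) = (LINT y|\<beta>. h y * P \<kappa> y) / \<delta> ^ CARD('n)"
    and P_meas: "P \<kappa> \<in> borel_measurable borel" and P1: "\<And>y. \<bar>P \<kappa> y\<bar> \<le> 1"
    and Sh': "\<bar>(LINT x|\<kappa>. S x) - (LINT x|\<kappa>. h x)\<bar> \<le> ?\<omega>"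
    and P_cis: "\<And>y. complex_of_real (P \<kappa> y) =
      of_real c * (LINT u|\<gamma>. cis ((u /\<^sub>R \<delta>) \<bullet> y) * (LINT x|\<kappa>. cis ((u /\<^sub>R - \<delta>) \<bullet> x)))"
    if \<kappa>: "\<kappa> \<in> borel_probabilities" for \<kappa>
  proof -
    have [measurable_cong]: "sets \<kappa> = sets borel" using \<kappa> by (simp add: borel_probabilities_def)
    interpret \<kappa>: prob_space \<kappa> using \<kappa> by (simp add: borel_probabilities_def)
    have fin_\<kappa>: "finite_measure \<kappa>" by (rule \<kappa>.finite_measure_axioms)
    have "(LINT x|\<kappa>. S x) = (LINT x|\<kappa>. LINT y|\<beta>. h y * g ((y - x) /\<^sub>R \<delta>)) / \<delta> ^ CARD('n)"
      unfolding S by simp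
    also have "(LINT x|\<kappa>. LINT y|\<beta>. h y * g ((y - x) /\<^sub>R \<delta>)) = (LINT y|\<beta>. LINT x|\<kappa>. h y * g ((y - x) /\<^sub>R \<delta>))"
    proof (rule Fubini_bounded[OF fin_\<beta> fin_\<kappa>, where B=1])
      show "(\<lambda>(y, x). h y * g ((y - x) /\<^sub>R \<delta>)) \<in> borel_measurable (\<beta> \<Otimes>\<^sub>M \<kappa>)" by measurable
      show "norm (h y * g ((y - x) /\<^sub>R \<delta>)) \<le> 1" for y x
        using mult_mono[OF h1[of y] g01(2)] g01 by (simp add: abs_mult)
    qed
    finally show "(LINT x|\<kappa>. S x) = (LINT y|\<beta>. h y * P \<kappa> y) / \<delta> ^ CARD('n)" by (simp add: P_def)
    show "P \<kappa> \<in> borel_measurable borel" unfolding P_def by measurable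
    show "\<bar>P \<kappa> y\<bar> \<le> 1" for y
    proof -
      have "\<bar>P \<kappa> y\<bar> \<le> (LINT x|\<kappa>. \<bar>g ((y - x) /\<^sub>R \<delta>)\<bar>)" unfolding P_def by (rule integral_abs_bound)
      also have "\<dots> \<le> (LINT x|\<kappa>. 1)"
      proof (rule integral_mono)
        show "integrable \<kappa> (\<lambda>x. \<bar>g ((y - x) /\<^sub>R \<delta>)\<bar>)"
          by (rule integrable_bounded[OF fin_\<kappa>, of _ 1], measurable) (use g01 in auto)
      qed (use g01 in auto)
      finally show ?thesis by (simp add: \<kappa>.prob_space)
    qed
    have [measurable]: "S \<in> borel_measurable borel" unfolding S_def by measurable
    have iS: "integrable \<kappa> S" and ih: "integrable \<kappa> h"
    proof -
      have "\<bar>S x\<bar> \<le> ?\<omega> + 1" for x using Sh[of x] h1[of x] by linarith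
      note b = this
      show "integrable \<kappa> S"
        by (intro integrable_bounded[OF fin_\<kappa>, of _ "?\<omega> + 1"]) (measurable, simp_all add: b)
      show "integrable \<kappa> h"
        by (intro integrable_bounded[OF fin_\<kappa>, of _ 1]) (measurable, simp_all add: h1)
    qed
    have "\<bar>(LINT x|\<kappa>. S x) - (LINT x|\<kappa>. h x)\<bar> = \<bar>LINT x|\<kappa>. S x - h x\<bar>" using iS ih by simp
    also have "\<dots> \<le> (LINT x|\<kappa>. \<bar>S x - h x\<bar>)" by (rule integral_abs_bound)
    also have "\<dots> \<le> (LINT x|\<kappa>. ?\<omega>)" using iS ih Sh by (intro integral_mono) auto
    finally show "\<bar>(LINT x|\<kappa>. S x) - (LINT x|\<kappa>. h x)\<bar> \<le> ?\<omega>" by (simp add: \<kappa>.prob_space)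
    fix y
    have "complex_of_real (P \<kappa> y) = (LINT x|\<kappa>. complex_of_real (g ((y - x) /\<^sub>R \<delta>)))"
      unfolding P_def by simp
    also have "\<dots> = of_real c * (LINT x|\<kappa>. LINT u|\<gamma>. cis (u \<bullet> ((y - x) /\<^sub>R \<delta>)))"
      unfolding g_cis by simp
    also have "(LINT x|\<kappa>. LINT u|\<gamma>. cis (u \<bullet> ((y - x) /\<^sub>R \<delta>))) = (LINT u|\<gamma>. LINT x|\<kappa>. cis (u \<bullet> ((y - x) /\<^sub>R \<delta>)))"
      by (rule Fubini_bounded[OF fin_\<gamma> fin_\<kappa>, where B=1]) auto
    also have "\<dots> = (LINT u|\<gamma>. cis ((u /\<^sub>R \<delta>) \<bullet> y) * (LINT x|\<kappa>. cis ((u /\<^sub>R - \<delta>) \<bullet> x)))"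
    proof -
      have "u \<bullet> ((y - x) /\<^sub>R \<delta>) = (u /\<^sub>R \<delta>) \<bullet> y + (u /\<^sub>R - \<delta>) \<bullet> x" for u x :: "real^'n"
        by (simp add: inner_diff_right algebra_simps)
      then have "cis (u \<bullet> ((y - x) /\<^sub>R \<delta>)) = cis ((u /\<^sub>R \<delta>) \<bullet> y) * cis ((u /\<^sub>R - \<delta>) \<bullet> x)" for u x :: "real^'n"
        by (simp only: cis_mult)
      then show ?thesis by (simp only: integral_mult_right_zero)
    qed
    finally show "complex_of_real (P \<kappa> y) =
      of_real c * (LINT u|\<gamma>. cis ((u /\<^sub>R \<delta>) \<bullet> y) * (LINT x|\<kappa>. cis ((u /\<^sub>R - \<delta>) \<bullet> x)))" .
  qed
  define \<phi> where "\<phi> \<kappa> u = (LINT x|\<kappa>. cis ((u /\<^sub>R - \<delta>) \<bullet> x))" for \<kappa> and u :: "real^'n"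
  have \<phi>: "\<phi> \<kappa> \<in> borel_measurable borel" "norm (\<phi> \<kappa> u) \<le> 1" if \<kappa>: "\<kappa> \<in> borel_probabilities" for \<kappa> u
  proof -
    have [measurable_cong]: "sets \<kappa> = sets borel" using \<kappa> by (simp add: borel_probabilities_def)
    interpret \<kappa>: prob_space \<kappa> using \<kappa> by (simp add: borel_probabilities_def)
    show "\<phi> \<kappa> \<in> borel_measurable borel" unfolding \<phi>_def by measurable
    have "norm (\<phi> \<kappa> u) \<le> (LINT x|\<kappa>. norm (cis ((u /\<^sub>R - \<delta>) \<bullet> x)))" unfolding \<phi>_def by (rule integral_norm_bound)
    then show "norm (\<phi> \<kappa> u) \<le> 1" by (simp add: \<kappa>.prob_space)
  qed
  note [measurable] = \<phi>(1)[OF \<mu>] \<phi>(1)[OF \<nu>]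
  \<comment> \<open>The smoothed densities differ by at most a Gaussian average of the difference of
    the characteristic functions, uniformly in \<open>y\<close>; integration over the ball then
    produces the volume factor.\<close>
  have PD: "\<bar>P \<mu> y - P \<nu> y\<bar> \<le> ?D" for y
  proof -
    have i: "integrable \<gamma> (\<lambda>u. cis ((u /\<^sub>R \<delta>) \<bullet> y) * \<phi> \<kappa> u)" if "\<kappa> \<in> borel_probabilities" for \<kappa>
    proof (rule integrable_bounded[OF fin_\<gamma>])
      note [measurable] = \<phi>(1)[OF that]
      show "(\<lambda>u. cis ((u /\<^sub>R \<delta>) \<bullet> y) * \<phi> \<kappa> u) \<in> borel_measurable \<gamma>" by measurable
      show "norm (cis ((u /\<^sub>R \<delta>) \<bullet> y) * \<phi> \<kappa> u) \<le> 1" for u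
        using \<phi>(2)[OF that] by (simp add: norm_mult)
    qed
    have d: "integrable \<gamma> (\<lambda>u. norm (\<phi> \<mu> u - \<phi> \<nu> u))"
    proof (rule integrable_bounded[OF fin_\<gamma>])
      show "(\<lambda>u. norm (\<phi> \<mu> u - \<phi> \<nu> u)) \<in> borel_measurable \<gamma>" by measurable
      show "norm (norm (\<phi> \<mu> u - \<phi> \<nu> u)) \<le> 1 + 1" for u
        unfolding norm_of_real real_norm_def abs_norm_cancel by (intro norm_triangle_le_diff add_mono \<phi> \<mu> \<nu>)
    qed
    have "\<bar>P \<mu> y - P \<nu> y\<bar> = norm (complex_of_real (P \<mu> y) - of_real (P \<nu> y))"
      by (metis norm_of_real of_real_diff real_norm_def)
    also have "\<dots> = c * norm (LINT u|\<gamma>. cis ((u /\<^sub>R \<delta>) \<bullet> y) * (\<phi> \<mu> u - \<phi> \<nu> u))"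
      using i[OF \<mu>] i[OF \<nu>] c unfolding P_cis[OF \<mu>] P_cis[OF \<nu>] \<phi>_def[symmetric]
      by (simp add: right_diff_distrib[symmetric] norm_mult)
         (simp add: right_diff_distrib)
    also have "\<dots> \<le> 1 * (LINT u|\<gamma>. norm (cis ((u /\<^sub>R \<delta>) \<bullet> y) * (\<phi> \<mu> u - \<phi> \<nu> u)))"
      using c by (intro mult_mono integral_norm_bound) auto
    also have "\<dots> = ?D" by (simp add: norm_mult \<phi>_def \<gamma>_def)
    finally show ?thesis .
  qed
  have "\<bar>(LINT x|\<mu>. S x) - (LINT x|\<nu>. S x)\<bar> = \<bar>LINT y|\<beta>. h y * (P \<mu> y - P \<nu> y)\<bar> / \<delta> ^ CARD('n)"
  proof -
    have "integrable \<beta> (\<lambda>y. h y * P \<kappa> y)" if "\<kappa> \<in> borel_probabilities" for \<kappa>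
    proof (rule integrable_bounded[OF fin_\<beta>, of _ 1])
      note [measurable] = P_meas[OF that]
      show "(\<lambda>y. h y * P \<kappa> y) \<in> borel_measurable \<beta>" by measurable
      show "norm (h y * P \<kappa> y) \<le> 1" for y
        using mult_mono[OF h1[of y] P1[OF that, of y]] by (simp add: abs_mult)
    qed
    then show ?thesis
      using \<mu> \<nu> \<open>\<delta> > 0\<close> by (simp add: int_S right_diff_distrib diff_divide_distrib[symmetric])
  qed
  also have "\<dots> \<le> (LINT y|\<beta>. ?D) / \<delta> ^ CARD('n)"
  proof (intro divide_right_mono order_trans[OF integral_abs_bound] integral_mono)
    note [measurable] = P_meas[OF \<mu>] P_meas[OF \<nu>]
    have le: "\<bar>h y * (P \<mu> y - P \<nu> y)\<bar> \<le> ?D" for y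
      using mult_mono[OF h1[of y] PD[of y]] by (simp add: abs_mult)
    show "\<bar>h y * (P \<mu> y - P \<nu> y)\<bar> \<le> ?D" for y by (rule le)
    show "integrable \<beta> (\<lambda>y. \<bar>h y * (P \<mu> y - P \<nu> y)\<bar>)"
      using le by (intro integrable_bounded[OF fin_\<beta>, of _ ?D]) auto
    show "integrable \<beta> (\<lambda>y. ?D)" using fin_\<beta> by (simp add: finite_measure.integrable_const)
  qed (use \<open>\<delta> > 0\<close> in auto)
  also have "(LINT y|\<beta>. ?D) = ?V * ?D"
    by (simp add: \<beta> measure_def)
  finally have "\<bar>(LINT x|\<mu>. S x) - (LINT x|\<nu>. S x)\<bar> \<le> ?V / \<delta> ^ CARD('n) * ?D" by simp
  then show ?thesis using Sh'[OF \<mu>] Sh'[OF \<nu>] by linarith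
qed

lemma bl_dist_le:
  fixes \<mu> \<nu> :: "'a::metric_space measure"
  assumes "\<mu> \<in> borel_probabilities" "\<nu> \<in> borel_probabilities"
    and "\<And>h. lipschitz_seminorm h + sup_norm h \<le> 1 \<Longrightarrow> \<bar>(LINT x|\<mu>. h x) - (LINT x|\<nu>. h x)\<bar> \<le> c"
  shows "bl_dist \<mu> \<nu> \<le> c"
proof -
  have "ereal (bl_dist \<mu> \<nu>) \<le> ereal c"
    unfolding bl_dist_bounds[OF assms(1,2)] using assms(3) by (intro SUP_least) simp
  then show ?thesis by simp
qed

text \<open>The factor falls from 1 to 0 between the radii \<open>R\<close> and
  \<open>2 * R\<close>; as \<open>R \<ge> 1\<close>, it is 1-Lipschitz, and the product is
  2-Lipschitz. The error is written as a Chebyshev bound, to be integrated against second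
  moments.\<close>

lemma bl_test_cutoff:
  fixes h :: "real^'n \<Rightarrow> real"
  assumes h: "lipschitz_seminorm h + sup_norm h \<le> 1" and "R \<ge> 1"
  obtains k where "k \<in> borel_measurable borel" "\<And>x. \<bar>k x\<bar> \<le> 1" "\<And>x. norm x > 2 * R \<Longrightarrow> k x = 0"
    "\<And>x y. \<bar>k x - k y\<bar> \<le> 2 * dist x y" "\<And>x. \<bar>h x - k x\<bar> \<le> (norm x)\<^sup>2 / R\<^sup>2"
proof
  define c where "c x = max 0 (min 1 (2 - norm x / R))" for x :: "real^'n"
  define k where "k x = h x * c x" for x
  have c01: "0 \<le> c x" "c x \<le> 1" for x by (auto simp: c_def)
  have c_lip: "\<bar>c x - c y\<bar> \<le> dist x y" for x y
  proof -
    have "\<bar>c x - c y\<bar> \<le> \<bar>norm x / R - norm y / R\<bar>" by (auto simp: c_def)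
    also have "\<dots> = \<bar>norm x - norm y\<bar> / R" using \<open>R \<ge> 1\<close> by (simp add: diff_divide_distrib[symmetric])
    also have "\<dots> \<le> \<bar>norm x - norm y\<bar>" using \<open>R \<ge> 1\<close> divide_left_mono[of 1 R "\<bar>norm x - norm y\<bar>"] by simp
    also have "\<dots> \<le> dist x y" by (simp add: dist_norm norm_triangle_ineq3)
    finally show ?thesis .
  qed
  show lip: "\<bar>k x - k y\<bar> \<le> 2 * dist x y" for x y
  proof -
    have "k x - k y = (h x - h y) * c x + h y * (c x - c y)" by (simp add: k_def algebra_simps)
    then have "\<bar>k x - k y\<bar> \<le> \<bar>h x - h y\<bar> * \<bar>c x\<bar> + \<bar>h y\<bar> * \<bar>c x - c y\<bar>"
      by (metis abs_mult abs_triangle_ineq)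
    also have "\<dots> \<le> dist x y * 1 + 1 * dist x y"
      using bl_testD[OF h] c01[of x] c_lip[of x y] by (intro add_mono mult_mono) auto
    finally show ?thesis by simp
  qed
  then have "2-lipschitz_on UNIV k" by (intro lipschitz_onI) (auto simp: dist_real_def)
  then have "continuous_on UNIV k" by (rule lipschitz_on_continuous_on)
  then show "k \<in> borel_measurable borel" by (rule borel_measurable_continuous_onI)
  show "\<bar>k x\<bar> \<le> 1" for x
    using mult_mono[OF bl_testD(1)[OF h, of x] c01(2)[of x]] c01 by (simp add: k_def abs_mult)
  show "k x = 0" if "norm x > 2 * R" for x
    using that \<open>R \<ge> 1\<close> by (simp add: k_def c_def field_simps)
  show "\<bar>h x - k x\<bar> \<le> (norm x)\<^sup>2 / R\<^sup>2" for x
  proof (cases "norm x \<le> R")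
    case True
    then have "c x = 1" using \<open>R \<ge> 1\<close> by (simp add: c_def field_simps)
    then show ?thesis by (simp add: k_def)
  next
    case False
    have "\<bar>h x - k x\<bar> = \<bar>h x\<bar> * \<bar>1 - c x\<bar>" by (simp add: k_def abs_mult[symmetric] right_diff_distrib)
    also have "\<dots> \<le> 1 * 1" using bl_testD(1)[OF h, of x] c01[of x] by (intro mult_mono) auto
    also have "\<dots> \<le> (norm x)\<^sup>2 / R\<^sup>2" using False \<open>R \<ge> 1\<close> by (simp add: power_mono)
    finally show ?thesis .
  qed
qed

text \<open>Both sequences move, without a common limit: laws at \<open>t n + \<sigma> n\<close> and
  at \<open>t n\<close> are to be compared. The order of choices matters. The cut-off radius comes
  from the second moments, the smoothing width from dominated convergence, both uniformly in the
  test function and in \<open>n\<close>; the characteristic functions come last.\<close>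

lemma bl_dist_tendsto_0:
  fixes \<mu> \<nu> :: "nat \<Rightarrow> (real^'n) measure"
  assumes \<mu>: "\<And>n. \<mu> n \<in> borel_probabilities" and \<nu>: "\<And>n. \<nu> n \<in> borel_probabilities"
    and \<mu>2: "\<And>n. integrable (\<mu> n) (\<lambda>x. (norm x)\<^sup>2)" "\<And>n. (LINT x|\<mu> n. (norm x)\<^sup>2) \<le> B"
    and \<nu>2: "\<And>n. integrable (\<nu> n) (\<lambda>x. (norm x)\<^sup>2)" "\<And>n. (LINT x|\<nu> n. (norm x)\<^sup>2) \<le> B"
    and lim: "\<And>\<theta>. (\<lambda>n. (LINT x|\<mu> n. cis (\<theta> \<bullet> x)) - (LINT x|\<nu> n. cis (\<theta> \<bullet> x))) \<longlonglongrightarrow> 0"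
  shows "(\<lambda>n. bl_dist (\<mu> n) (\<nu> n)) \<longlonglongrightarrow> 0"
proof (rule LIMSEQ_I)
  fix e :: real assume "e > 0"
  define \<gamma> :: "(real^'n) measure" where "\<gamma> = std_gaussian"
  have [measurable_cong]: "sets \<gamma> = sets borel" by (simp add: \<gamma>_def)
  interpret \<gamma>: prob_space \<gamma> unfolding \<gamma>_def by (rule prob_space_std_gaussian)
  have "0 \<le> B" using order_trans[OF integral_nonneg_AE \<mu>2(2)[of 0]] by simp
  obtain R where R: "R \<ge> 1" "B / R\<^sup>2 \<le> e / 8"
  proof
    show "1 \<le> max 1 (sqrt (8 * B / e))" by simp
    have "8 * B / e = (sqrt (8 * B / e))\<^sup>2" using \<open>0 \<le> B\<close> \<open>e > 0\<close> by simp
    also have "\<dots> \<le> (max 1 (sqrt (8 * B / e)))\<^sup>2" by (intro power_mono) (use \<open>0 \<le> B\<close> \<open>e > 0\<close> in auto)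
    finally have "8 * B \<le> e * (max 1 (sqrt (8 * B / e)))\<^sup>2" using \<open>e > 0\<close> by (simp add: field_simps)
    moreover have "(max 1 (sqrt (8 * B / e)))\<^sup>2 > 0" by (intro zero_less_power) auto
    ultimately show "B / (max 1 (sqrt (8 * B / e)))\<^sup>2 \<le> e / 8" by (simp add: field_simps)
  qed
  have "(\<lambda>k. LINT z|\<gamma>. min 2 (2 * (1 / Suc k) * norm z)) \<longlonglongrightarrow> (LINT z|\<gamma>. 0)"
  proof (rule integral_dominated_convergence[where w="\<lambda>_. 2"])
    show "AE z in \<gamma>. (\<lambda>k. min 2 (2 * (1 / Suc k) * norm z)) \<longlonglongrightarrow> 0"
    proof (rule AE_I2)
      fix z
      have "(\<lambda>k. min 2 (2 * (1 / Suc k) * norm z)) \<longlonglongrightarrow> min 2 (2 * 0 * norm z)"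
        by (intro tendsto_intros LIMSEQ_Suc[OF lim_1_over_n])
      then show "(\<lambda>k. min 2 (2 * (1 / Suc k) * norm z)) \<longlonglongrightarrow> 0" by simp
    qed
    show "AE z in \<gamma>. norm (min 2 (2 * (1 / Suc k) * norm z)) \<le> 2" for k
      by (rule AE_I2) (auto simp: abs_le_iff min_def intro: order_trans[of _ 0])
  qed auto
  then have "eventually (\<lambda>k. (LINT z|\<gamma>. min 2 (2 * (1 / Suc k) * norm z)) < e / 8) sequentially"
    using \<open>e > 0\<close> by (intro order_tendstoD) auto
  then obtain k where k: "(LINT z|\<gamma>. min 2 (2 * (1 / Suc k) * norm z)) < e / 8"
    unfolding eventually_sequentially by blast
  define \<delta> where "\<delta> = 1 / real (Suc k)"
  have "\<delta> > 0" by (simp add: \<delta>_def)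
  define \<phi> where "\<phi> \<kappa> u = (LINT x|\<kappa>. cis ((u /\<^sub>R - \<delta>) \<bullet> x))" for \<kappa> and u :: "real^'n"
  have \<phi>: "\<phi> \<kappa> \<in> borel_measurable borel" "norm (\<phi> \<kappa> u) \<le> 1" if \<kappa>: "\<kappa> \<in> borel_probabilities" for \<kappa> u
  proof -
    have [measurable_cong]: "sets \<kappa> = sets borel" using \<kappa> by (simp add: borel_probabilities_def)
    interpret \<kappa>: prob_space \<kappa> using \<kappa> by (simp add: borel_probabilities_def)
    show "\<phi> \<kappa> \<in> borel_measurable borel" unfolding \<phi>_def by measurable
    have "norm (\<phi> \<kappa> u) \<le> (LINT x|\<kappa>. norm (cis ((u /\<^sub>R - \<delta>) \<bullet> x)))" unfolding \<phi>_def by (rule integral_norm_bound)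
    then show "norm (\<phi> \<kappa> u) \<le> 1" by (simp add: \<kappa>.prob_space)
  qed
  note [measurable] = \<phi>(1)[OF \<mu>] \<phi>(1)[OF \<nu>]
  define V where "V = measure lborel (cball (0::real^'n) (2 * R)) / \<delta> ^ CARD('n)"
  have "(\<lambda>n. LINT u|\<gamma>. norm (\<phi> (\<mu> n) u - \<phi> (\<nu> n) u)) \<longlonglongrightarrow> (LINT u|\<gamma>. 0)"
  proof (rule integral_dominated_convergence[where w="\<lambda>_. 1 + 1"])
    show "AE u in \<gamma>. (\<lambda>n. norm (\<phi> (\<mu> n) u - \<phi> (\<nu> n) u)) \<longlonglongrightarrow> 0"
      unfolding \<phi>_def by (intro AE_I2 tendsto_norm_zero lim)
    show "AE u in \<gamma>. norm (norm (\<phi> (\<mu> n) u - \<phi> (\<nu> n) u)) \<le> 1 + 1" for n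
      unfolding norm_of_real real_norm_def abs_norm_cancel
      by (intro AE_I2 norm_triangle_le_diff add_mono \<phi> \<mu> \<nu>)
  qed auto
  then have "(\<lambda>n. V * (LINT u|\<gamma>. norm (\<phi> (\<mu> n) u - \<phi> (\<nu> n) u))) \<longlonglongrightarrow> 0"
    using tendsto_mult_right_zero by fastforce
  then have "eventually (\<lambda>n. V * (LINT u|\<gamma>. norm (\<phi> (\<mu> n) u - \<phi> (\<nu> n) u)) < e / 8) sequentially"
    using \<open>e > 0\<close> by (intro order_tendstoD) auto
  then obtain N where N: "\<And>n. n \<ge> N \<Longrightarrow> V * (LINT u|\<gamma>. norm (\<phi> (\<mu> n) u - \<phi> (\<nu> n) u)) < e / 8"
    unfolding eventually_sequentially by blast
  \<comment> \<open>Two cut-offs, two smoothing errors and one term from the characteristic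
    functions, each worth \<open>e / 8\<close>.\<close>
  have le: "bl_dist (\<mu> n) (\<nu> n) \<le> e / 8 + e / 8 + (2 * (e / 8) + e / 8)" if "n \<ge> N" for n
  proof (rule bl_dist_le[OF \<mu> \<nu>])
    fix h :: "real^'n \<Rightarrow> real" assume h: "lipschitz_seminorm h + sup_norm h \<le> 1"
    obtain k' where k': "k' \<in> borel_measurable borel" "\<And>x. \<bar>k' x\<bar> \<le> 1" "\<And>x. norm x > 2 * R \<Longrightarrow> k' x = 0"
      "\<And>x y. \<bar>k' x - k' y\<bar> \<le> 2 * dist x y" "\<And>x. \<bar>h x - k' x\<bar> \<le> (norm x)\<^sup>2 / R\<^sup>2"
      using bl_test_cutoff[OF h R(1)] by blast
    have cut: "\<bar>(LINT x|\<kappa>. h x) - (LINT x|\<kappa>. k' x)\<bar> \<le> e / 8"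
      if \<kappa>: "\<kappa> \<in> borel_probabilities" "integrable \<kappa> (\<lambda>x. (norm x)\<^sup>2)" "(LINT x|\<kappa>. (norm x)\<^sup>2) \<le> B" for \<kappa>
    proof -
      have [measurable_cong]: "sets \<kappa> = sets borel" using \<kappa>(1) by (simp add: borel_probabilities_def)
      interpret \<kappa>: prob_space \<kappa> using \<kappa>(1) by (simp add: borel_probabilities_def)
      have ih: "integrable \<kappa> h" by (rule bl_test_integrable[OF h \<kappa>(1)])
      have ik: "integrable \<kappa> k'"
        by (rule integrable_bounded[OF \<kappa>.finite_measure_axioms, of _ 1]) (use k' in \<open>auto simp: measurable_cong_sets[OF \<open>sets \<kappa> = sets borel\<close> refl]\<close>)
      have "\<bar>(LINT x|\<kappa>. h x) - (LINT x|\<kappa>. k' x)\<bar> = \<bar>LINT x|\<kappa>. h x - k' x\<bar>" using ih ik by simp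
      also have "\<dots> \<le> (LINT x|\<kappa>. \<bar>h x - k' x\<bar>)" by (rule integral_abs_bound)
      also have "\<dots> \<le> (LINT x|\<kappa>. (norm x)\<^sup>2 / R\<^sup>2)" using ih ik \<kappa>(2) k'(5) by (intro integral_mono) auto
      also have "\<dots> \<le> B / R\<^sup>2" using \<kappa>(3) by (simp add: divide_right_mono)
      also note R(2)
      finally show ?thesis .
    qed
    have "\<bar>(LINT x|\<mu> n. k' x) - (LINT x|\<nu> n. k' x)\<bar> \<le> 2 * (LINT z|\<gamma>. min 2 (2 * \<delta> * norm z))
        + V * (LINT u|\<gamma>. norm (\<phi> (\<mu> n) u - \<phi> (\<nu> n) u))"
      unfolding V_def \<phi>_def \<gamma>_def using k' by (intro gaussian_smoothing_bound \<mu> \<nu> \<open>\<delta> > 0\<close>) auto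
    also have "\<dots> \<le> 2 * (e / 8) + e / 8"
      using N[OF that] k unfolding \<delta>_def by linarith
    finally show "\<bar>(LINT x|\<mu> n. h x) - (LINT x|\<nu> n. h x)\<bar> \<le> e / 8 + e / 8 + (2 * (e / 8) + e / 8)"
      using cut[OF \<mu> \<mu>2, of n] cut[OF \<nu> \<nu>2, of n] by linarith
  qed
  have "0 \<le> bl_dist (\<mu> n) (\<nu> n)" for n
    using Metric_space.nonneg[OF Metric_space_bl_dist] .
  then have "norm (bl_dist (\<mu> n) (\<nu> n) - 0) < e" if "n \<ge> N" for n
    using le[OF that] \<open>e > 0\<close> by simp
  then show "\<exists>N. \<forall>n\<ge>N. norm (bl_dist (\<mu> n) (\<nu> n) - 0) < e" by blast
qed

section \<open>Gaussian increments\<close>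

lemma (in filtered_prob_space) F_measurable_events:
  "f \<in> measurable (F t) N \<Longrightarrow> f \<in> measurable M N"
  using subalgebra_F[of t] by (rule measurable_from_subalg)

lemma (in filtered_prob_space) F_measurable_mono:
  assumes "f \<in> measurable (F s) N" "s \<le> t"
  shows "f \<in> measurable (F t) N"
  by (rule measurable_from_subalg[OF _ assms(1)])
     (simp add: subalgebra_def space_F sets_F_mono assms(2))

text \<open>The independence of the \<sigma>-algebras passes to \<open>Z\<close>, which is
  measurable for the past, and to the character, which is a function of the increment; the
  expectation splits and the second factor is a Gaussian characteristic function.\<close>

lemma (in filtered_prob_space) brownian_increment_cis:
  fixes W :: "real \<Rightarrow> 'w \<Rightarrow> real^'m" and Z :: "'w \<Rightarrow> complex"
  assumes W: "brownian_motion M F W" and ab: "a \<le> b"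
    and Z: "Z \<in> borel_measurable (F a)" "\<And>\<omega>. norm (Z \<omega>) \<le> 1"
  shows "(LINT \<omega>|M. Z \<omega> * cis (\<theta> \<bullet> (W b \<omega> - W a \<omega>))) =
    (LINT \<omega>|M. Z \<omega>) * of_real (exp (- ((b - a) * (norm \<theta>)\<^sup>2) / 2))"
\<comment> \<open>A density of the increment exists only for \<open>a < b\<close>.\<close>
proof (cases "a = b")
  case False
  then have "a < b" using ab by simp
  define D where "D \<omega> = W b \<omega> - W a \<omega>" for \<omega>
  let ?Y = "\<lambda>\<omega>. cis (\<theta> \<bullet> D \<omega>)"
  have ZM: "Z \<in> borel_measurable M" by (rule F_measurable_events[OF Z(1)])
  have dist: "distributed M lborel D (\<lambda>x. ennreal (\<Prod>i\<in>UNIV. normal_density 0 (sqrt (b - a)) (x $ i)))"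
    and DF: "D \<in> borel_measurable (F b)"
    and ind: "indep_set (sets (vimage_algebra (space M) D borel)) (sets (F a))"
    using W \<open>a < b\<close> unfolding brownian_motion_def D_def by (auto simp: less_imp_le)
  have DM: "D \<in> borel_measurable M" by (rule F_measurable_events[OF DF])
  have YM: "?Y \<in> borel_measurable M" using DM by measurable
  have gen: "sigma_sets (space M) {f -` A \<inter> space M |A. A \<in> sets borel} \<subseteq> sets N"
    if "f \<in> borel_measurable N" "space N = space M" for f :: "'w \<Rightarrow> complex" and N
    unfolding that(2)[symmetric] by (rule sets.sigma_sets_subset) (auto intro: measurable_sets[OF that(1)])
  have indep: "indep_var borel Z borel ?Y"
    unfolding indep_var_eq
  proof (intro conjI ZM YM indep_setI)
    show sub: "sigma_sets (space M) {Z -` A \<inter> space M |A. A \<in> sets borel} \<subseteq> events"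
      "sigma_sets (space M) {?Y -` A \<inter> space M |A. A \<in> sets borel} \<subseteq> events"
      using gen[OF ZM] gen[OF YM] by auto
    fix A B assume A: "A \<in> sigma_sets (space M) {Z -` A \<inter> space M |A. A \<in> sets borel}"
      and B: "B \<in> sigma_sets (space M) {?Y -` A \<inter> space M |A. A \<in> sets borel}"
    have "sigma_sets (space M) {Z -` A \<inter> space M |A. A \<in> sets borel} \<subseteq> sets (F a)"
      by (rule gen[OF Z(1) space_F])
    moreover have "sigma_sets (space M) {?Y -` A \<inter> space M |A. A \<in> sets borel}
        \<subseteq> sets (vimage_algebra (space M) D borel)"
    proof -
      have "D \<in> measurable (vimage_algebra (space M) D borel) borel" by (rule measurable_vimage_algebra1) simp
      then have "?Y \<in> borel_measurable (vimage_algebra (space M) D borel)" by measurable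
      then show ?thesis by (rule gen) simp
    qed
    ultimately have "prob (B \<inter> A) = prob B * prob A" using indep_setD[OF ind] A B by blast
    then show "prob (A \<inter> B) = prob A * prob B" by (simp add: Int_commute mult.commute)
  qed
  have "(LINT \<omega>|M. Z \<omega> * ?Y \<omega>) = (LINT \<omega>|M. Z \<omega>) * (LINT \<omega>|M. ?Y \<omega>)"
    using Z(2) ZM YM
    by (intro indep_var_lebesgue_integral indep) (auto intro!: integrable_bounded[OF finite_measure_axioms, of _ 1])
  also have "(LINT \<omega>|M. ?Y \<omega>) = (LINT x|distr M lborel D. cis (\<theta> \<bullet> x))"
    using DM by (subst integral_distr) auto
  also have "\<dots> = (LINT x|lborel. of_real (\<Prod>i\<in>UNIV. normal_density 0 (sqrt (b - a)) (x $ i)) * cis (\<theta> \<bullet> x))"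
    unfolding distributed_distr_eq_density[OF dist]
    by (subst integral_density) (auto simp: scaleR_conv_of_real prod_nonneg)
  also have "\<dots> = of_real (exp (- ((b - a) * (norm \<theta>)\<^sup>2) / 2))"
    using \<open>a < b\<close> by (subst integral_gaussian_cis) (auto simp: power_mult_distrib)
  finally show ?thesis by (simp add: D_def)
qed simp

text \<open>Induction over the cells: \<open>Z\<close> times the character of the sum so far takes
  the role of \<open>Z\<close> for the next increment. Adaptedness and the value are therefore
  proved together.\<close>

lemma (in filtered_prob_space) elementary_integral_cis:
  fixes W :: "real \<Rightarrow> 'w \<Rightarrow> real^'m" and Z :: "'w \<Rightarrow> complex"
  assumes W: "brownian_motion M F W" and p: "partition_of s t n p"
    and Z: "Z \<in> borel_measurable (F s)" "\<And>\<omega>. norm (Z \<omega>) \<le> 1"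
  shows "(\<lambda>\<omega>. Z \<omega> * cis (\<theta> \<bullet> elementary_integral W n p C \<omega>)) \<in> borel_measurable (F t)" (is ?meas)
    and "(LINT \<omega>|M. Z \<omega> * cis (\<theta> \<bullet> elementary_integral W n p C \<omega>)) =
      (LINT \<omega>|M. Z \<omega>) * of_real (exp (- (\<Sum>i<n. (p (Suc i) - p i) * (norm (\<theta> v* C i))\<^sup>2) / 2))" (is ?eq)
proof -
  have "?meas \<and> ?eq" using p
  proof (induction n arbitrary: t)
    case 0
    then have "s = t" by (auto simp: partition_of_def)
    then show ?case using Z(1) by (simp add: elementary_integral_def)
  next
    case (Suc n)
    then have IH: "partition_of s (p n) n p" and t: "t = p (Suc n)" "p n \<le> t"
      by (auto simp: partition_of_def)
    let ?Z = "\<lambda>\<omega>. Z \<omega> * cis (\<theta> \<bullet> elementary_integral W n p C \<omega>)"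
    let ?D = "\<lambda>\<omega>. W (p (Suc n)) \<omega> - W (p n) \<omega>"
    note IH = Suc.IH[OF IH]
    have D: "?D \<in> borel_measurable (F t)" using W t unfolding brownian_motion_def by blast
    have split: "Z \<omega> * cis (\<theta> \<bullet> elementary_integral W (Suc n) p C \<omega>) = ?Z \<omega> * cis ((\<theta> v* C n) \<bullet> ?D \<omega>)" for \<omega>
      by (simp add: elementary_integral_def inner_add_right dot_lmul_matrix cis_mult[symmetric])
    have "?Z \<in> borel_measurable (F t)" using IH t by (blast intro: F_measurable_mono)
    then have "(\<lambda>\<omega>. ?Z \<omega> * cis ((\<theta> v* C n) \<bullet> ?D \<omega>)) \<in> borel_measurable (F t)"
      using D by measurable
    moreover have "(LINT \<omega>|M. ?Z \<omega> * cis ((\<theta> v* C n) \<bullet> ?D \<omega>)) =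
        (LINT \<omega>|M. ?Z \<omega>) * of_real (exp (- ((p (Suc n) - p n) * (norm (\<theta> v* C n))\<^sup>2) / 2))"
      using IH t Z(2) by (intro brownian_increment_cis[OF W]) (auto simp: norm_mult)
    ultimately show ?case
      unfolding split using IH
      by (simp add: exp_add[symmetric] of_real_mult[symmetric] add_divide_distrib del: of_real_mult)
  qed
  then show ?meas ?eq by auto
qed

text \<open>The convergence is stated with nonnegative integrals, which may be infinite for small
  \<open>k\<close>, so integrability belongs to the conclusion and holds from some \<open>K\<close>
  on. The first power is controlled by \<open>x \<le> \<eta> + x^2 / \<eta>\<close>.\<close>

lemma nn_integral_square_tendsto_0D:
  fixes D :: "nat \<Rightarrow> 'x \<Rightarrow> 'b::{banach, second_countable_topology}"
  assumes "finite_measure N" and D[measurable]: "\<And>k. D k \<in> borel_measurable N"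
    and lim: "(\<lambda>k. \<integral>\<^sup>+x. ennreal ((norm (D k x))\<^sup>2) \<partial>N) \<longlonglongrightarrow> 0" and "e > 0"
  shows "\<exists>K. \<forall>k\<ge>K. integrable N (\<lambda>x. norm (D k x)) \<and> integrable N (\<lambda>x. (norm (D k x))\<^sup>2) \<and>
    (LINT x|N. norm (D k x)) \<le> e \<and> (LINT x|N. (norm (D k x))\<^sup>2) \<le> e"
proof -
  interpret finite_measure N by fact
  define m where "m = measure N (space N)"
  \<comment> \<open>Chosen so that \<open>\<eta> * m \<le> e / 2\<close> pays for the constant part;
    a square integral below \<open>e / 2 * \<eta>\<close> pays for the quotient.\<close>
  define \<eta> where "\<eta> = e / (2 * (m + 1))"
  have m: "m \<ge> 0" by (simp add: m_def)
  have \<eta>: "\<eta> > 0" "\<eta> * m \<le> e / 2" using m \<open>e > 0\<close> by (auto simp: \<eta>_def field_simps)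
  have "eventually (\<lambda>k. (\<integral>\<^sup>+x. ennreal ((norm (D k x))\<^sup>2) \<partial>N) < ennreal (min e (e / 2 * \<eta>))) sequentially"
    by (rule order_tendstoD(2)[OF lim]) (use \<eta> \<open>e > 0\<close> in auto)
  then obtain K where K: "\<And>k. k \<ge> K \<Longrightarrow> (\<integral>\<^sup>+x. ennreal ((norm (D k x))\<^sup>2) \<partial>N) < ennreal (min e (e / 2 * \<eta>))"
    unfolding eventually_sequentially by blast
  show ?thesis
  proof (intro exI[of _ K] allI impI)
    fix k assume "k \<ge> K"
    note lt = K[OF this]
    have i2: "integrable N (\<lambda>x. (norm (D k x))\<^sup>2)"
    proof (rule integrableI_bounded)
      have "(\<integral>\<^sup>+x. ennreal (norm ((norm (D k x))\<^sup>2)) \<partial>N) < ennreal (min e (e / 2 * \<eta>))" using lt by simp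
      also have "\<dots> < \<infinity>" by simp
      finally show "(\<integral>\<^sup>+x. ennreal (norm ((norm (D k x))\<^sup>2)) \<partial>N) < \<infinity>" .
    qed measurable
    have eq: "(\<integral>\<^sup>+x. ennreal ((norm (D k x))\<^sup>2) \<partial>N) = ennreal (LINT x|N. (norm (D k x))\<^sup>2)"
      using i2 by (intro nn_integral_eq_integral) auto
    have le: "(LINT x|N. (norm (D k x))\<^sup>2) \<le> min e (e / 2 * \<eta>)"
      using lt \<eta> \<open>e > 0\<close> unfolding eq by (subst (asm) ennreal_less_iff) auto
    have pt: "norm (D k x) \<le> \<eta> + (norm (D k x))\<^sup>2 / \<eta>" for x
    proof (cases "norm (D k x) \<le> \<eta>")
      case True
      then show ?thesis using \<eta> by (simp add: add_increasing2)
    next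
      case False
      then have "norm (D k x) * \<eta> \<le> (norm (D k x))\<^sup>2"
        by (simp add: power2_eq_square mult_left_mono)
      then have "norm (D k x) \<le> (norm (D k x))\<^sup>2 / \<eta>" using \<eta> by (simp add: field_simps)
      then show ?thesis using \<eta> by linarith
    qed
    have ib: "integrable N (\<lambda>x. \<eta> + (norm (D k x))\<^sup>2 / \<eta>)" using i2 by auto
    have i1: "integrable N (\<lambda>x. norm (D k x))"
      by (rule Bochner_Integration.integrable_bound[OF ib]) (auto intro!: AE_I2 order_trans[OF pt])
    have "(LINT x|N. norm (D k x)) \<le> (LINT x|N. \<eta> + (norm (D k x))\<^sup>2 / \<eta>)"
      by (rule integral_mono[OF i1 ib pt])
    also have "\<dots> = \<eta> * m + (LINT x|N. (norm (D k x))\<^sup>2) / \<eta>"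
      using i2 by (simp add: m_def mult.commute)
    also have "(LINT x|N. (norm (D k x))\<^sup>2) / \<eta> \<le> e / 2" using le \<eta> by (simp add: field_simps)
    finally show "integrable N (\<lambda>x. norm (D k x)) \<and> integrable N (\<lambda>x. (norm (D k x))\<^sup>2) \<and>
      (LINT x|N. norm (D k x)) \<le> e \<and> (LINT x|N. (norm (D k x))\<^sup>2) \<le> e"
      using i1 i2 \<eta>(2) le by auto
  qed
qed

text \<open>With \<open>d\<close> the difference of the norms, the squares differ by
  \<open>d^2 + 2 * norm b * d\<close>. Since \<open>b\<close> is bounded, convergence of the first
  two absolute moments of \<open>a k - b\<close> to 0 suffices.\<close>

lemma square_norm_integral_tendsto:
  fixes a :: "nat \<Rightarrow> 'x \<Rightarrow> 'b::{banach, second_countable_topology}"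
  assumes N: "finite_measure N" and a[measurable]: "\<And>k. a k \<in> borel_measurable N"
    and b[measurable]: "b \<in> borel_measurable N" and G: "\<And>x. x \<in> space N \<Longrightarrow> norm (b x) \<le> G"
    and lim: "(\<lambda>k. \<integral>\<^sup>+x. ennreal ((norm (a k x - b x))\<^sup>2) \<partial>N) \<longlonglongrightarrow> 0"
  shows "(\<lambda>k. LINT x|N. (norm (a k x))\<^sup>2) \<longlonglongrightarrow> (LINT x|N. (norm (b x))\<^sup>2)"
proof (rule LIMSEQ_I)
  fix e :: real assume "e > 0"
  interpret finite_measure N by fact
  define q where "q = 1 + 2 * \<bar>G\<bar>"
  define c where "c = e / (2 * q)"
  have c: "c > 0" "c * (1 + 2 * \<bar>G\<bar>) < e"
  proof -
    have "q > 0" by (simp add: q_def add_pos_nonneg)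
    then show "c > 0" "c * (1 + 2 * \<bar>G\<bar>) < e"
      using \<open>e > 0\<close> unfolding q_def[symmetric] by (simp_all add: c_def)
  qed
  obtain K where K: "\<And>k. k \<ge> K \<Longrightarrow> integrable N (\<lambda>x. norm (a k x - b x)) \<and> integrable N (\<lambda>x. (norm (a k x - b x))\<^sup>2) \<and>
      (LINT x|N. norm (a k x - b x)) \<le> c \<and> (LINT x|N. (norm (a k x - b x))\<^sup>2) \<le> c"
    using nn_integral_square_tendsto_0D[OF N _ lim c(1)] by auto
  have ib: "integrable N (\<lambda>x. (norm (b x))\<^sup>2)"
    using G by (intro integrable_const_bound[where B="G\<^sup>2"]) (auto intro!: AE_I2 power_mono)
  show "\<exists>K. \<forall>k\<ge>K. norm ((LINT x|N. (norm (a k x))\<^sup>2) - (LINT x|N. (norm (b x))\<^sup>2)) < e"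
  proof (intro exI[of _ K] allI impI)
    fix k assume "k \<ge> K"
    note Kk = K[OF this]
    have pt: "\<bar>(norm (a k x))\<^sup>2 - (norm (b x))\<^sup>2\<bar> \<le> (norm (a k x - b x))\<^sup>2 + 2 * \<bar>G\<bar> * norm (a k x - b x)"
      if "x \<in> space N" for x
    proof -
      define d where "d = norm (a k x) - norm (b x)"
      have d: "\<bar>d\<bar> \<le> norm (a k x - b x)" unfolding d_def by (rule norm_triangle_ineq3)
      have "(norm (a k x))\<^sup>2 - (norm (b x))\<^sup>2 = d\<^sup>2 + 2 * norm (b x) * d"
        by (simp add: d_def power2_eq_square algebra_simps)
      then have "\<bar>(norm (a k x))\<^sup>2 - (norm (b x))\<^sup>2\<bar> \<le> d\<^sup>2 + \<bar>2 * norm (b x) * d\<bar>"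
        using abs_triangle_ineq[of "d\<^sup>2" "2 * norm (b x) * d"] by simp
      also have "\<bar>2 * norm (b x) * d\<bar> = 2 * norm (b x) * \<bar>d\<bar>" by (simp add: abs_mult)
      also have "d\<^sup>2 \<le> (norm (a k x - b x))\<^sup>2" using power_mono[OF d, of 2] by simp
      also have "2 * norm (b x) * \<bar>d\<bar> \<le> 2 * \<bar>G\<bar> * norm (a k x - b x)"
        using d G[OF that] by (intro mult_mono) auto
      finally show ?thesis by simp
    qed
    have ibd: "integrable N (\<lambda>x. (norm (a k x - b x))\<^sup>2 + 2 * \<bar>G\<bar> * norm (a k x - b x))" using Kk by auto
    have id: "integrable N (\<lambda>x. (norm (a k x))\<^sup>2 - (norm (b x))\<^sup>2)"
      by (rule Bochner_Integration.integrable_bound[OF ibd]) (auto intro!: AE_I2 order_trans[OF pt])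
    have ia: "integrable N (\<lambda>x. (norm (a k x))\<^sup>2)"
      using Bochner_Integration.integrable_add[OF id ib] by simp
    have "norm ((LINT x|N. (norm (a k x))\<^sup>2) - (LINT x|N. (norm (b x))\<^sup>2))
        = \<bar>LINT x|N. (norm (a k x))\<^sup>2 - (norm (b x))\<^sup>2\<bar>" using ia ib by simp
    also have "\<dots> \<le> (LINT x|N. \<bar>(norm (a k x))\<^sup>2 - (norm (b x))\<^sup>2\<bar>)" by (rule integral_abs_bound)
    also have "\<dots> \<le> (LINT x|N. (norm (a k x - b x))\<^sup>2 + 2 * \<bar>G\<bar> * norm (a k x - b x))"
      using id ibd pt by (intro integral_mono) auto
    also have "\<dots> = (LINT x|N. (norm (a k x - b x))\<^sup>2) + 2 * \<bar>G\<bar> * (LINT x|N. norm (a k x - b x))"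
      using Kk by simp
    also have "\<dots> \<le> c + 2 * \<bar>G\<bar> * c" using Kk by (intro add_mono mult_left_mono) auto
    also have "\<dots> < e" using c by (simp add: algebra_simps)
    finally show "norm ((LINT x|N. (norm (a k x))\<^sup>2) - (LINT x|N. (norm (b x))\<^sup>2)) < e" .
  qed
qed

lemma partition_of_mono:
  assumes "partition_of s t n p" "i \<le> j" "j \<le> n"
  shows "p i \<le> p j"
  using assms(2,3)
proof (induction j)
  case (Suc j)
  then show ?case
    using assms(1) unfolding partition_of_def by (cases "i = Suc j") (auto intro: order_trans)
qed simp

text \<open>The half-open cells are disjoint, so squaring the sum produces no cross terms.\<close>

lemma step_function_energy:
  fixes C :: "nat \<Rightarrow> real^'m^'d"
  assumes p: "partition_of s t n p"
  shows "(LINT r|restrict_space lborel {s..t}. (norm (\<theta> v* step_function n p C r))\<^sup>2) =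
    (\<Sum>i<n. (p (Suc i) - p i) * (norm (\<theta> v* C i))\<^sup>2)"
proof -
  have pt: "(norm (\<theta> v* step_function k p C r))\<^sup>2 = (\<Sum>i<k. indicator {p i<..p (Suc i)} r * (norm (\<theta> v* C i))\<^sup>2)"
    if "k \<le> n" for r k
    using that
  proof (induction k)
    case 0
    then show ?case by (simp add: step_function_def)
  next
    case (Suc k)
    have S: "step_function (Suc k) p C r = step_function k p C r + indicator {p k<..p (Suc k)} r *\<^sub>R C k"
      by (simp add: step_function_def)
    show ?case
    proof (cases "r \<in> {p k<..p (Suc k)}")
      case True
      have "indicator {p i<..p (Suc i)} r = (0::real)" if "i < k" for i
        using partition_of_mono[OF p, of "Suc i" k] that Suc.prems True by (auto simp: indicator_def)
      then show ?thesis using True unfolding S by (simp add: step_function_def)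
    next
      case False
      then show ?thesis using Suc unfolding S by simp
    qed
  qed
  have ind: "indicator {s..t} r * indicator {p i<..p (Suc i)} r = (indicator {p i<..p (Suc i)} r :: real)"
    if "i < n" for i r
    using partition_of_mono[OF p, of 0 i] partition_of_mono[OF p, of "Suc i" n] that p
    by (auto simp: indicator_def partition_of_def)
  have le: "p i \<le> p (Suc i)" if "i < n" for i using p that by (simp add: partition_of_def)
  have "(LINT r|restrict_space lborel {s..t}. (norm (\<theta> v* step_function n p C r))\<^sup>2) =
      (LINT r|lborel. indicator {s..t} r * (norm (\<theta> v* step_function n p C r))\<^sup>2)"
    by (subst integral_restrict_space) auto
  also have "\<dots> = (LINT r|lborel. (\<Sum>i<n. indicator {p i<..p (Suc i)} r * (norm (\<theta> v* C i))\<^sup>2))"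
    unfolding pt[OF order_refl] sum_distrib_left
    by (intro Bochner_Integration.integral_cong sum.cong) (auto simp: ind mult.assoc[symmetric])
  also have "\<dots> = (\<Sum>i<n. (p (Suc i) - p i) * (norm (\<theta> v* C i))\<^sup>2)"
    using le by (subst Bochner_Integration.integral_sum) auto
  finally show ?thesis .
qed

section \<open>Characteristic functions of Wiener integrals\<close>

text \<open>The indefinite integral is only almost surely equal to something adapted, so adaptedness
  is carried along up to approximation in \<open>L\<^sup>1\<close>.\<close>

definition approx_adapted :: "'w measure \<Rightarrow> 'w measure \<Rightarrow> ('w \<Rightarrow> complex) \<Rightarrow> bool" where
  "approx_adapted M N Z \<longleftrightarrow> Z \<in> borel_measurable M \<and> (\<forall>\<omega>. norm (Z \<omega>) \<le> 1) \<and>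
    (\<forall>e>0. \<exists>Z'\<in>borel_measurable N. (\<forall>\<omega>. norm (Z' \<omega>) \<le> 1) \<and> (LINT \<omega>|M. norm (Z \<omega> - Z' \<omega>)) \<le> e)"

lemma (in filtered_prob_space) approx_adapted_measurable:
  assumes "Z \<in> borel_measurable (F t)" "\<And>\<omega>. norm (Z \<omega>) \<le> 1"
  shows "approx_adapted M (F t) Z"
  using assms F_measurable_events[OF assms(1)] unfolding approx_adapted_def
  by (auto intro!: bexI[of _ Z])

text \<open>The formula is exact for elementary integrals. The exponents converge because the step
  functions converge in square mean, the expectations because \<open>cis\<close> is 1-Lipschitz. The
  first conclusion allows a further increment to be appended.\<close>

lemma (in filtered_prob_space) stochastic_integral_cis:
  fixes W :: "real \<Rightarrow> 'w \<Rightarrow> real^'m" and g :: "real \<Rightarrow> real^'m^'d"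
  assumes W: "brownian_motion M F W" and Y: "is_stochastic_integral M W g s t Y"
    and g: "continuous_on UNIV g" and Z: "approx_adapted M (F s) Z"
  shows "approx_adapted M (F t) (\<lambda>\<omega>. Z \<omega> * cis (\<theta> \<bullet> Y \<omega>))" (is ?approx)
    and "(LINT \<omega>|M. Z \<omega> * cis (\<theta> \<bullet> Y \<omega>)) =
      (LINT \<omega>|M. Z \<omega>) * of_real (exp (- integral {s..t} (\<lambda>r. (norm (\<theta> v* g r))\<^sup>2) / 2))" (is ?eq)
proof -
  obtain n p C where p: "\<And>k. partition_of s t (n k) (p k)"
    and step: "(\<lambda>k. \<integral>\<^sup>+r\<in>{s..t}. ennreal ((norm (step_function (n k) (p k) (C k) r - g r))\<^sup>2) \<partial>lborel) \<longlonglongrightarrow> 0"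
    and elem: "(\<lambda>k. \<integral>\<^sup>+\<omega>. ennreal ((norm (elementary_integral W (n k) (p k) (C k) \<omega> - Y \<omega>))\<^sup>2) \<partial>M) \<longlonglongrightarrow> 0"
    and Y_meas: "Y \<in> borel_measurable M"
    using Y unfolding is_stochastic_integral_def by blast
  define E where "E k = elementary_integral W (n k) (p k) (C k)" for k
  have W_meas: "W r \<in> borel_measurable M" for r using W by (simp add: brownian_motion_def)
  have E_meas: "E k \<in> borel_measurable M" for k
  proof -
    note [measurable] = W_meas
    have [measurable]: "(\<lambda>x. B *v x) \<in> borel_measurable borel" for B :: "real^'m^'d"
      by (intro borel_measurable_continuous_onI linear_continuous_on matrix_vector_mul_bounded_linear)
    show ?thesis unfolding E_def elementary_integral_def by measurable
  qed
  note [measurable] = Y_meas E_meas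
  define N where "N = restrict_space lborel {s..t}"
  have N: "finite_measure N" "space N = {s..t}"
    by (auto intro!: finite_measureI simp: N_def emeasure_restrict_space space_restrict_space)
       (metis emeasure_lborel_Icc_eq ennreal_neq_top)
  define G where "G k = exp (- (\<Sum>i<n k. (p k (Suc i) - p k i) * (norm (\<theta> v* C k i))\<^sup>2) / 2)" for k
  define G0 where "G0 = exp (- integral {s..t} (\<lambda>r. (norm (\<theta> v* g r))\<^sup>2) / 2)"
  have G_lim: "G \<longlonglongrightarrow> G0"
  proof -
    have bl: "bounded_linear (\<lambda>B::real^'m^'d. \<theta> v* B)"
      unfolding linear_conv_bounded_linear[symmetric]
      by (intro linearI) (simp_all add: vector_matrix_mul_rid vector_matrix_mult_def vec_eq_iff sum.distrib
          algebra_simps sum_distrib_left)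
    obtain K where K: "K > 0" "\<And>B::real^'m^'d. norm (\<theta> v* B) \<le> norm B * K"
      using bounded_linear.pos_bounded[OF bl] by blast
    have diff: "\<theta> v* B - \<theta> v* B' = \<theta> v* (B - B')" for B B' :: "real^'m^'d"
      by (rule linear_diff[OF bounded_linear.linear[OF bl], symmetric])
    have cont: "continuous_on UNIV (\<lambda>r. \<theta> v* g r)"
      by (intro bounded_linear.continuous_on[OF bl] g)
    have "compact ((\<lambda>r. \<theta> v* g r) ` {s..t})"
      by (intro compact_continuous_image continuous_on_subset[OF cont]) auto
    then have "bounded ((\<lambda>r. \<theta> v* g r) ` {s..t})" by (rule compact_imp_bounded)
    then obtain H where "\<forall>x\<in>(\<lambda>r. \<theta> v* g r) ` {s..t}. norm x \<le> H"
      unfolding bounded_iff by blast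
    then have H: "\<And>r. r \<in> {s..t} \<Longrightarrow> norm (\<theta> v* g r) \<le> H" by blast
    have step_meas: "(\<lambda>r. step_function (n k) (p k) (C k) r) \<in> borel_measurable borel" for k
      unfolding step_function_def by measurable
    have vm: "(\<lambda>B::real^'m^'d. \<theta> v* B) \<in> borel_measurable borel"
      by (intro borel_measurable_continuous_onI linear_continuous_on bl)
    have m1: "(\<lambda>r. \<theta> v* step_function (n k) (p k) (C k) r) \<in> borel_measurable borel" for k
      using measurable_compose[OF step_meas vm] .
    have m2: "(\<lambda>r. \<theta> v* g r) \<in> borel_measurable borel"
      by (intro borel_measurable_continuous_onI cont)
    have "(\<lambda>k. LINT r|N. (norm (\<theta> v* step_function (n k) (p k) (C k) r))\<^sup>2) \<longlonglongrightarrow> (LINT r|N. (norm (\<theta> v* g r))\<^sup>2)"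
    proof (rule square_norm_integral_tendsto[OF N(1)])
      show "(\<lambda>r. \<theta> v* step_function (n k) (p k) (C k) r) \<in> borel_measurable N" for k
        using m1 unfolding N_def by (intro measurable_restrict_space1) simp
      show "(\<lambda>r. \<theta> v* g r) \<in> borel_measurable N"
        using m2 unfolding N_def by (intro measurable_restrict_space1) simp
      show "norm (\<theta> v* g r) \<le> H" if "r \<in> space N" for r using H that N by simp
      have up: "(\<integral>\<^sup>+r. ennreal ((norm (\<theta> v* step_function (n k) (p k) (C k) r - \<theta> v* g r))\<^sup>2) \<partial>N)
          \<le> ennreal (K\<^sup>2) * (\<integral>\<^sup>+r\<in>{s..t}. ennreal ((norm (step_function (n k) (p k) (C k) r - g r))\<^sup>2) \<partial>lborel)" for k
      proof -
        have mg: "(\<lambda>r. step_function (n k) (p k) (C k) r - g r) \<in> borel_measurable borel"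
          by (rule borel_measurable_diff[OF step_meas borel_measurable_continuous_onI[OF g]])
        have "(\<integral>\<^sup>+r. ennreal ((norm (\<theta> v* step_function (n k) (p k) (C k) r - \<theta> v* g r))\<^sup>2) \<partial>N)
            \<le> (\<integral>\<^sup>+r. ennreal (K\<^sup>2) * ennreal ((norm (step_function (n k) (p k) (C k) r - g r))\<^sup>2) \<partial>N)"
        proof (rule nn_integral_mono)
          fix r
          have "(norm (\<theta> v* step_function (n k) (p k) (C k) r - \<theta> v* g r))\<^sup>2
              \<le> (norm (step_function (n k) (p k) (C k) r - g r) * K)\<^sup>2"
            unfolding diff by (intro power_mono K(2)) auto
          then show "ennreal ((norm (\<theta> v* step_function (n k) (p k) (C k) r - \<theta> v* g r))\<^sup>2)
              \<le> ennreal (K\<^sup>2) * ennreal ((norm (step_function (n k) (p k) (C k) r - g r))\<^sup>2)"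
            by (subst ennreal_mult[symmetric]) (auto simp: power_mult_distrib mult.commute)
        qed
        also have "\<dots> = ennreal (K\<^sup>2) * (\<integral>\<^sup>+r. ennreal ((norm (step_function (n k) (p k) (C k) r - g r))\<^sup>2) \<partial>N)"
        proof (rule nn_integral_cmult)
          have "(\<lambda>r. ennreal ((norm (step_function (n k) (p k) (C k) r - g r))\<^sup>2)) \<in> borel_measurable lborel"
            using measurable_compose[OF mg, of "\<lambda>x. ennreal ((norm x)\<^sup>2)" borel] by simp
          then show "(\<lambda>r. ennreal ((norm (step_function (n k) (p k) (C k) r - g r))\<^sup>2)) \<in> borel_measurable N"
            unfolding N_def by (rule measurable_restrict_space1)
        qed
        also have "(\<integral>\<^sup>+r. ennreal ((norm (step_function (n k) (p k) (C k) r - g r))\<^sup>2) \<partial>N)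
            = (\<integral>\<^sup>+r\<in>{s..t}. ennreal ((norm (step_function (n k) (p k) (C k) r - g r))\<^sup>2) \<partial>lborel)"
          unfolding N_def by (subst nn_integral_restrict_space) auto
        finally show ?thesis .
      qed
      have "(\<lambda>k. ennreal (K\<^sup>2) * (\<integral>\<^sup>+r\<in>{s..t}. ennreal ((norm (step_function (n k) (p k) (C k) r - g r))\<^sup>2) \<partial>lborel)) \<longlonglongrightarrow> ennreal (K\<^sup>2) * 0"
        by (rule ennreal_tendsto_cmult[OF _ step]) simp
      then have "(\<lambda>k. ennreal (K\<^sup>2) * (\<integral>\<^sup>+r\<in>{s..t}. ennreal ((norm (step_function (n k) (p k) (C k) r - g r))\<^sup>2) \<partial>lborel)) \<longlonglongrightarrow> 0"
        by simp
      from tendsto_sandwich[OF always_eventually[OF allI[OF zero_le]] always_eventually[OF allI[OF up]] tendsto_const this]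
      show "(\<lambda>k. \<integral>\<^sup>+r. ennreal ((norm (\<theta> v* step_function (n k) (p k) (C k) r - \<theta> v* g r))\<^sup>2) \<partial>N) \<longlonglongrightarrow> 0" .
    qed
    moreover have "(LINT r|N. (norm (\<theta> v* step_function (n k) (p k) (C k) r))\<^sup>2) =
        (\<Sum>i<n k. (p k (Suc i) - p k i) * (norm (\<theta> v* C k i))\<^sup>2)" for k
      unfolding N_def by (rule step_function_energy[OF p])
    moreover have "(LINT r|N. (norm (\<theta> v* g r))\<^sup>2) = integral {s..t} (\<lambda>r. (norm (\<theta> v* g r))\<^sup>2)"
    proof -
      have "set_integrable lborel {s..t} (\<lambda>r. (norm (\<theta> v* g r))\<^sup>2)"
        by (intro borel_integrable_atLeastAtMost' continuous_intros continuous_on_subset[OF cont]) auto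
      then have "(LINT r:{s..t}|lborel. (norm (\<theta> v* g r))\<^sup>2) = integral {s..t} (\<lambda>r. (norm (\<theta> v* g r))\<^sup>2)"
        by (rule set_borel_integral_eq_integral)
      then show ?thesis unfolding N_def set_lebesgue_integral_def by (subst integral_restrict_space) auto
    qed
    ultimately show ?thesis unfolding G_def G0_def by (auto intro!: tendsto_intros)
  qed
  have ZM: "Z \<in> borel_measurable M" and Z1: "\<And>\<omega>. norm (Z \<omega>) \<le> 1" using Z by (auto simp: approx_adapted_def)
  note [measurable] = ZM
  \<comment> \<open>Replacing \<open>Z\<close> by an adapted \<open>Z'\<close> costs
    \<open>e\<close>, and replacing \<open>Y\<close> by a late elementary integral costs another
    \<open>e\<close>. The same \<open>Z'\<close> serves for all late \<open>k\<close>.\<close>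
  have key: "\<exists>Z'. Z' \<in> borel_measurable (F s) \<and> (\<forall>\<omega>. norm (Z' \<omega>) \<le> 1) \<and> (LINT \<omega>|M. norm (Z \<omega> - Z' \<omega>)) \<le> e \<and>
     (\<exists>K. \<forall>k\<ge>K. (LINT \<omega>|M. norm (Z \<omega> * cis (\<theta> \<bullet> Y \<omega>) - Z' \<omega> * cis (\<theta> \<bullet> E k \<omega>))) \<le> 2 * e)"
    if "e > 0" for e
  proof -
    obtain Z' where Z': "Z' \<in> borel_measurable (F s)" "\<And>\<omega>. norm (Z' \<omega>) \<le> 1" "(LINT \<omega>|M. norm (Z \<omega> - Z' \<omega>)) \<le> e"
      using Z \<open>e > 0\<close> unfolding approx_adapted_def by blast
    have [measurable]: "Z' \<in> borel_measurable M" using Z'(1) by (rule F_measurable_events)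
    have "e / (norm \<theta> + 1) > 0" using \<open>e > 0\<close> by (simp add: add_nonneg_pos)
    then obtain K where K: "\<And>k. k \<ge> K \<Longrightarrow> integrable M (\<lambda>\<omega>. norm (E k \<omega> - Y \<omega>)) \<and>
        (LINT \<omega>|M. norm (E k \<omega> - Y \<omega>)) \<le> e / (norm \<theta> + 1)"
      using nn_integral_square_tendsto_0D[OF finite_measure_axioms _ elem[folded E_def], of "e / (norm \<theta> + 1)"]
      by (auto simp del: zero_less_divide_iff)
    have "(LINT \<omega>|M. norm (Z \<omega> * cis (\<theta> \<bullet> Y \<omega>) - Z' \<omega> * cis (\<theta> \<bullet> E k \<omega>))) \<le> 2 * e" if "k \<ge> K" for k
    proof -
      have iZ: "integrable M (\<lambda>\<omega>. norm (Z \<omega> - Z' \<omega>))"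
      proof (rule integrable_bounded[OF finite_measure_axioms])
        show "norm (norm (Z \<omega> - Z' \<omega>)) \<le> 1 + 1" for \<omega>
          unfolding real_norm_def abs_norm_cancel by (intro norm_triangle_le_diff add_mono Z1 Z'(2))
      qed measurable
      have pt: "norm (Z \<omega> * cis (\<theta> \<bullet> Y \<omega>) - Z' \<omega> * cis (\<theta> \<bullet> E k \<omega>)) \<le> norm (Z \<omega> - Z' \<omega>) + norm \<theta> * norm (E k \<omega> - Y \<omega>)" for \<omega>
      proof -
        have "Z \<omega> * cis (\<theta> \<bullet> Y \<omega>) - Z' \<omega> * cis (\<theta> \<bullet> E k \<omega>) =
          (Z \<omega> - Z' \<omega>) * cis (\<theta> \<bullet> Y \<omega>) + Z' \<omega> * (cis (\<theta> \<bullet> Y \<omega>) - cis (\<theta> \<bullet> E k \<omega>))"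
          by (simp add: algebra_simps)
        then have "norm (Z \<omega> * cis (\<theta> \<bullet> Y \<omega>) - Z' \<omega> * cis (\<theta> \<bullet> E k \<omega>)) \<le>
          norm (Z \<omega> - Z' \<omega>) + norm (Z' \<omega>) * norm (cis (\<theta> \<bullet> Y \<omega>) - cis (\<theta> \<bullet> E k \<omega>))"
          using norm_triangle_ineq[of "(Z \<omega> - Z' \<omega>) * cis (\<theta> \<bullet> Y \<omega>)" "Z' \<omega> * (cis (\<theta> \<bullet> Y \<omega>) - cis (\<theta> \<bullet> E k \<omega>))"]
          by (simp add: norm_mult)
        also have "norm (Z' \<omega>) * norm (cis (\<theta> \<bullet> Y \<omega>) - cis (\<theta> \<bullet> E k \<omega>)) \<le> 1 * \<bar>\<theta> \<bullet> Y \<omega> - \<theta> \<bullet> E k \<omega>\<bar>"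
          using Z'(2) by (intro mult_mono norm_cis_diff_le) auto
        also have "1 * \<bar>\<theta> \<bullet> Y \<omega> - \<theta> \<bullet> E k \<omega>\<bar> \<le> norm \<theta> * norm (E k \<omega> - Y \<omega>)"
          using Cauchy_Schwarz_ineq2[of \<theta> "Y \<omega> - E k \<omega>"] by (simp add: inner_diff_right norm_minus_commute)
        finally show ?thesis by simp
      qed
      have "(LINT \<omega>|M. norm (Z \<omega> * cis (\<theta> \<bullet> Y \<omega>) - Z' \<omega> * cis (\<theta> \<bullet> E k \<omega>)))
          \<le> (LINT \<omega>|M. norm (Z \<omega> - Z' \<omega>) + norm \<theta> * norm (E k \<omega> - Y \<omega>))"
      proof (rule integral_mono)
        show ib: "integrable M (\<lambda>\<omega>. norm (Z \<omega> - Z' \<omega>) + norm \<theta> * norm (E k \<omega> - Y \<omega>))"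
          using iZ K[OF that] by auto
        show "integrable M (\<lambda>\<omega>. norm (Z \<omega> * cis (\<theta> \<bullet> Y \<omega>) - Z' \<omega> * cis (\<theta> \<bullet> E k \<omega>)))"
          by (rule Bochner_Integration.integrable_bound[OF ib]) (measurable, use pt in \<open>auto intro: order_trans\<close>)
      qed (rule pt)
      also have "\<dots> = (LINT \<omega>|M. norm (Z \<omega> - Z' \<omega>)) + norm \<theta> * (LINT \<omega>|M. norm (E k \<omega> - Y \<omega>))"
        using iZ K[OF that] by simp
      also have "\<dots> \<le> e + norm \<theta> * (e / (norm \<theta> + 1))"
        using Z'(3) K[OF that] by (intro add_mono mult_left_mono) auto
      also have "norm \<theta> * (e / (norm \<theta> + 1)) \<le> e"
      proof -
        have "norm \<theta> * (e / (norm \<theta> + 1)) \<le> (norm \<theta> + 1) * (e / (norm \<theta> + 1))"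
          using \<open>e / (norm \<theta> + 1) > 0\<close> by (intro mult_right_mono) auto
        also have "\<dots> = e" using norm_ge_zero[of \<theta>] by (simp add: add_nonneg_eq_0_iff)
        finally show ?thesis .
      qed
      finally show ?thesis by simp
    qed
    then show ?thesis using Z' by blast
  qed
  have ZY_meas: "(\<lambda>\<omega>. Z \<omega> * cis (\<theta> \<bullet> Y \<omega>)) \<in> borel_measurable M" by measurable
  show ?approx
    unfolding approx_adapted_def
  proof (intro conjI allI impI ZY_meas)
    show "norm (Z \<omega> * cis (\<theta> \<bullet> Y \<omega>)) \<le> 1" for \<omega> using Z1 by (simp add: norm_mult)
    fix e :: real assume "e > 0"
    then obtain Z' k where Z': "Z' \<in> borel_measurable (F s)" "\<And>\<omega>. norm (Z' \<omega>) \<le> 1"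
      "(LINT \<omega>|M. norm (Z \<omega> * cis (\<theta> \<bullet> Y \<omega>) - Z' \<omega> * cis (\<theta> \<bullet> E k \<omega>))) \<le> e"
      using key[of "e / 2"] by auto
    have "(\<lambda>\<omega>. Z' \<omega> * cis (\<theta> \<bullet> E k \<omega>)) \<in> borel_measurable (F t)"
      unfolding E_def by (rule elementary_integral_cis(1)[OF W p Z'(1,2)])
    then show "\<exists>Z'\<in>borel_measurable (F t). (\<forall>\<omega>. norm (Z' \<omega>) \<le> 1) \<and> (LINT \<omega>|M. norm (Z \<omega> * cis (\<theta> \<bullet> Y \<omega>) - Z' \<omega>)) \<le> e"
      using Z' by (intro bexI[of _ "\<lambda>\<omega>. Z' \<omega> * cis (\<theta> \<bullet> E k \<omega>)"]) (auto simp: norm_mult)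
  qed
  have iZ: "integrable M Z" by (rule integrable_bounded[OF finite_measure_axioms ZM Z1])
  have iZY: "integrable M (\<lambda>\<omega>. Z \<omega> * cis (\<theta> \<bullet> Y \<omega>))"
    by (rule integrable_bounded[OF finite_measure_axioms ZY_meas, of 1]) (use Z1 in \<open>auto simp: norm_mult\<close>)
  have "norm ((LINT \<omega>|M. Z \<omega> * cis (\<theta> \<bullet> Y \<omega>)) - (LINT \<omega>|M. Z \<omega>) * of_real G0) \<le> 0"
  proof (rule field_le_epsilon)
    fix e' :: real assume "e' > 0"
    \<comment> \<open>The three errors \<open>a\<close>, \<open>b\<close>, \<open>c\<close> below
      amount to \<open>2 * e\<close>, \<open>e\<close> and \<open>e\<close>.\<close>
    define e where "e = e' / 4"
    have "e > 0" using \<open>e' > 0\<close> by (simp add: e_def)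
    obtain Z' K where Z': "Z' \<in> borel_measurable (F s)" "\<And>\<omega>. norm (Z' \<omega>) \<le> 1" "(LINT \<omega>|M. norm (Z \<omega> - Z' \<omega>)) \<le> e"
      and K: "\<And>k. k \<ge> K \<Longrightarrow> (LINT \<omega>|M. norm (Z \<omega> * cis (\<theta> \<bullet> Y \<omega>) - Z' \<omega> * cis (\<theta> \<bullet> E k \<omega>))) \<le> 2 * e"
      using key[OF \<open>e > 0\<close>] by blast
    obtain K' where K': "\<And>k. k \<ge> K' \<Longrightarrow> norm (G k - G0) < e"
      using LIMSEQ_D[OF G_lim \<open>e > 0\<close>] by blast
    define k where "k = max K K'"
    have [measurable]: "Z' \<in> borel_measurable M" using Z'(1) by (rule F_measurable_events)
    have iZ': "integrable M Z'" by (rule integrable_bounded[OF finite_measure_axioms _ Z'(2)]) measurable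
    have iZE: "integrable M (\<lambda>\<omega>. Z' \<omega> * cis (\<theta> \<bullet> E k \<omega>))"
      by (rule integrable_bounded[OF finite_measure_axioms, of _ 1]) (measurable, use Z'(2) in \<open>auto simp: norm_mult\<close>)
    have eqE: "(LINT \<omega>|M. Z' \<omega> * cis (\<theta> \<bullet> E k \<omega>)) = (LINT \<omega>|M. Z' \<omega>) * of_real (G k)"
      unfolding E_def G_def by (rule elementary_integral_cis(2)[OF W p Z'(1,2)])
    have a: "norm ((LINT \<omega>|M. Z \<omega> * cis (\<theta> \<bullet> Y \<omega>)) - (LINT \<omega>|M. Z' \<omega> * cis (\<theta> \<bullet> E k \<omega>))) \<le> 2 * e"
    proof -
      have "(LINT \<omega>|M. Z \<omega> * cis (\<theta> \<bullet> Y \<omega>)) - (LINT \<omega>|M. Z' \<omega> * cis (\<theta> \<bullet> E k \<omega>))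
          = (LINT \<omega>|M. Z \<omega> * cis (\<theta> \<bullet> Y \<omega>) - Z' \<omega> * cis (\<theta> \<bullet> E k \<omega>))" using iZY iZE by simp
      also have "norm \<dots> \<le> (LINT \<omega>|M. norm (Z \<omega> * cis (\<theta> \<bullet> Y \<omega>) - Z' \<omega> * cis (\<theta> \<bullet> E k \<omega>)))"
        by (rule integral_norm_bound)
      also have "\<dots> \<le> 2 * e" by (rule K) (simp add: k_def)
      finally show ?thesis .
    qed
    have b: "norm ((LINT \<omega>|M. Z' \<omega>) * of_real (G k) - (LINT \<omega>|M. Z' \<omega>) * of_real G0) \<le> e"
    proof -
      have "norm (LINT \<omega>|M. Z' \<omega>) \<le> (LINT \<omega>|M. norm (Z' \<omega>))" by (rule integral_norm_bound)
      also have "\<dots> \<le> (LINT \<omega>|M. 1)" using iZ' Z'(2) by (intro integral_mono) auto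
      finally have n: "norm (LINT \<omega>|M. Z' \<omega>) \<le> 1" by (simp add: prob_space)
      have "norm ((LINT \<omega>|M. Z' \<omega>) * of_real (G k) - (LINT \<omega>|M. Z' \<omega>) * of_real G0)
          = norm (LINT \<omega>|M. Z' \<omega>) * \<bar>G k - G0\<bar>"
        by (simp add: right_diff_distrib[symmetric] norm_mult of_real_diff[symmetric] del: of_real_diff)
      also have "\<dots> \<le> 1 * e" using n K'[of k] by (intro mult_mono) (auto simp: k_def)
      finally show ?thesis by simp
    qed
    have c: "norm ((LINT \<omega>|M. Z' \<omega>) * of_real G0 - (LINT \<omega>|M. Z \<omega>) * of_real G0) \<le> e"
    proof -
      have "norm ((LINT \<omega>|M. Z' \<omega>) * of_real G0 - (LINT \<omega>|M. Z \<omega>) * of_real G0)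
          = norm (LINT \<omega>|M. Z \<omega> - Z' \<omega>) * \<bar>G0\<bar>"
        using iZ iZ' by (simp add: left_diff_distrib[symmetric] norm_mult norm_minus_commute)
      also have "\<dots> \<le> (LINT \<omega>|M. norm (Z \<omega> - Z' \<omega>)) * 1"
      proof (intro mult_mono integral_norm_bound)
        have "0 \<le> integral {s..t} (\<lambda>r. (norm (\<theta> v* g r))\<^sup>2)"
          by (cases "(\<lambda>r. (norm (\<theta> v* g r))\<^sup>2) integrable_on {s..t}")
             (auto intro: integral_nonneg simp: not_integrable_integral)
        then show "\<bar>G0\<bar> \<le> 1" by (simp add: G0_def)
      qed auto
      finally show ?thesis using Z'(3) by simp
    qed
    show "norm ((LINT \<omega>|M. Z \<omega> * cis (\<theta> \<bullet> Y \<omega>)) - (LINT \<omega>|M. Z \<omega>) * of_real G0) \<le> 0 + e'"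
      using norm_triangle_le[OF add_mono[OF a[unfolded eqE] norm_triangle_le[OF add_mono[OF b c]]]]
      by (simp add: e_def)
  qed
  then show ?eq by (simp add: G0_def)
qed

text \<open>The vector \<open>\<theta> i\<close> may change from cell to cell, which makes room for
  the flow frozen at grid points.\<close>

lemma (in filtered_prob_space) wiener_integral_sum_cis:
  fixes W :: "real \<Rightarrow> 'w \<Rightarrow> real^'m" and g :: "real \<Rightarrow> real^'m^'d"
  assumes W: "brownian_motion M F W" and I: "stochastic_integral_process M W g I"
    and g: "continuous_on UNIV g" and mono: "mono p" and Z: "approx_adapted M (F (p 0)) Z"
  shows "approx_adapted M (F (p n)) (\<lambda>\<omega>. Z \<omega> * cis (\<Sum>i<n. \<theta> i \<bullet> (I (p (Suc i)) \<omega> - I (p i) \<omega>))) \<and>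
    (LINT \<omega>|M. Z \<omega> * cis (\<Sum>i<n. \<theta> i \<bullet> (I (p (Suc i)) \<omega> - I (p i) \<omega>))) =
      (LINT \<omega>|M. Z \<omega>) * of_real (exp (- (\<Sum>i<n. integral {p i..p (Suc i)} (\<lambda>r. (norm (\<theta> i v* g r))\<^sup>2)) / 2))"
proof (induction n)
  case 0
  then show ?case using Z by simp
next
  case (Suc n)
  let ?Z = "\<lambda>\<omega>. Z \<omega> * cis (\<Sum>i<n. \<theta> i \<bullet> (I (p (Suc i)) \<omega> - I (p i) \<omega>))"
  have "is_stochastic_integral M W g (p n) (p (Suc n)) (\<lambda>\<omega>. I (p (Suc n)) \<omega> - I (p n) \<omega>)"
    using I monoD[OF mono, of n "Suc n"] unfolding stochastic_integral_process_def by auto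
  note * = stochastic_integral_cis[OF W this g, of ?Z "\<theta> n"]
  have split: "Z \<omega> * cis (\<Sum>i<Suc n. \<theta> i \<bullet> (I (p (Suc i)) \<omega> - I (p i) \<omega>)) =
      ?Z \<omega> * cis (\<theta> n \<bullet> (I (p (Suc n)) \<omega> - I (p n) \<omega>))" for \<omega>
    by (simp add: cis_mult[symmetric])
  show ?case
    unfolding split using * Suc
    by (simp add: exp_add[symmetric] of_real_mult[symmetric] add_divide_distrib del: of_real_mult)
qed

section \<open>Variation of constants\<close>

lemma integral_reflect_translate:
  fixes h :: "real \<Rightarrow> 'a::banach"
  assumes "continuous_on UNIV h" "s \<le> t"
  shows "integral {s..t} h = integral {0..t - s} (\<lambda>u. h (t - u))"
proof -
  obtain H where H: "\<And>t. (H has_vector_derivative h t) (at t)"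
    using continuous_antiderivative[OF assms(1)] by blast
  have "((\<lambda>u. - H (t - u)) has_vector_derivative h (t - u)) (at u)" for u
  proof -
    have "((\<lambda>u. H (u + t)) has_vector_derivative h (- u + t)) (at (- u))"
      by (rule has_vector_derivative_translate[OF H])
    from has_vector_derivative_minus[OF has_vector_derivative_reflect[OF this]] show ?thesis by simp
  qed
  then have "((\<lambda>u. h (t - u)) has_integral - H (t - (t - s)) - - H (t - 0)) {0..t - s}"
    using assms(2) by (intro fundamental_theorem_of_calculus) (auto intro: has_vector_derivative_at_within)
  moreover have "(h has_integral H t - H s) {s..t}"
    using assms(2) by (intro fundamental_theorem_of_calculus) (auto intro: has_vector_derivative_at_within H)
  ultimately show ?thesis by (simp add: integral_unique)
qed

definition grid :: "real \<Rightarrow> real \<Rightarrow> nat \<Rightarrow> nat \<Rightarrow> real" where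
  "grid s t n i = s + real i * ((t - s) / real n)"

lemma grid_0 [simp]: "grid s t n 0 = s"
  and grid_n [simp]: "n > 0 \<Longrightarrow> grid s t n n = t"
  by (simp_all add: grid_def)

lemma grid_Suc: "grid s t n (Suc i) = grid s t n i + (t - s) / real n"
  by (simp add: grid_def add_divide_distrib distrib_right)

lemma mono_grid: "s \<le> t \<Longrightarrow> mono (grid s t n)"
  unfolding grid_def by (intro monoI add_left_mono mult_right_mono) auto

lemma grid_mem:
  assumes "s \<le> t" "i \<le> n" "n > 0" shows "grid s t n i \<in> {s..t}"
  using monoD[OF mono_grid[OF assms(1)], of 0 i n] monoD[OF mono_grid[OF assms(1)], of i n n] assms by auto

lemma sum_integral_grid:
  fixes h :: "real \<Rightarrow> 'a::banach"
  assumes "continuous_on {s..t} h" "s \<le> t" "n > 0" "k \<le> n"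
  shows "(\<Sum>i<k. integral {grid s t n i..grid s t n (Suc i)} h) = integral {s..grid s t n k} h"
  using assms(4)
proof (induction k)
  case (Suc k)
  have m: "grid s t n k \<le> grid s t n (Suc k)" by (rule monoD[OF mono_grid[OF assms(2)]]) simp
  have "s \<le> grid s t n k" "grid s t n (Suc k) \<le> t"
    using grid_mem[OF assms(2), of k n] grid_mem[OF assms(2), of "Suc k" n] Suc.prems assms(3) by auto
  then have "h integrable_on {s..grid s t n (Suc k)}"
    by (intro integrable_continuous_real continuous_on_subset[OF assms(1)]) auto
  from Henstock_Kurzweil_Integration.integral_combine[OF \<open>s \<le> grid s t n k\<close> m this]
  show ?case using Suc by simp
qed simp

text \<open>The first argument of \<open>K\<close> is frozen at a point of each cell and the second
  is integrated exactly; uniform continuity on the square gives the diagonal in the limit. Left end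
  points serve for the paths, right end points for the variances.\<close>

lemma riemann_sum_tendsto:
  fixes K :: "real \<times> real \<Rightarrow> 'a::banach"
  assumes K: "continuous_on ({s..t} \<times> {s..t}) K" and st: "s \<le> t"
    and c: "\<And>n i. i < n \<Longrightarrow> c n i \<in> {grid s t n i..grid s t n (Suc i)}"
  shows "(\<lambda>n. \<Sum>i<n. integral {grid s t n i..grid s t n (Suc i)} (\<lambda>r. K (c n i, r)))
    \<longlonglongrightarrow> integral {s..t} (\<lambda>r. K (r, r))"
proof (rule LIMSEQ_I)
  fix e' :: real assume "e' > 0"
  define q where "q = t - s + 1"
  define e where "e = e' / (2 * q)"
  have e: "e > 0" "e * (t - s) < e'"
  proof -
    have q: "q > 0" using st by (simp add: q_def)
    then show "e > 0" using \<open>e' > 0\<close> by (simp add: e_def)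
    have "e * (t - s) \<le> e * q" using \<open>e > 0\<close> by (intro mult_left_mono) (auto simp: q_def)
    also have "\<dots> = e' / 2" using q by (simp add: e_def)
    finally show "e * (t - s) < e'" using \<open>e' > 0\<close> by simp
  qed
  have "uniformly_continuous_on ({s..t} \<times> {s..t}) K"
    by (intro compact_uniformly_continuous K compact_Times) auto
  from this[unfolded uniformly_continuous_on_def, THEN spec, THEN mp, OF e(1)]
  obtain d where "d > 0" and d: "\<forall>z\<in>{s..t} \<times> {s..t}. \<forall>z'\<in>{s..t} \<times> {s..t}. dist z' z < d \<longrightarrow> dist (K z') (K z) < e"
    by (elim exE conjE)
  obtain N :: nat where N: "(t - s) / d < real N" using reals_Archimedean2 by blast
  have diag: "continuous_on {s..t} (\<lambda>r. K (r, r))"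
    by (rule continuous_on_compose2[OF K]) (auto intro!: continuous_intros)
  show "\<exists>N. \<forall>n\<ge>N. norm ((\<Sum>i<n. integral {grid s t n i..grid s t n (Suc i)} (\<lambda>r. K (c n i, r))) - integral {s..t} (\<lambda>r. K (r, r))) < e'"
  proof (intro exI[of _ "max 1 N"] allI impI)
    fix n assume n: "n \<ge> max 1 N"
    then have n0: "n > 0" by simp
    have "(t - s) / d < real n" using N n by linarith
    then have h: "(t - s) / real n < d" using n0 \<open>d > 0\<close> by (simp add: field_simps)
    have h0: "0 \<le> (t - s) / real n" using st by simp
    let ?J = "\<lambda>i. {grid s t n i..grid s t n (Suc i)}"
    have sub: "?J i \<subseteq> {s..t}" if "i < n" for i
      using grid_mem[OF st, of i n] grid_mem[OF st, of "Suc i" n] that n0 by auto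
    have cell: "norm (integral (?J i) (\<lambda>r. K (c n i, r)) - integral (?J i) (\<lambda>r. K (r, r))) \<le> e * ((t - s) / real n)"
      if "i < n" for i
    proof -
      have c': "c n i \<in> {s..t}" using c[OF that] sub[OF that] by blast
      have i1: "continuous_on (?J i) (\<lambda>r. K (c n i, r))"
        by (rule continuous_on_compose2[OF K]) (use sub[OF that] c' in \<open>auto intro!: continuous_intros\<close>)
      have i2: "continuous_on (?J i) (\<lambda>r. K (r, r))" by (rule continuous_on_subset[OF diag sub[OF that]])
      have "integral (?J i) (\<lambda>r. K (c n i, r)) - integral (?J i) (\<lambda>r. K (r, r)) = integral (?J i) (\<lambda>r. K (c n i, r) - K (r, r))"
        by (intro Henstock_Kurzweil_Integration.integral_diff[symmetric] integrable_continuous_real i1 i2)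
      also have "norm \<dots> \<le> e * (grid s t n (Suc i) - grid s t n i)"
      proof (rule integral_bound)
        show "grid s t n i \<le> grid s t n (Suc i)" using h0 by (simp add: grid_Suc)
        show "continuous_on (?J i) (\<lambda>r. K (c n i, r) - K (r, r))" by (intro continuous_intros i1 i2)
        show "norm (K (c n i, r) - K (r, r)) \<le> e" if r: "r \<in> ?J i" for r
        proof -
          have "\<bar>c n i - r\<bar> \<le> (t - s) / real n" using c[OF \<open>i < n\<close>] r by (auto simp: grid_Suc)
          then have "dist (c n i, r) (r, r) < d" using h by (simp add: dist_Pair_Pair dist_real_def)
          then have "dist (K (c n i, r)) (K (r, r)) < e" using r sub[OF \<open>i < n\<close>] c' by (intro d[rule_format]) auto
          then show ?thesis by (simp add: dist_norm)
        qed
      qed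
      finally show ?thesis by (simp add: grid_Suc)
    qed
    have "(\<Sum>i<n. integral (?J i) (\<lambda>r. K (r, r))) = integral {s..t} (\<lambda>r. K (r, r))"
      using sum_integral_grid[OF diag st n0 order_refl] n0 by simp
    then have "norm ((\<Sum>i<n. integral (?J i) (\<lambda>r. K (c n i, r))) - integral {s..t} (\<lambda>r. K (r, r)))
        = norm (\<Sum>i<n. integral (?J i) (\<lambda>r. K (c n i, r)) - integral (?J i) (\<lambda>r. K (r, r)))"
      by (simp add: sum_subtractf)
    also have "\<dots> \<le> (\<Sum>i<n. e * ((t - s) / real n))"
      by (intro sum_norm_le cell) simp
    also have "\<dots> = e * (t - s)" using n0 by simp
    also note e(2)
    finally show "norm ((\<Sum>i<n. integral (?J i) (\<lambda>r. K (c n i, r))) - integral {s..t} (\<lambda>r. K (r, r))) < e'" .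
  qed
qed

lemma has_vector_derivative_flow_reversed:
  "((\<lambda>r. flow A (t - r) v) has_vector_derivative - flow A (t - r) (A *v v)) (at r)"
proof -
  have "((\<lambda>r. flow A (r + t) v) has_vector_derivative A *v flow A (- r + t) v) (at (- r))"
    by (rule has_vector_derivative_translate[OF has_vector_derivative_flow])
  from has_vector_derivative_reflect[OF this] show ?thesis by (simp add: flow_matrix_commute)
qed

lemma continuous_on_matrix_vector [continuous_intros]:
  fixes A :: "real^'n^'m"
  assumes "continuous_on S w" shows "continuous_on S (\<lambda>r. A *v w r)"
  using bounded_linear.continuous_on[OF matrix_vector_mul_bounded_linear assms] .

text \<open>Continuity of the path comes out of the equation: an indefinite integral is continuous,
  and so is \<open>I\<close>.\<close>

lemma integral_equation_continuous:
  fixes A :: "real^'d^'d" and x f I :: "real \<Rightarrow> real^'d"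
  assumes I: "continuous_on UNIV I"
    and eq: "\<And>s t. s \<le> t \<Longrightarrow> set_integrable lborel {s..t} (\<lambda>r. A *v x r + f r) \<and>
      x t = x s + (LINT r:{s..t}|lborel. A *v x r + f r) + (I t - I s)"
  shows "continuous_on UNIV x"
proof -
  let ?h = "\<lambda>r. A *v x r + f r"
  have eq': "?h integrable_on {a..b}" "x b = x a + integral {a..b} ?h + (I b - I a)" if "a \<le> b" for a b
    using eq[OF that] set_borel_integral_eq_integral[of "{a..b}" ?h] by auto
  have "isCont x r" for r
  proof -
    have "continuous_on {r - 1..r + 1} (\<lambda>b. x (r - 1) + integral {r - 1..b} ?h + (I b - I (r - 1)))"
      by (intro continuous_intros indefinite_integral_continuous_1 eq' continuous_on_subset[OF I]) auto
    then have "continuous_on {r - 1..r + 1} x"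
      by (rule continuous_on_eq) (use eq'(2) in auto)
    then have "continuous_on {r - 1<..<r + 1} x" by (rule continuous_on_subset) auto
    then show ?thesis by (simp add: continuous_on_eq_continuous_at)
  qed
  then show ?thesis by (simp add: continuous_on_eq_continuous_at)
qed

text \<open>The path \<open>I\<close> is not differentiable, but \<open>w = x - I\<close> is, with
  \<open>w' = A w + (A I + f)\<close>. Variation of constants for \<open>w\<close> yields the noise
  in a form integrated by parts.\<close>

lemma mild_solution:
  fixes A :: "real^'d^'d" and x f I :: "real \<Rightarrow> real^'d"
  assumes I: "continuous_on UNIV I" and f: "continuous_on UNIV f"
    and eq: "\<And>s t. s \<le> t \<Longrightarrow> set_integrable lborel {s..t} (\<lambda>r. A *v x r + f r) \<and>
      x t = x s + (LINT r:{s..t}|lborel. A *v x r + f r) + (I t - I s)"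
    and st: "s \<le> t"
  shows "x t - flow A (t - s) (x s) - integral {s..t} (\<lambda>r. flow A (t - r) (f r)) =
    I t - flow A (t - s) (I s) + integral {s..t} (\<lambda>r. flow A (t - r) (A *v I r))"
proof -
  let ?h = "\<lambda>r. A *v x r + f r"
  have eq': "?h integrable_on {a..b}" "x b = x a + integral {a..b} ?h + (I b - I a)" if "a \<le> b" for a b
    using eq[OF that] set_borel_integral_eq_integral[of "{a..b}" ?h] by auto
  have "continuous_on UNIV x" by (rule integral_equation_continuous[OF I eq])
  then have h: "continuous_on UNIV ?h" by (intro continuous_intros f)
  define w where "w r = x r - I r" for r
  have w: "(w has_vector_derivative ?h r) (at r)" for r
  proof -
    have "((\<lambda>b. integral {r - 1..b} ?h) has_vector_derivative ?h r) (at r within {r - 1..r + 1})"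
      by (intro integral_has_vector_derivative continuous_on_subset[OF h]) auto
    then have "((\<lambda>b. integral {r - 1..b} ?h) has_vector_derivative ?h r) (at r within {r - 1<..<r + 1})"
      by (rule has_vector_derivative_within_subset) auto
    then have "((\<lambda>b. integral {r - 1..b} ?h) has_vector_derivative ?h r) (at r)"
      by (subst (asm) at_within_open) auto
    then have "((\<lambda>b. (x (r - 1) - I (r - 1)) + integral {r - 1..b} ?h) has_vector_derivative 0 + ?h r) (at r)"
      by (intro has_vector_derivative_add has_vector_derivative_const)
    then have "(w has_vector_derivative 0 + ?h r) (at r)"
    proof (rule has_vector_derivative_transform_within_open[of _ _ _ "{r - 1<..<r + 1}"])
      show "x (r - 1) - I (r - 1) + integral {r - 1..b} ?h = w b" if "b \<in> {r - 1<..<r + 1}" for b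
        using eq'(2)[of "r - 1" b] that by (simp add: w_def)
    qed auto
    then show ?thesis by simp
  qed
  have q: "((\<lambda>u. flow A u (w (t - u))) has_vector_derivative - flow A u (A *v I (t - u) + f (t - u))) (at u)" for u
  proof -
    have "((\<lambda>u. w (u + t)) has_vector_derivative ?h (- u + t)) (at (- u))"
      by (rule has_vector_derivative_translate[OF w])
    from has_vector_derivative_reflect[OF this]
    have "((\<lambda>u. w (t - u)) has_vector_derivative - ?h (t - u)) (at u)" by simp
    from has_vector_derivative_flow_comp[OF this, of A]
    show ?thesis
      by (simp add: w_def matrix_vector_mult_diff_distrib linear_neg[OF linear_flow, symmetric] algebra_simps)
  qed
  have "((\<lambda>u. - flow A u (A *v I (t - u) + f (t - u))) has_integral
      flow A (t - s) (w (t - (t - s))) - flow A 0 (w (t - 0))) {0..t - s}"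
    using st by (intro fundamental_theorem_of_calculus) (auto intro: has_vector_derivative_at_within q)
  then have "flow A (t - s) (w s) - w t = - integral {0..t - s} (\<lambda>u. flow A u (A *v I (t - u) + f (t - u)))"
    by (auto dest!: integral_unique)
  also have "integral {0..t - s} (\<lambda>u. flow A u (A *v I (t - u) + f (t - u)))
      = integral {s..t} (\<lambda>r. flow A (t - r) (A *v I r + f r))"
    by (subst integral_reflect_translate[OF _ st]) (auto intro!: continuous_intros I f)
  also have "\<dots> = integral {s..t} (\<lambda>r. flow A (t - r) (A *v I r)) + integral {s..t} (\<lambda>r. flow A (t - r) (f r))"
    unfolding linear_add[OF linear_flow]
    by (intro Henstock_Kurzweil_Integration.integral_add integrable_continuous_real continuous_intros
        continuous_on_subset[OF I] continuous_on_subset[OF f]) auto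
  finally show ?thesis
    by (simp add: w_def linear_diff[OF linear_flow] algebra_simps)
qed

text \<open>The limit is \<integral> \<open>U(t - r) dI(r)\<close> after integration by parts, which
  makes sense for every continuous path. Summation by parts turns the sums into a telescoping
  boundary term and ordinary integrals in which \<open>I\<close> is frozen at the left end of each
  cell.\<close>

lemma mild_noise_riemann_sum:
  fixes A :: "real^'d^'d" and I :: "real \<Rightarrow> real^'d"
  assumes I: "continuous_on UNIV I" and st: "s \<le> t"
  shows "(\<lambda>n. \<Sum>i<n. flow A (t - grid s t n (Suc i)) (I (grid s t n (Suc i)) - I (grid s t n i)))
    \<longlonglongrightarrow> I t - flow A (t - s) (I s) + integral {s..t} (\<lambda>r. flow A (t - r) (A *v I r))"
proof -
  let ?p = "grid s t"
  have piece: "flow A (t - a) v - flow A (t - b) v = integral {a..b} (\<lambda>r. flow A (t - r) (A *v v))" if "a \<le> b" for a b v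
  proof -
    have "((\<lambda>r. - flow A (t - r) (A *v v)) has_integral flow A (t - b) v - flow A (t - a) v) {a..b}"
      by (intro fundamental_theorem_of_calculus that has_vector_derivative_at_within[OF has_vector_derivative_flow_reversed])
    from has_integral_neg[OF this] show ?thesis by (simp add: integral_unique)
  qed
  have sum: "(\<Sum>i<n. flow A (t - ?p n (Suc i)) (I (?p n (Suc i)) - I (?p n i))) =
      I t - flow A (t - s) (I s) + (\<Sum>i<n. integral {?p n i..?p n (Suc i)} (\<lambda>r. flow A (t - r) (A *v I (?p n i))))"
    if "n > 0" for n
  proof -
    have "flow A (t - ?p n (Suc i)) (I (?p n (Suc i)) - I (?p n i)) =
        (flow A (t - ?p n (Suc i)) (I (?p n (Suc i))) - flow A (t - ?p n i) (I (?p n i)))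
        + integral {?p n i..?p n (Suc i)} (\<lambda>r. flow A (t - r) (A *v I (?p n i)))" for i
    proof -
      have m: "?p n i \<le> ?p n (Suc i)" by (rule monoD[OF mono_grid[OF st]]) simp
      show ?thesis by (simp only: linear_diff[OF linear_flow] piece[OF m, symmetric]) simp
    qed
    then have "(\<Sum>i<n. flow A (t - ?p n (Suc i)) (I (?p n (Suc i)) - I (?p n i))) =
        (\<Sum>i<n. flow A (t - ?p n (Suc i)) (I (?p n (Suc i))) - flow A (t - ?p n i) (I (?p n i)))
        + (\<Sum>i<n. integral {?p n i..?p n (Suc i)} (\<lambda>r. flow A (t - r) (A *v I (?p n i))))"
      by (simp add: sum.distrib)
    also have "(\<Sum>i<n. flow A (t - ?p n (Suc i)) (I (?p n (Suc i))) - flow A (t - ?p n i) (I (?p n i)))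
        = I t - flow A (t - s) (I s)"
      using that sum_lessThan_telescope[of "\<lambda>i. flow A (t - ?p n i) (I (?p n i))" n] by simp
    finally show ?thesis .
  qed
  have "(\<lambda>n. \<Sum>i<n. integral {?p n i..?p n (Suc i)} (\<lambda>r. (\<lambda>(a, r). flow A (t - r) (A *v I a)) (?p n i, r)))
      \<longlonglongrightarrow> integral {s..t} (\<lambda>r. (\<lambda>(a, r). flow A (t - r) (A *v I a)) (r, r))"
  proof (rule riemann_sum_tendsto[OF _ st])
    show "continuous_on ({s..t} \<times> {s..t}) (\<lambda>(a, r). flow A (t - r) (A *v I a))"
      unfolding case_prod_beta by (intro continuous_intros continuous_on_compose2[OF I]) auto
    show "?p n i \<in> {?p n i..?p n (Suc i)}" for n i using monoD[OF mono_grid[OF st], of i "Suc i" n] by simp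
  qed
  then have "(\<lambda>n. I t - flow A (t - s) (I s) + (\<Sum>i<n. integral {?p n i..?p n (Suc i)} (\<lambda>r. flow A (t - r) (A *v I (?p n i)))))
      \<longlonglongrightarrow> I t - flow A (t - s) (I s) + integral {s..t} (\<lambda>r. flow A (t - r) (A *v I r))"
    by (intro tendsto_intros) simp
  moreover have "eventually (\<lambda>n. I t - flow A (t - s) (I s) + (\<Sum>i<n. integral {?p n i..?p n (Suc i)} (\<lambda>r. flow A (t - r) (A *v I (?p n i)))) =
      (\<Sum>i<n. flow A (t - ?p n (Suc i)) (I (?p n (Suc i)) - I (?p n i)))) sequentially"
    using eventually_gt_at_top[of 0] by eventually_elim (simp add: sum)
  ultimately show ?thesis by (rule Lim_transform_eventually)
qed

text \<open>With \<open>r = t - u\<close> this is the variance of \<open>\<theta> \<bullet> \<integral> U(t - r) g(r) dW(r)\<close> over \<open>[t - L, t]\<close>.\<close>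

definition energy :: "real^'d^'d \<Rightarrow> (real \<Rightarrow> real^'m^'d) \<Rightarrow> real^'d \<Rightarrow> real \<Rightarrow> real \<Rightarrow> real" where
  "energy A g \<theta> t L = integral {0..L} (\<lambda>u. \<Sum>j\<in>UNIV. (\<theta> \<bullet> flow A u (column j (g (t - u))))\<^sup>2)"

lemma continuous_on_column [continuous_intros]:
  fixes g :: "'a::topological_space \<Rightarrow> real^'m^'d"
  assumes "continuous_on S g" shows "continuous_on S (\<lambda>r. column j (g r))"
  unfolding column_def by (intro continuous_intros assms)

text \<open>For a solution this is \<integral> \<open>U(t - r) g(r) dW(r)\<close> over
  \<open>[s, t]\<close>. Expressed through \<open>X\<close>, it depends on no choice of a version of
  the stochastic integral.\<close>

definition mild_noise ::
    "real^'d^'d \<Rightarrow> (real \<Rightarrow> real^'d) \<Rightarrow> (real \<Rightarrow> 'w \<Rightarrow> real^'d) \<Rightarrow> real \<Rightarrow> real \<Rightarrow> 'w \<Rightarrow> real^'d" where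
  "mild_noise A f X s t \<omega> = X t \<omega> - flow A (t - s) (X s \<omega>) - integral {0..t - s} (\<lambda>u. flow A u (f (t - u)))"

text \<open>The noise after \<open>s\<close> is Gaussian and independent of the past, in the tested
  form that the proof works with. Riemann sums \<open>S n\<close> of the noise are combinations of
  increments of \<open>I\<close> with deterministic coefficients; their exponents \<open>Q n\<close>
  tend to the energy, and \<open>S n\<close> converges almost surely.\<close>

lemma weak_solution_mild_noise_cis:
  fixes A :: "real^'d^'d" and g :: "real \<Rightarrow> real^'m^'d"
  assumes X: "weak_solution A f g M F X W" and f: "continuous_on UNIV f" and g: "continuous_on UNIV g"
    and st: "s \<le> t" and Z: "Z \<in> borel_measurable (F s)" "\<And>\<omega>. norm (Z \<omega>) \<le> 1"
  shows "(LINT \<omega>|M. Z \<omega> * cis (\<theta> \<bullet> mild_noise A f X s t \<omega>)) =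
    (LINT \<omega>|M. Z \<omega>) * of_real (exp (- energy A g \<theta> t (t - s) / 2))"
proof -
  interpret filtered_prob_space M F using X by (simp add: weak_solution_def)
  have W: "brownian_motion M F W" using X by (simp add: weak_solution_def)
  have X_meas: "X r \<in> borel_measurable M" for r
    using X by (intro F_measurable_events[of _ r]) (simp add: weak_solution_def)
  obtain I where I: "stochastic_integral_process M W g I"
    and path: "AE \<omega> in M. \<forall>s t. s \<le> t \<longrightarrow> set_integrable lborel {s..t} (\<lambda>r. A *v X r \<omega> + f r) \<and>
      X t \<omega> = X s \<omega> + (LINT r:{s..t}|lborel. A *v X r \<omega> + f r) + (I t \<omega> - I s \<omega>)"
    using X unfolding weak_solution_def by blast
  let ?p = "grid s t"
  \<comment> \<open>The adjoint moves the flow from the noise to \<theta>, so that each cell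
    contributes an inner product with an increment of \<open>I\<close>.\<close>
  define a where "a r = adjoint (flow A (t - r)) \<theta>" for r
  have a: "a r \<bullet> v = \<theta> \<bullet> flow A (t - r) v" for r v
    using adjoint_works[OF linear_flow, of v A "t - r" \<theta>] by (simp add: a_def inner_commute)
  have a_cont: "continuous_on S (\<lambda>z. a (h z))" if "continuous_on S h" for h and S :: "(real \<times> real) set"
  proof -
    have "a r = (\<chi> i. \<theta> \<bullet> flow A (t - r) (axis i 1))" for r
      by (simp add: vec_eq_iff a[symmetric] inner_axis)
    then show ?thesis by (simp add: continuous_intros that)
  qed
  have vm: "(norm (a r v* B))\<^sup>2 = (\<Sum>j\<in>UNIV. (\<theta> \<bullet> flow A (t - r) (column j B))\<^sup>2)" for r and B :: "real^'m^'d"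
  proof -
    have "(a r v* B) $ j = \<theta> \<bullet> flow A (t - r) (column j B)" for j
      unfolding a[symmetric] by (simp add: vector_matrix_mult_def column_def inner_vec_def mult.commute)
    then show ?thesis by (simp add: norm_vec_def L2_set_def sum_nonneg)
  qed
  define S where "S n \<omega> = (\<Sum>i<n. a (?p n (Suc i)) \<bullet> (I (?p n (Suc i)) \<omega> - I (?p n i) \<omega>))" for n \<omega>
  define Q where "Q n = (\<Sum>i<n. integral {?p n i..?p n (Suc i)} (\<lambda>r. (norm (a (?p n (Suc i)) v* g r))\<^sup>2))" for n
  have Z': "approx_adapted M (F (?p n 0)) Z" for n
    using approx_adapted_measurable[OF Z] by simp
  note chain = wiener_integral_sum_cis[OF W I g mono_grid[OF st] Z', where \<theta>="\<lambda>i. a (?p n (Suc i))" for n]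
  have S_meas: "(\<lambda>\<omega>. Z \<omega> * cis (S n \<omega>)) \<in> borel_measurable M"
    and S_eq: "(LINT \<omega>|M. Z \<omega> * cis (S n \<omega>)) = (LINT \<omega>|M. Z \<omega>) * of_real (exp (- Q n / 2))" for n
    using chain[of n n] unfolding S_def Q_def approx_adapted_def by auto
  have J_meas: "mild_noise A f X s t \<in> borel_measurable M"
  proof -
    have "(\<lambda>\<omega>. flow A (t - s) (X s \<omega>)) \<in> borel_measurable M"
      by (rule borel_measurable_continuous_on[OF linear_continuous_on[OF bounded_linear_flow] X_meas])
    then show ?thesis unfolding mild_noise_def[abs_def] using X_meas by measurable
  qed
  have ZM: "Z \<in> borel_measurable M" by (rule F_measurable_events[OF Z(1)])
  have AE_lim: "AE \<omega> in M. (\<lambda>n. S n \<omega>) \<longlonglongrightarrow> \<theta> \<bullet> mild_noise A f X s t \<omega>"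
  proof -
    have "AE \<omega> in M. continuous_on UNIV (\<lambda>t. I t \<omega>)" using I by (simp add: stochastic_integral_process_def)
    then show ?thesis using path
    proof eventually_elim
      case (elim \<omega>)
      have "mild_noise A f X s t \<omega> = X t \<omega> - flow A (t - s) (X s \<omega>) - integral {s..t} (\<lambda>r. flow A (t - r) (f r))"
        unfolding mild_noise_def
        by (subst integral_reflect_translate[OF _ st]) (auto intro!: continuous_intros f)
      also have "\<dots> = I t \<omega> - flow A (t - s) (I s \<omega>) + integral {s..t} (\<lambda>r. flow A (t - r) (A *v I r \<omega>))"
        using elim by (intro mild_solution st f) auto
      finally have eq: "mild_noise A f X s t \<omega> = \<dots>" .
      have "S n \<omega> = \<theta> \<bullet> (\<Sum>i<n. flow A (t - ?p n (Suc i)) (I (?p n (Suc i)) \<omega> - I (?p n i) \<omega>))" for n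
        unfolding S_def a inner_sum_right ..
      then show ?case
        unfolding eq using mild_noise_riemann_sum[OF elim(1) st, of A] by (simp add: tendsto_inner)
    qed
  qed
  have "(\<lambda>n. LINT \<omega>|M. Z \<omega> * cis (S n \<omega>)) \<longlonglongrightarrow> (LINT \<omega>|M. Z \<omega> * cis (\<theta> \<bullet> mild_noise A f X s t \<omega>))"
  proof (rule integral_dominated_convergence[where w="\<lambda>_. 1"])
    show "AE \<omega> in M. (\<lambda>n. Z \<omega> * cis (S n \<omega>)) \<longlonglongrightarrow> Z \<omega> * cis (\<theta> \<bullet> mild_noise A f X s t \<omega>)"
      using AE_lim
    proof eventually_elim
      case (elim \<omega>)
      have "isCont cis x" for x using continuous_on_cis[OF continuous_on_id, of UNIV] by (simp add: continuous_on_eq_continuous_at)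
      then show ?case by (intro tendsto_mult tendsto_const isCont_tendsto_compose[OF _ elim])
    qed
    show "(\<lambda>\<omega>. Z \<omega> * cis (\<theta> \<bullet> mild_noise A f X s t \<omega>)) \<in> borel_measurable M"
      using ZM J_meas by measurable
  qed (use S_meas Z(2) in \<open>auto simp: norm_mult\<close>)
  moreover have "Q \<longlonglongrightarrow> energy A g \<theta> t (t - s)"
  proof -
    let ?K = "\<lambda>(b, r). \<Sum>j\<in>UNIV. (\<theta> \<bullet> flow A (t - b) (column j (g r)))\<^sup>2"
    have "(\<lambda>n. \<Sum>i<n. integral {?p n i..?p n (Suc i)} (\<lambda>r. ?K (?p n (Suc i), r))) \<longlonglongrightarrow> integral {s..t} (\<lambda>r. ?K (r, r))"
    proof (rule riemann_sum_tendsto[OF _ st])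
      show "continuous_on ({s..t} \<times> {s..t}) ?K"
        unfolding case_prod_beta by (intro continuous_intros continuous_on_compose2[OF g]) auto
      show "?p n (Suc i) \<in> {?p n i..?p n (Suc i)}" for n i using monoD[OF mono_grid[OF st], of i "Suc i" n] by simp
    qed
    moreover have "integral {s..t} (\<lambda>r. ?K (r, r)) = energy A g \<theta> t (t - s)"
      unfolding energy_def
      by (subst integral_reflect_translate[OF _ st]) (auto intro!: continuous_intros g)
    ultimately show ?thesis by (simp add: Q_def[abs_def] vm)
  qed
  then have "(\<lambda>n. LINT \<omega>|M. Z \<omega> * cis (S n \<omega>)) \<longlonglongrightarrow> (LINT \<omega>|M. Z \<omega>) * of_real (exp (- energy A g \<theta> t (t - s) / 2))"
    unfolding S_eq by (intro tendsto_intros) auto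
  ultimately show ?thesis by (rule LIMSEQ_unique)
qed

section \<open>Square integrable bounded solutions\<close>

lemma norm_sum_sq_le:
  fixes x y :: "'a::real_normed_vector"
  shows "(norm (x + y))\<^sup>2 \<le> 2 * (norm x)\<^sup>2 + 2 * (norm y)\<^sup>2"
proof -
  have "(norm (x + y))\<^sup>2 \<le> (norm x + norm y)\<^sup>2" by (intro power_mono norm_triangle_ineq) simp
  also have "\<dots> \<le> 2 * (norm x)\<^sup>2 + 2 * (norm y)\<^sup>2"
    using zero_le_power2[of "norm x - norm y"] by (simp add: power2_eq_square algebra_simps)
  finally show ?thesis .
qed

definition square_integrable :: "'w measure \<Rightarrow> ('w \<Rightarrow> 'a::euclidean_space) \<Rightarrow> bool" where
  "square_integrable M Y \<longleftrightarrow> Y \<in> borel_measurable M \<and> integrable M (\<lambda>\<omega>. (norm (Y \<omega>))\<^sup>2)"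

lemma square_integrable_add:
  assumes "square_integrable M X" "square_integrable M Y"
  shows "square_integrable M (\<lambda>\<omega>. X \<omega> + Y \<omega>)"
  unfolding square_integrable_def
proof
  have [measurable]: "X \<in> borel_measurable M" "Y \<in> borel_measurable M"
    using assms by (auto simp: square_integrable_def)
  show "(\<lambda>\<omega>. X \<omega> + Y \<omega>) \<in> borel_measurable M" by measurable
  have i: "integrable M (\<lambda>\<omega>. 2 * (norm (X \<omega>))\<^sup>2 + 2 * (norm (Y \<omega>))\<^sup>2)"
    using assms by (auto simp: square_integrable_def)
  show "integrable M (\<lambda>\<omega>. (norm (X \<omega> + Y \<omega>))\<^sup>2)"
    by (rule Bochner_Integration.integrable_bound[OF i]) (auto intro!: AE_I2 order_trans[OF norm_sum_sq_le])
qed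

lemma square_integrable_linear:
  fixes f :: "'a::euclidean_space \<Rightarrow> 'b::euclidean_space"
  assumes "square_integrable M Y" "linear f"
  shows "square_integrable M (\<lambda>\<omega>. f (Y \<omega>))"
  unfolding square_integrable_def
proof
  have f: "bounded_linear f" using assms(2) by (simp add: linear_conv_bounded_linear)
  obtain K where K: "\<And>x. norm (f x) \<le> norm x * K" using bounded_linear.bounded[OF f] by blast
  have Y[measurable]: "Y \<in> borel_measurable M" using assms by (simp add: square_integrable_def)
  show [measurable]: "(\<lambda>\<omega>. f (Y \<omega>)) \<in> borel_measurable M"
    by (rule borel_measurable_continuous_on[OF linear_continuous_on[OF f] Y])
  have i: "integrable M (\<lambda>\<omega>. K\<^sup>2 * (norm (Y \<omega>))\<^sup>2)" using assms by (auto simp: square_integrable_def)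
  show "integrable M (\<lambda>\<omega>. (norm (f (Y \<omega>)))\<^sup>2)"
  proof (rule Bochner_Integration.integrable_bound[OF i])
    have "(norm (f x))\<^sup>2 \<le> K\<^sup>2 * (norm x)\<^sup>2" for x
      using power_mono[OF K[of x], of 2] by (simp add: power_mult_distrib mult.commute)
    then show "AE \<omega> in M. norm ((norm (f (Y \<omega>)))\<^sup>2) \<le> norm (K\<^sup>2 * (norm (Y \<omega>))\<^sup>2)" by simp
  qed measurable
qed

lemma (in prob_space) square_integrable_const: "square_integrable M (\<lambda>_. c)"
  by (simp add: square_integrable_def)

text \<open>\<open>1 + x^2\<close> dominates \<open>x\<close>; the last bound is the nonnegativity
  of the variance of \<open>norm Y\<close>.\<close>

lemma (in prob_space) square_integrable_imp_integrable:
  assumes "square_integrable M Y"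
  shows "integrable M Y" and "integrable M (\<lambda>\<omega>. norm (Y \<omega>))"
    and "expectation (\<lambda>\<omega>. norm (Y \<omega>)) \<le> sqrt (expectation (\<lambda>\<omega>. (norm (Y \<omega>))\<^sup>2))"
proof -
  have [measurable]: "Y \<in> borel_measurable M" and i2: "integrable M (\<lambda>\<omega>. (norm (Y \<omega>))\<^sup>2)"
    using assms by (auto simp: square_integrable_def)
  have i: "integrable M (\<lambda>\<omega>. 1 + (norm (Y \<omega>))\<^sup>2)" using i2 by auto
  have le: "norm x \<le> 1 + (norm x)\<^sup>2" for x :: 'b
    using zero_le_power2[of "norm x - 1 / 2"] by (simp add: power2_eq_square algebra_simps)
  show iY: "integrable M Y"
    by (rule Bochner_Integration.integrable_bound[OF i]) (auto intro!: AE_I2 order_trans[OF le])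
  then show "integrable M (\<lambda>\<omega>. norm (Y \<omega>))" by simp
  then have "(expectation (\<lambda>\<omega>. norm (Y \<omega>)))\<^sup>2 \<le> expectation (\<lambda>\<omega>. (norm (Y \<omega>))\<^sup>2)"
    using variance_positive[of "\<lambda>\<omega>. norm (Y \<omega>)"] variance_eq[of "\<lambda>\<omega>. norm (Y \<omega>)"] i2 by simp
  then show "expectation (\<lambda>\<omega>. norm (Y \<omega>)) \<le> sqrt (expectation (\<lambda>\<omega>. (norm (Y \<omega>))\<^sup>2))"
    by (rule real_le_rsqrt)
qed

text \<open>Both moments are difference quotients of the characteristic function at 0 with step
  \<open>1 / Suc n\<close>. The limits may be taken under the expectation because the second moment
  is finite by assumption.\<close>

lemma (in prob_space) gaussian_moments:
  assumes Y: "square_integrable M Y"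
    and char: "\<And>a. expectation (\<lambda>\<omega>. cis (a * Y \<omega>)) = of_real (exp (- (a\<^sup>2 * q) / 2))"
  shows "expectation Y = 0" and "expectation (\<lambda>\<omega>. (Y \<omega>)\<^sup>2) = q"
proof -
  have [measurable]: "Y \<in> borel_measurable M" and i2: "integrable M (\<lambda>\<omega>. (Y \<omega>)\<^sup>2)"
    using Y by (auto simp: square_integrable_def)
  have i1: "integrable M (\<lambda>\<omega>. \<bar>Y \<omega>\<bar>)" using square_integrable_imp_integrable(2)[OF Y] by simp
  have ic: "integrable M (\<lambda>\<omega>. cis (a * Y \<omega>))" for a
    by (rule integrable_bounded[OF finite_measure_axioms, of _ 1]) auto
  have cos: "expectation (\<lambda>\<omega>. cos (a * Y \<omega>)) = exp (- (a\<^sup>2 * q) / 2)" for a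
  proof -
    have "expectation (\<lambda>\<omega>. Re (cis (a * Y \<omega>))) = Re (expectation (\<lambda>\<omega>. cis (a * Y \<omega>)))"
      by (rule integral_Re[OF ic])
    then show ?thesis unfolding char by simp
  qed
  have sin: "expectation (\<lambda>\<omega>. sin (a * Y \<omega>)) = 0" for a
  proof -
    have "expectation (\<lambda>\<omega>. Im (cis (a * Y \<omega>))) = Im (expectation (\<lambda>\<omega>. cis (a * Y \<omega>)))"
      by (rule integral_Im[OF ic])
    then show ?thesis unfolding char by simp
  qed
  have sin_lim: "(\<lambda>n. real (Suc n) * sin (1 / real (Suc n) * y)) \<longlonglongrightarrow> y" for y
  proof -
    have "((\<lambda>h. (sin (0 + h * y) - sin (0 * y)) / h) \<longlongrightarrow> y) (at 0)"
    proof -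
      have "((\<lambda>h. sin (h * y)) has_real_derivative y) (at 0)" by (auto intro!: derivative_eq_intros)
      then show ?thesis by (simp add: DERIV_def)
    qed
    moreover have "filterlim (\<lambda>n. 1 / real (Suc n)) (at 0) sequentially"
      unfolding filterlim_at using LIMSEQ_Suc[OF lim_1_over_n] by auto
    ultimately show ?thesis
      using filterlim_compose[of "\<lambda>h. (sin (0 + h * y) - sin (0 * y)) / h" "nhds y" "at 0" "\<lambda>n. 1 / real (Suc n)" sequentially]
      by (simp add: field_simps)
  qed
  have sin_le: "\<bar>real (Suc n) * sin (1 / real (Suc n) * y)\<bar> \<le> \<bar>y\<bar>" for n y
  proof -
    have "\<bar>real (Suc n) * sin (1 / real (Suc n) * y)\<bar> \<le> real (Suc n) * \<bar>1 / real (Suc n) * y\<bar>"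
      unfolding abs_mult[of "real (Suc n)"] abs_of_nat by (intro mult_left_mono abs_sin_x_le_abs_x) simp
    then show ?thesis by (simp add: abs_mult)
  qed
  have "(\<lambda>n. expectation (\<lambda>\<omega>. real (Suc n) * sin (1 / real (Suc n) * Y \<omega>))) \<longlonglongrightarrow> expectation Y"
  proof (rule integral_dominated_convergence[where w="\<lambda>\<omega>. \<bar>Y \<omega>\<bar>"])
    show "AE \<omega> in M. (\<lambda>n. real (Suc n) * sin (1 / real (Suc n) * Y \<omega>)) \<longlonglongrightarrow> Y \<omega>"
      by (intro AE_I2 sin_lim)
    show "AE \<omega> in M. norm (real (Suc n) * sin (1 / real (Suc n) * Y \<omega>)) \<le> \<bar>Y \<omega>\<bar>" for n
      unfolding real_norm_def by (intro AE_I2 sin_le)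
  qed (use i1 in auto)
  moreover have "expectation (\<lambda>\<omega>. real (Suc n) * sin (1 / real (Suc n) * Y \<omega>)) = 0" for n
    by (simp only: integral_mult_right_zero sin mult_zero_right)
  ultimately show "expectation Y = 0" by (simp add: LIMSEQ_const_iff)
  have double: "2 * (1 - cos (2 * x)) = (2 * sin x)\<^sup>2" for x :: real
    by (simp add: cos_double_sin power2_eq_square)
  \<comment> \<open>The second difference quotient in half-angle form, which shows the domination by
    \<open>y^2\<close>.\<close>
  define k where "k n y = (2 * (real (Suc n) * sin (1 / real (Suc n) * (y / 2))))\<^sup>2" for n y
  have k_eq: "k n y = 2 * (real (Suc n))\<^sup>2 * (1 - cos (1 / real (Suc n) * y))" for n y
    using double[of "1 / real (Suc n) * (y / 2)"] by (simp add: k_def power_mult_distrib del: of_nat_Suc)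
  have "(\<lambda>n. expectation (\<lambda>\<omega>. k n (Y \<omega>))) \<longlonglongrightarrow> expectation (\<lambda>\<omega>. (Y \<omega>)\<^sup>2)"
  proof (rule integral_dominated_convergence[where w="\<lambda>\<omega>. (Y \<omega>)\<^sup>2"])
    have "k n y \<le> y\<^sup>2" for n y
    proof -
      have "k n y = (\<bar>2 * (real (Suc n) * sin (1 / real (Suc n) * (y / 2)))\<bar>)\<^sup>2" by (simp add: k_def)
      also have "\<dots> \<le> (2 * \<bar>y / 2\<bar>)\<^sup>2"
        unfolding abs_mult[of 2] using sin_le[of n "y / 2"] by (intro power_mono) auto
      finally show ?thesis by simp
    qed
    then show "AE \<omega> in M. norm (k n (Y \<omega>)) \<le> (Y \<omega>)\<^sup>2" for n by (auto simp: k_def)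
    show "AE \<omega> in M. (\<lambda>n. k n (Y \<omega>)) \<longlonglongrightarrow> (Y \<omega>)\<^sup>2"
    proof (rule AE_I2)
      fix \<omega>
      have "(\<lambda>n. k n (Y \<omega>)) \<longlonglongrightarrow> (2 * (Y \<omega> / 2))\<^sup>2"
        unfolding k_def by (intro tendsto_intros sin_lim)
      then show "(\<lambda>n. k n (Y \<omega>)) \<longlonglongrightarrow> (Y \<omega>)\<^sup>2" by simp
    qed
    show "(\<lambda>\<omega>. k n (Y \<omega>)) \<in> borel_measurable M" for n unfolding k_def by measurable
  qed (use i2 in auto)
  moreover have "expectation (\<lambda>\<omega>. k n (Y \<omega>)) = 2 * (real (Suc n))\<^sup>2 * (1 - exp (- ((1 / real (Suc n))\<^sup>2 * q) / 2))" for n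
  proof -
    have "expectation (\<lambda>\<omega>. b * (1 - cos (a * Y \<omega>))) = b * (1 - exp (- (a\<^sup>2 * q) / 2))" for a b
    proof -
      have "integrable M (\<lambda>\<omega>. cos (a * Y \<omega>))"
        by (rule integrable_bounded[OF finite_measure_axioms, of _ 1]) auto
      then show ?thesis by (simp add: cos prob_space)
    qed
    then show ?thesis unfolding k_eq .
  qed
  moreover have "(\<lambda>n. 2 * (real (Suc n))\<^sup>2 * (1 - exp (- ((1 / real (Suc n))\<^sup>2 * q) / 2))) \<longlonglongrightarrow> q"
    by real_asymp
  ultimately show "expectation (\<lambda>\<omega>. (Y \<omega>)\<^sup>2) = q" using LIMSEQ_unique by force
qed

lemma energy_scaleR: "energy A g (c *\<^sub>R \<theta>) t L = c\<^sup>2 * energy A g \<theta> t L"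
  by (simp add: energy_def power_mult_distrib sum_distrib_left[symmetric])

lemma energy_integrand_integrable:
  assumes "continuous_on UNIV g"
  shows "(\<lambda>u. \<Sum>j\<in>UNIV. (\<theta> \<bullet> flow A u (column j (g (t - u))))\<^sup>2) integrable_on {a..b}"
  by (intro integrable_continuous_real continuous_intros continuous_on_compose2[OF assms]) auto

lemma energy_nonneg:
  assumes "continuous_on UNIV g" shows "0 \<le> energy A g \<theta> t L"
  unfolding energy_def
  by (intro integral_nonneg energy_integrand_integrable assms) (auto intro: sum_nonneg)

section \<open>Variance, decay of the noise and mean of a bounded solution\<close>

locale L2_bounded_solution =
  fixes A :: "real^'d^'d" and f :: "real \<Rightarrow> real^'d" and g :: "real \<Rightarrow> real^'m^'d"
    and M :: "'w measure" and F :: "real \<Rightarrow> 'w measure" and X :: "real \<Rightarrow> 'w \<Rightarrow> real^'d"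
    and W :: "real \<Rightarrow> 'w \<Rightarrow> real^'m"
  assumes solution: "weak_solution A f g M F X W" and bounded: "L2_bounded M X"
    and ap_f: "bochner_ap f" and ap_g: "bochner_ap g"
begin

sublocale filtered_prob_space M F
  using solution by (simp add: weak_solution_def)

lemmas cont_f = bochner_ap_continuous[OF ap_f]
lemmas cont_g = bochner_ap_continuous[OF ap_g]

lemma X_F_measurable: "X t \<in> borel_measurable (F t)"
  using solution by (simp add: weak_solution_def)

lemma X_measurable [measurable]: "X t \<in> borel_measurable M"
  by (rule F_measurable_events[OF X_F_measurable])

lemma X_square_integrable: "square_integrable M (X t)"
  using bounded X_measurable by (simp add: square_integrable_def L2_bounded_def)

text \<open>One fixed common bound of the second moments, so that later constants do not depend on
  time.\<close>

definition moment :: real where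
  "moment = (SOME K. \<forall>t. expectation (\<lambda>\<omega>. (norm (X t \<omega>))\<^sup>2) \<le> K)"

lemma X_moment: "expectation (\<lambda>\<omega>. (norm (X t \<omega>))\<^sup>2) \<le> moment"
proof -
  obtain c where c: "\<And>t. sqrt (expectation (\<lambda>\<omega>. (norm (X t \<omega>))\<^sup>2)) \<le> c"
    using bounded by (auto simp: L2_bounded_def bdd_above_def)
  then have "expectation (\<lambda>\<omega>. (norm (X t \<omega>))\<^sup>2) \<le> c\<^sup>2" for t
    using power_mono[OF c[of t], of 2] by (simp add: integral_nonneg_AE)
  then have "\<exists>K. \<forall>t. expectation (\<lambda>\<omega>. (norm (X t \<omega>))\<^sup>2) \<le> K" by blast
  then show ?thesis unfolding moment_def by (rule someI2_ex) blast
qed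

lemma moment_nonneg: "0 \<le> moment"
  using order_trans[OF _ X_moment[of 0]] by (simp add: integral_nonneg_AE)

lemma X_norm: "expectation (\<lambda>\<omega>. norm (X t \<omega>)) \<le> sqrt moment"
  using square_integrable_imp_integrable(3)[OF X_square_integrable[of t]] X_moment[of t]
  by (meson order_trans real_sqrt_le_mono)

abbreviation J :: "real \<Rightarrow> real \<Rightarrow> 'w \<Rightarrow> real^'d" where
  "J \<equiv> mild_noise A f X"

lemma J_square_integrable: "square_integrable M (J s t)"
proof -
  have "square_integrable M (\<lambda>\<omega>. X t \<omega> + ((- flow A (t - s) (X s \<omega>)) + - integral {0..t - s} (\<lambda>u. flow A u (f (t - u)))))"
    by (intro square_integrable_add X_square_integrable square_integrable_const
        square_integrable_linear[of M _ "\<lambda>x. - flow A (t - s) x"] linear_compose_neg linear_flow)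
  then show ?thesis by (simp add: mild_noise_def[abs_def] algebra_simps)
qed

text \<open>Noise accumulated over any length of time damps the characteristic function by
  \<open>exp (- energy / 2)\<close>. A bounded first moment keeps the characteristic function near 1
  for small arguments, uniformly in time, so the damping is limited.\<close>

lemma energy_bounded: "\<exists>C. \<forall>t. \<forall>L\<ge>0. energy A g \<theta> t L \<le> C"
proof -
  \<comment> \<open>Scaling \<theta> by \<open>c\<close> makes the distance of the characteristic
    function from 1 at most \<open>1 / 2\<close>; as the energy is quadratic, this costs the factor
    \<open>1 / c^2\<close>.\<close>
  define c where "c = 1 / (2 * (norm \<theta> * sqrt moment + 1))"
  have pos: "norm \<theta> * sqrt moment + 1 > 0" using moment_nonneg by (simp add: add_nonneg_pos)
  have c: "c > 0" "c * (norm \<theta> * sqrt moment) \<le> 1 / 2"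
    using pos by (auto simp: c_def field_simps)
  have "energy A g \<theta> t L \<le> 2 * ln 2 / c\<^sup>2" if "L \<ge> 0" for t L
  proof -
    let ?\<theta> = "c *\<^sub>R \<theta>"
    define Z where "Z \<omega> = cis (?\<theta> \<bullet> flow A L (X (t - L) \<omega>))" for \<omega>
    define b where "b = integral {0..L} (\<lambda>u. flow A u (f (t - u)))"
    have Z_meas: "Z \<in> borel_measurable (F (t - L))"
    proof -
      have [measurable]: "(\<lambda>\<omega>. flow A L (X (t - L) \<omega>)) \<in> borel_measurable (F (t - L))"
        by (rule borel_measurable_continuous_on[OF linear_continuous_on[OF bounded_linear_flow] X_F_measurable])
      show ?thesis unfolding Z_def by measurable
    qed
    have split: "cis (?\<theta> \<bullet> X t \<omega>) = cis (?\<theta> \<bullet> b) * (Z \<omega> * cis (?\<theta> \<bullet> J (t - L) t \<omega>))" for \<omega>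
      by (simp add: mild_noise_def Z_def b_def cis_mult inner_diff_right)
    have "expectation (\<lambda>\<omega>. cis (?\<theta> \<bullet> X t \<omega>)) = cis (?\<theta> \<bullet> b) * (expectation Z * of_real (exp (- energy A g ?\<theta> t L / 2)))"
    proof -
      have "expectation (\<lambda>\<omega>. Z \<omega> * cis (?\<theta> \<bullet> J (t - L) t \<omega>)) = expectation Z * of_real (exp (- energy A g ?\<theta> t (t - (t - L)) / 2))"
        by (rule weak_solution_mild_noise_cis[OF solution cont_f cont_g _ Z_meas]) (use that in \<open>auto simp: Z_def\<close>)
      then show ?thesis unfolding split by simp
    qed
    then have "norm (expectation (\<lambda>\<omega>. cis (?\<theta> \<bullet> X t \<omega>))) = norm (expectation Z) * exp (- energy A g ?\<theta> t L / 2)"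
      by (simp add: norm_mult)
    also have "norm (expectation Z) \<le> expectation (\<lambda>\<omega>. norm (Z \<omega>))" by (rule integral_norm_bound)
    also have "\<dots> = 1" by (simp add: Z_def prob_space)
    finally have up: "norm (expectation (\<lambda>\<omega>. cis (?\<theta> \<bullet> X t \<omega>))) \<le> exp (- energy A g ?\<theta> t L / 2)" by simp
    have ic: "integrable M (\<lambda>\<omega>. cis (?\<theta> \<bullet> X t \<omega>))"
      by (rule integrable_bounded[OF finite_measure_axioms, of _ 1]) auto
    have iX: "integrable M (\<lambda>\<omega>. norm (X t \<omega>))" by (rule square_integrable_imp_integrable[OF X_square_integrable])
    have "norm (1 - expectation (\<lambda>\<omega>. cis (?\<theta> \<bullet> X t \<omega>))) = norm (expectation (\<lambda>\<omega>. 1 - cis (?\<theta> \<bullet> X t \<omega>)))"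
      using ic by (simp add: prob_space)
    also have "\<dots> \<le> expectation (\<lambda>\<omega>. norm (1 - cis (?\<theta> \<bullet> X t \<omega>)))" by (rule integral_norm_bound)
    also have "\<dots> \<le> expectation (\<lambda>\<omega>. c * norm \<theta> * norm (X t \<omega>))"
    proof (rule integral_mono)
      show "norm (1 - cis (?\<theta> \<bullet> X t \<omega>)) \<le> c * norm \<theta> * norm (X t \<omega>)" for \<omega>
        using norm_cis_diff_le[of 0 "?\<theta> \<bullet> X t \<omega>"] Cauchy_Schwarz_ineq2[of ?\<theta> "X t \<omega>"] c(1) by simp
    qed (use ic iX in auto)
    also have "\<dots> = c * norm \<theta> * expectation (\<lambda>\<omega>. norm (X t \<omega>))" by simp
    also have "\<dots> \<le> c * norm \<theta> * sqrt moment" using c(1) X_norm by (intro mult_left_mono) auto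
    also have "\<dots> \<le> 1 / 2" using c(2) by (simp add: mult.assoc)
    finally have "norm (1 - expectation (\<lambda>\<omega>. cis (?\<theta> \<bullet> X t \<omega>))) \<le> 1 / 2" .
    then have "1 / 2 \<le> norm (expectation (\<lambda>\<omega>. cis (?\<theta> \<bullet> X t \<omega>)))"
      using norm_triangle_ineq2[of 1 "1 - expectation (\<lambda>\<omega>. cis (?\<theta> \<bullet> X t \<omega>))"] by simp
    with up have "1 / 2 \<le> exp (- energy A g ?\<theta> t L / 2)" by linarith
    then have "ln (1 / 2) \<le> ln (exp (- energy A g ?\<theta> t L / 2))" by (intro ln_mono) auto
    then have "ln (1 / 2) \<le> - energy A g ?\<theta> t L / 2" by simp
    then have "c\<^sup>2 * energy A g \<theta> t L \<le> 2 * ln 2" by (simp add: energy_scaleR ln_div)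
    then show ?thesis using c(1) by (simp add: field_simps)
  qed
  then show ?thesis by blast
qed

text \<open>\<open>flow_decay\<close> is applied to each column of \<open>g\<close>. The squared
  modulus of a complex functional is the sum of the squares of two real ones, represented by
  \<open>\<theta>1\<close> and \<open>\<theta>2\<close>, and each of them is bounded by an
  energy.\<close>

lemma noise_decay:
  obtains K \<alpha> where "K > 0" "\<alpha> > 0"
    "\<And>j u r. u \<ge> 0 \<Longrightarrow> norm (flow A u (column j (g r))) \<le> K * exp (- \<alpha> * u)"
proof -
  have "\<exists>K \<alpha>. K > 0 \<and> \<alpha> > 0 \<and> (\<forall>u\<ge>0. \<forall>r. norm (flow A u (column j (g r))) \<le> K * exp (- \<alpha> * u))" for j
  proof (rule flow_decay)
    have "linear (\<lambda>B::real^'m^'d. column j B)"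
      by (intro linearI) (auto simp: column_def vec_eq_iff)
    then show "bochner_ap (\<lambda>r. column j (g r))"
      by (intro bochner_ap_bounded_linear[OF ap_g]) (simp add: linear_conv_bounded_linear)
    fix l :: "real^'d \<Rightarrow> complex" assume l: "linear l"
    define \<theta>1 where "\<theta>1 = adjoint (\<lambda>v. Re (l v)) 1"
    define \<theta>2 where "\<theta>2 = adjoint (\<lambda>v. Im (l v)) 1"
    have "linear (\<lambda>v. Re (l v))" "linear (\<lambda>v. Im (l v))"
      using l by (auto intro!: linear_compose[unfolded o_def, OF l] simp: bounded_linear.linear bounded_linear_Re bounded_linear_Im)
    then have \<theta>: "Re (l v) = \<theta>1 \<bullet> v" "Im (l v) = \<theta>2 \<bullet> v" for v
      using adjoint_works[of "\<lambda>v. Re (l v)" v 1] adjoint_works[of "\<lambda>v. Im (l v)" v 1]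
      by (simp_all add: \<theta>1_def \<theta>2_def inner_commute)
    obtain C1 C2 where C: "\<And>t L. L \<ge> 0 \<Longrightarrow> energy A g \<theta>1 t L \<le> C1" "\<And>t L. L \<ge> 0 \<Longrightarrow> energy A g \<theta>2 t L \<le> C2"
      using energy_bounded by metis
    have "integral {0..L} (\<lambda>u. (norm (l (flow A u (column j (g (t - u))))))\<^sup>2) \<le> C1 + C2" if "L \<ge> 0" for t L
    proof -
      have "integral {0..L} (\<lambda>u. (norm (l (flow A u (column j (g (t - u))))))\<^sup>2)
        \<le> integral {0..L} (\<lambda>u. (\<Sum>j\<in>UNIV. (\<theta>1 \<bullet> flow A u (column j (g (t - u))))\<^sup>2)
            + (\<Sum>j\<in>UNIV. (\<theta>2 \<bullet> flow A u (column j (g (t - u))))\<^sup>2))"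
      proof (rule integral_le)
        have "bounded_linear l" using l by (simp add: linear_conv_bounded_linear)
        then show "(\<lambda>u. (norm (l (flow A u (column j (g (t - u))))))\<^sup>2) integrable_on {0..L}"
          by (intro integrable_continuous_real continuous_intros bounded_linear.continuous_on[of l]
              continuous_on_compose2[OF cont_g]) auto
        show "(\<lambda>u. (\<Sum>j\<in>UNIV. (\<theta>1 \<bullet> flow A u (column j (g (t - u))))\<^sup>2)
            + (\<Sum>j\<in>UNIV. (\<theta>2 \<bullet> flow A u (column j (g (t - u))))\<^sup>2)) integrable_on {0..L}"
          by (intro Henstock_Kurzweil_Integration.integrable_add energy_integrand_integrable cont_g)
        fix u
        have "(\<theta> \<bullet> flow A u (column j (g (t - u))))\<^sup>2 \<le> (\<Sum>j\<in>UNIV. (\<theta> \<bullet> flow A u (column j (g (t - u))))\<^sup>2)" for \<theta>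
          by (rule member_le_sum) auto
        then show "(norm (l (flow A u (column j (g (t - u))))))\<^sup>2
          \<le> (\<Sum>j\<in>UNIV. (\<theta>1 \<bullet> flow A u (column j (g (t - u))))\<^sup>2) + (\<Sum>j\<in>UNIV. (\<theta>2 \<bullet> flow A u (column j (g (t - u))))\<^sup>2)"
          unfolding cmod_power2 \<theta> by (intro add_mono)
      qed
      also have "\<dots> = energy A g \<theta>1 t L + energy A g \<theta>2 t L"
        unfolding energy_def
        by (intro Henstock_Kurzweil_Integration.integral_add energy_integrand_integrable cont_g)
      also have "\<dots> \<le> C1 + C2" by (intro add_mono C that)
      finally show ?thesis .
    qed
    then show "\<exists>C. \<forall>t. \<forall>L\<ge>0. integral {0..L} (\<lambda>u. (norm (l (flow A u (column j (g (t - u))))))\<^sup>2) \<le> C" by blast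
  qed
  then obtain K \<alpha> where K: "\<And>j. K j > 0" and \<alpha>: "\<And>j. \<alpha> j > 0"
    and le: "\<And>j u r. u \<ge> 0 \<Longrightarrow> norm (flow A u (column j (g r))) \<le> K j * exp (- \<alpha> j * u)" by metis
  show ?thesis
  proof
    show "sum K UNIV > 0" using K by (intro sum_pos) auto
    show "Min (range \<alpha>) > 0" using \<alpha> by simp
    fix j r and u :: real assume u: "u \<ge> 0"
    have "K j \<le> sum K UNIV" using K by (intro member_le_sum) (auto simp: less_imp_le)
    moreover have "exp (- \<alpha> j * u) \<le> exp (- Min (range \<alpha>) * u)"
    proof -
      have "Min (range \<alpha>) * u \<le> \<alpha> j * u" using u by (intro mult_right_mono) auto
      then show ?thesis by (simp only: exp_le_cancel_iff mult_minus_left neg_le_iff_le)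
    qed
    ultimately have "K j * exp (- \<alpha> j * u) \<le> sum K UNIV * exp (- Min (range \<alpha>) * u)"
      using K[of j] by (intro mult_mono) auto
    with le[OF u, of j r] show "norm (flow A u (column j (g r))) \<le> sum K UNIV * exp (- Min (range \<alpha>) * u)" by linarith
  qed
qed

lemma J_moments:
  assumes "s \<le> t"
  shows "expectation (\<lambda>\<omega>. \<theta> \<bullet> J s t \<omega>) = 0"
    and "expectation (\<lambda>\<omega>. (\<theta> \<bullet> J s t \<omega>)\<^sup>2) = energy A g \<theta> t (t - s)"
proof -
  have sq: "square_integrable M (\<lambda>\<omega>. \<theta> \<bullet> J s t \<omega>)"
    by (intro square_integrable_linear[OF J_square_integrable] bounded_linear.linear bounded_linear_inner_right)
  have "expectation (\<lambda>\<omega>. cis (a * (\<theta> \<bullet> J s t \<omega>))) = of_real (exp (- (a\<^sup>2 * energy A g \<theta> t (t - s)) / 2))" for a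
    using weak_solution_mild_noise_cis[OF solution cont_f cont_g assms, of "\<lambda>_. 1" "a *\<^sub>R \<theta>"]
    by (simp add: prob_space energy_scaleR)
  from gaussian_moments[OF sq this] show "expectation (\<lambda>\<omega>. \<theta> \<bullet> J s t \<omega>) = 0"
    "expectation (\<lambda>\<omega>. (\<theta> \<bullet> J s t \<omega>)\<^sup>2) = energy A g \<theta> t (t - s)" by auto
qed

definition m :: "real \<Rightarrow> real^'d" where "m t = expectation (X t)"

lemma X_integrable: "integrable M (X t)"
  by (rule square_integrable_imp_integrable[OF X_square_integrable])

lemma m_mild:
  assumes "s \<le> t"
  shows "m t = flow A (t - s) (m s) + integral {0..t - s} (\<lambda>u. flow A u (f (t - u)))"
proof -
  have iJ: "integrable M (J s t)" by (rule square_integrable_imp_integrable[OF J_square_integrable])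
  have "expectation (J s t) = 0"
  proof -
    have "expectation (J s t) \<bullet> \<theta> = 0" for \<theta>
      using J_moments(1)[OF assms, of \<theta>] iJ by (simp add: inner_commute[of \<theta>])
    then show ?thesis by (metis inner_eq_zero_iff)
  qed
  moreover have "expectation (J s t) = m t - flow A (t - s) (m s) - integral {0..t - s} (\<lambda>u. flow A u (f (t - u)))"
  proof -
    have "integrable M (\<lambda>\<omega>. flow A (t - s) (X s \<omega>))"
      by (intro integrable_bounded_linear[OF bounded_linear_flow] X_integrable)
    moreover have "expectation (\<lambda>\<omega>. flow A (t - s) (X s \<omega>)) = flow A (t - s) (m s)"
      unfolding m_def by (intro integral_bounded_linear bounded_linear_flow X_integrable)
    ultimately show ?thesis
      using X_integrable by (simp add: mild_noise_def[abs_def] m_def prob_space)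
  qed
  ultimately show ?thesis by (simp add: algebra_simps)
qed

text \<open>With \<open>flow A (r - s)\<close> pulled out, the mild formula becomes a flow applied
  to a differentiable function. The base point \<open>s = t - 1\<close> makes \<open>t\<close> an
  interior point.\<close>

lemma m_derivative: "(m has_vector_derivative A *v m t + f t) (at t)"
proof -
  define s where "s = t - 1"
  define v where "v r = m s + integral {s..r} (\<lambda>r. flow A (s - r) (f r))" for r
  have cont: "continuous_on UNIV (\<lambda>r. flow A (s - r) (f r))" by (intro continuous_intros cont_f)
  have m_eq: "m r = flow A (r - s) (v r)" if "s \<le> r" for r
  proof -
    have "integral {0..r - s} (\<lambda>u. flow A u (f (r - u))) = integral {s..r} (\<lambda>q. flow A (r - q) (f q))"
      by (subst integral_reflect_translate[OF _ that]) (auto intro!: continuous_intros cont_f)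
    also have "\<dots> = integral {s..r} (flow A (r - s) \<circ> (\<lambda>q. flow A (s - q) (f q)))"
      by (simp add: o_def flow_add[symmetric])
    also have "\<dots> = flow A (r - s) (integral {s..r} (\<lambda>q. flow A (s - q) (f q)))"
      by (intro integral_linear bounded_linear_flow integrable_continuous_real continuous_on_subset[OF cont]) auto
    finally show ?thesis
      using m_mild[OF that] by (simp add: v_def linear_add[OF linear_flow])
  qed
  have "((\<lambda>r. integral {s..r} (\<lambda>r. flow A (s - r) (f r))) has_vector_derivative flow A (s - t) (f t)) (at t within {s..t + 1})"
    by (intro integral_has_vector_derivative continuous_on_subset[OF cont]) (auto simp: s_def)
  then have "((\<lambda>r. integral {s..r} (\<lambda>r. flow A (s - r) (f r))) has_vector_derivative flow A (s - t) (f t)) (at t within {s<..<t + 1})"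
    by (rule has_vector_derivative_within_subset) auto
  then have "((\<lambda>r. integral {s..r} (\<lambda>r. flow A (s - r) (f r))) has_vector_derivative flow A (s - t) (f t)) (at t)"
    by (subst (asm) at_within_open) (auto simp: s_def)
  then have "(v has_vector_derivative 0 + flow A (s - t) (f t)) (at t)"
    unfolding v_def by (intro has_vector_derivative_add has_vector_derivative_const)
  from has_vector_derivative_flow_comp[OF this, of A]
  have "((\<lambda>r. flow A r (v r)) has_vector_derivative A *v flow A t (v t) + flow A s (f t)) (at t)"
    by (simp add: flow_matrix_commute linear_add[OF linear_flow] flow_add[symmetric])
  from bounded_linear.has_vector_derivative[OF bounded_linear_flow this, of A "- s"]
  have "((\<lambda>r. flow A (r - s) (v r)) has_vector_derivative A *v flow A (t - s) (v t) + f t) (at t)"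
    by (simp add: linear_add[OF linear_flow] flow_matrix_commute flow_add[symmetric])
  then have "(m has_vector_derivative A *v flow A (t - s) (v t) + f t) (at t)"
    by (rule has_vector_derivative_transform_within_open[of _ _ _ "{s<..<t + 1}"]) (auto simp: m_eq s_def)
  then show ?thesis using m_eq[of t] by (simp add: s_def)
qed

lemma m_bound: "norm (m t) \<le> sqrt moment"
  unfolding m_def using integral_norm_bound[of M "X t"] X_norm[of t] by linarith

lemma ap_m: "bochner_ap m"
proof (rule bochner_ap_bounded_ode_solution[OF m_derivative ap_f])
  show "bounded (range m)" using m_bound by (auto simp: bounded_iff)
qed

definition Xc :: "real \<Rightarrow> 'w \<Rightarrow> real^'d" where "Xc t \<omega> = X t \<omega> - m t"

lemma Xc_measurable [measurable]: "Xc t \<in> borel_measurable M"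
  unfolding Xc_def by measurable

text \<open>Solution and mean carry the same forcing integral, so centring cancels it.\<close>

lemma J_Xc: "s \<le> t \<Longrightarrow> J s t \<omega> = Xc t \<omega> - flow A (t - s) (Xc s \<omega>)"
  using m_mild[of s t] by (simp add: mild_noise_def Xc_def linear_diff[OF linear_flow] algebra_simps)

lemma Xc_square_integrable: "square_integrable M (Xc t)"
  using square_integrable_add[OF X_square_integrable[of t] square_integrable_const[of "- m t"]]
  by (simp add: Xc_def[abs_def])

lemma Xc_moment: "expectation (\<lambda>\<omega>. (norm (Xc t \<omega>))\<^sup>2) \<le> 4 * moment"
proof -
  have "expectation (\<lambda>\<omega>. (norm (Xc t \<omega>))\<^sup>2) \<le> expectation (\<lambda>\<omega>. 2 * (norm (X t \<omega>))\<^sup>2 + 2 * (norm (m t))\<^sup>2)"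
  proof (rule integral_mono)
    show "(norm (Xc t \<omega>))\<^sup>2 \<le> 2 * (norm (X t \<omega>))\<^sup>2 + 2 * (norm (m t))\<^sup>2" for \<omega>
      using norm_sum_sq_le[of "X t \<omega>" "- m t"] by (simp add: Xc_def)
  qed (use Xc_square_integrable X_square_integrable in \<open>auto simp: square_integrable_def\<close>)
  also have "\<dots> = 2 * expectation (\<lambda>\<omega>. (norm (X t \<omega>))\<^sup>2) + 2 * (norm (m t))\<^sup>2"
    using X_square_integrable by (simp add: square_integrable_def prob_space)
  also have "\<dots> \<le> 2 * moment + 2 * moment"
  proof (intro add_mono mult_left_mono X_moment)
    show "(norm (m t))\<^sup>2 \<le> moment"
      using power_mono[OF m_bound[of t], of 2] moment_nonneg by simp
  qed auto
  finally show ?thesis by simp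
qed

end

section \<open>The contribution of the remote past\<close>

lemma norm_sq_component_sum: "(norm (x :: real^'n))\<^sup>2 = (\<Sum>i\<in>UNIV. (axis i 1 \<bullet> x)\<^sup>2)"
  by (simp add: norm_vec_def L2_set_def sum_nonneg inner_axis' )

context L2_bounded_solution
begin

text \<open>The second moment of a coordinate is an energy with \<theta> pulled back by
  \<open>flow A L\<close>. There the columns of \<open>g\<close> appear at flow time
  \<open>L + u\<close>, and integrating their decay over \<open>u\<close> gives a bound that does
  not depend on \<open>s\<close>. The maximum of two constants lets one pair \<open>K\<close>,
  \<alpha> serve both estimates.\<close>

lemma flow_J_bound:
  obtains K \<alpha> where "K > 0" "\<alpha> > 0"
    "\<And>j u r. u \<ge> 0 \<Longrightarrow> norm (flow A u (column j (g r))) \<le> K * exp (- \<alpha> * u)"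
    "\<And>s t L. L \<ge> 0 \<Longrightarrow> s \<le> t - L \<Longrightarrow>
      expectation (\<lambda>\<omega>. (norm (flow A L (J s (t - L) \<omega>)))\<^sup>2) \<le> K * exp (- \<alpha> * L)"
proof -
  obtain K \<alpha> where K: "K > 0" "\<alpha> > 0"
    and decay: "\<And>j u r. u \<ge> 0 \<Longrightarrow> norm (flow A u (column j (g r))) \<le> K * exp (- \<alpha> * u)"
    using noise_decay by blast
  define m' where "m' = real CARD('m)"
  define K' where "K' = real CARD('d) * (m' * K\<^sup>2 / (2 * \<alpha>))"
  have main: "expectation (\<lambda>\<omega>. (norm (flow A L (J s (t - L) \<omega>)))\<^sup>2) \<le> K' * exp (- \<alpha> * L)"
    if L: "L \<ge> 0" "s \<le> t - L" for s t L
  proof -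
    have comp: "expectation (\<lambda>\<omega>. (axis i 1 \<bullet> flow A L (J s (t - L) \<omega>))\<^sup>2) \<le> m' * K\<^sup>2 / (2 * \<alpha>) * exp (- \<alpha> * L)" for i
    proof -
      define \<theta> where "\<theta> = adjoint (flow A L) (axis i 1)"
      have \<theta>: "\<theta> \<bullet> v = axis i 1 \<bullet> flow A L v" for v
        using adjoint_works[OF linear_flow, of v A L "axis i 1"] by (simp add: \<theta>_def inner_commute)
      define T where "T = t - L - s"
      have "T \<ge> 0" using L by (simp add: T_def)
      have exp_integral: "integral {0..T} (\<lambda>u. exp (- 2 * \<alpha> * u)) \<le> 1 / (2 * \<alpha>)"
      proof -
        have "((\<lambda>u. exp (- 2 * \<alpha> * u)) has_integral (- exp (- 2 * \<alpha> * T) / (2 * \<alpha>) - (- exp (- 2 * \<alpha> * 0) / (2 * \<alpha>)))) {0..T}"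
          using \<open>T \<ge> 0\<close> K
          by (intro fundamental_theorem_of_calculus)
             (auto intro!: derivative_eq_intros simp: has_real_derivative_iff_has_vector_derivative[symmetric])
        then show ?thesis using K by (simp add: integral_unique diff_divide_distrib[symmetric] divide_right_mono)
      qed
      have "expectation (\<lambda>\<omega>. (axis i 1 \<bullet> flow A L (J s (t - L) \<omega>))\<^sup>2) = energy A g \<theta> (t - L) T"
        unfolding \<theta>[symmetric] T_def by (rule J_moments(2)[OF L(2)])
      also have "\<dots> \<le> integral {0..T} (\<lambda>u. m' * (K\<^sup>2 * exp (- \<alpha> * L) * exp (- 2 * \<alpha> * u)))"
        unfolding energy_def
      proof (rule integral_le[OF energy_integrand_integrable[OF cont_g]])
        show "(\<lambda>u. m' * (K\<^sup>2 * exp (- \<alpha> * L) * exp (- 2 * \<alpha> * u))) integrable_on {0..T}"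
          by (intro integrable_continuous_real continuous_intros)
        fix u assume u: "u \<in> {0..T}"
        have "(\<theta> \<bullet> flow A u (column j (g (t - L - u))))\<^sup>2 \<le> K\<^sup>2 * exp (- \<alpha> * L) * exp (- 2 * \<alpha> * u)" for j
        proof -
          have "\<bar>\<theta> \<bullet> flow A u (column j (g (t - L - u)))\<bar> = \<bar>axis i 1 \<bullet> flow A (L + u) (column j (g (t - L - u)))\<bar>"
            by (simp add: \<theta> flow_add)
          also have "\<dots> \<le> norm (axis i (1::real)) * norm (flow A (L + u) (column j (g (t - L - u))))"
            by (rule Cauchy_Schwarz_ineq2)
          also have "\<dots> \<le> K * exp (- \<alpha> * (L + u))" using decay[of "L + u" j "t - L - u"] u L by simp
          finally have "\<bar>\<theta> \<bullet> flow A u (column j (g (t - L - u)))\<bar>\<^sup>2 \<le> (K * exp (- \<alpha> * (L + u)))\<^sup>2"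
            by (intro power_mono) auto
          also have "(K * exp (- \<alpha> * (L + u)))\<^sup>2 = K\<^sup>2 * exp (- 2 * \<alpha> * L) * exp (- 2 * \<alpha> * u)"
            by (simp add: power_mult_distrib power2_eq_square[of "exp _"] exp_add[symmetric] algebra_simps)
          also have "\<dots> \<le> K\<^sup>2 * exp (- \<alpha> * L) * exp (- 2 * \<alpha> * u)"
            using L K by (intro mult_right_mono mult_left_mono) auto
          finally show ?thesis by simp
        qed
        then show "(\<Sum>j\<in>UNIV. (\<theta> \<bullet> flow A u (column j (g (t - L - u))))\<^sup>2) \<le> m' * (K\<^sup>2 * exp (- \<alpha> * L) * exp (- 2 * \<alpha> * u))"
          unfolding m'_def by (intro sum_bounded_above)
      qed
      also have "\<dots> = m' * (K\<^sup>2 * exp (- \<alpha> * L)) * integral {0..T} (\<lambda>u. exp (- 2 * \<alpha> * u))"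
        by (simp add: mult.assoc)
      also have "\<dots> \<le> m' * (K\<^sup>2 * exp (- \<alpha> * L)) * (1 / (2 * \<alpha>))"
        by (intro mult_left_mono exp_integral) (simp add: m'_def)
      finally show ?thesis by (simp add: mult_ac)
    qed
    have sq: "square_integrable M (\<lambda>\<omega>. axis i 1 \<bullet> flow A L (J s (t - L) \<omega>))" for i
      by (intro square_integrable_linear[OF J_square_integrable, of "\<lambda>x. axis i 1 \<bullet> flow A L x"]
          linear_compose[unfolded o_def, OF linear_flow] bounded_linear.linear bounded_linear_inner_right)
    have "expectation (\<lambda>\<omega>. (norm (flow A L (J s (t - L) \<omega>)))\<^sup>2)
        = (\<Sum>i\<in>UNIV. expectation (\<lambda>\<omega>. (axis i 1 \<bullet> flow A L (J s (t - L) \<omega>))\<^sup>2))"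
      unfolding norm_sq_component_sum
      using sq by (intro Bochner_Integration.integral_sum) (simp add: square_integrable_def)
    also have "\<dots> \<le> real CARD('d) * (m' * K\<^sup>2 / (2 * \<alpha>) * exp (- \<alpha> * L))"
      by (intro sum_bounded_above comp)
    finally show ?thesis by (simp add: K'_def mult.assoc)
  qed
  show ?thesis
  proof (rule that[of "max K K'"])
    show "max K K' > 0" using K by simp
    fix j r and u :: real assume "u \<ge> 0"
    show "norm (flow A u (column j (g r))) \<le> max K K' * exp (- \<alpha> * u)"
      by (rule order_trans[OF decay[OF \<open>u \<ge> 0\<close>]]) (simp add: mult_right_mono)
  next
    fix s t L :: real assume "L \<ge> 0" "s \<le> t - L"
    show "expectation (\<lambda>\<omega>. (norm (flow A L (J s (t - L) \<omega>)))\<^sup>2) \<le> max K K' * exp (- \<alpha> * L)"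
      by (rule order_trans[OF main[OF \<open>L \<ge> 0\<close> \<open>s \<le> t - L\<close>]]) (simp add: mult_right_mono)
  qed (rule K(2))
qed

text \<open>The part of the solution carried by the remote past. The sequence converges only almost
  surely; elsewhere \<open>lim\<close> is arbitrary.\<close>

definition \<eta> :: "'w \<Rightarrow> real^'d" where
  "\<eta> \<omega> = lim (\<lambda>n. flow A (real n) (Xc (- real n) \<omega>))"

lemma flow_Xc_measurable [measurable]: "(\<lambda>\<omega>. flow A u (Xc t \<omega>)) \<in> borel_measurable M"
  by (rule borel_measurable_continuous_on[OF linear_continuous_on[OF bounded_linear_flow] Xc_measurable])

lemma \<eta>_measurable [measurable]: "\<eta> \<in> borel_measurable M"
  unfolding \<eta>_def by measurable

lemma flow_\<eta>_measurable [measurable]: "(\<lambda>\<omega>. flow A u (\<eta> \<omega>)) \<in> borel_measurable M"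
  by (rule borel_measurable_continuous_on[OF linear_continuous_on[OF bounded_linear_flow] \<eta>_measurable])

text \<open>Consecutive terms differ by propagated noise, whose mean norm decays geometrically. The
  norms of the differences thus have a finite expected sum, and the telescoping series converges
  almost surely.\<close>

lemma AE_lim_\<eta>: "AE \<omega> in M. (\<lambda>n. flow A (real n) (Xc (- real n) \<omega>)) \<longlonglongrightarrow> \<eta> \<omega>"
proof -
  obtain K \<alpha> where K: "K > 0" "\<alpha> > 0"
    and JK: "\<And>s t L. L \<ge> 0 \<Longrightarrow> s \<le> t - L \<Longrightarrow> expectation (\<lambda>\<omega>. (norm (flow A L (J s (t - L) \<omega>)))\<^sup>2) \<le> K * exp (- \<alpha> * L)"
    using flow_J_bound by metis
  define D where "D n \<omega> = flow A (real n) (Xc (- real n) \<omega>)" for n \<omega>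
  have [measurable]: "D n \<in> borel_measurable M" for n unfolding D_def by measurable
  \<comment> \<open>The noise of \<open>[- (n + 1), - n]\<close>, transported to time 0; the end
    point is written \<open>0 - real n\<close> to match \<open>t - L\<close> in the bound.\<close>
  have diff: "D n \<omega> - D (Suc n) \<omega> = flow A (real n) (J (- real (Suc n)) (0 - real n) \<omega>)" for n \<omega>
    using flow_add[of A "real n" 1 "Xc (- real (Suc n)) \<omega>"]
    by (subst J_Xc) (simp_all add: D_def linear_diff[OF linear_flow] add.commute)
  \<comment> \<open>The square root of the decay factor over a unit of time, since first moments are
    bounded by roots of second moments.\<close>
  define q where "q = exp (- \<alpha> / 2)"
  have q: "0 < q" "q < 1" using K by (auto simp: q_def)
  have le: "expectation (\<lambda>\<omega>. norm (D n \<omega> - D (Suc n) \<omega>)) \<le> sqrt K * q ^ n"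
    and int: "integrable M (\<lambda>\<omega>. norm (D n \<omega> - D (Suc n) \<omega>))" for n
  proof -
    have sq: "square_integrable M (\<lambda>\<omega>. flow A (real n) (J (- real (Suc n)) (0 - real n) \<omega>))"
      by (intro square_integrable_linear[OF J_square_integrable] linear_flow)
    have "expectation (\<lambda>\<omega>. norm (D n \<omega> - D (Suc n) \<omega>)) \<le> sqrt (K * exp (- \<alpha> * real n))"
      unfolding diff
      by (rule order_trans[OF square_integrable_imp_integrable(3)[OF sq]])
         (intro real_sqrt_le_mono JK, auto)
    also have "\<dots> = sqrt K * q ^ n"
    proof -
      have "exp (- \<alpha> * real n) = (q ^ n)\<^sup>2"
        by (simp add: q_def exp_of_nat_mult[symmetric] power_mult[symmetric] mult.commute exp_add[symmetric] power2_eq_square algebra_simps)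
      then show ?thesis using q by (simp add: real_sqrt_mult)
    qed
    finally show "expectation (\<lambda>\<omega>. norm (D n \<omega> - D (Suc n) \<omega>)) \<le> sqrt K * q ^ n" .
    show "integrable M (\<lambda>\<omega>. norm (D n \<omega> - D (Suc n) \<omega>))"
      unfolding diff by (rule square_integrable_imp_integrable(2)[OF sq])
  qed
  have "(\<integral>\<^sup>+\<omega>. (\<Sum>n. ennreal (norm (D n \<omega> - D (Suc n) \<omega>))) \<partial>M) = (\<Sum>n. \<integral>\<^sup>+\<omega>. ennreal (norm (D n \<omega> - D (Suc n) \<omega>)) \<partial>M)"
    by (intro nn_integral_suminf) measurable
  also have "\<dots> = (\<Sum>n. ennreal (expectation (\<lambda>\<omega>. norm (D n \<omega> - D (Suc n) \<omega>))))"
    using int by (intro suminf_cong nn_integral_eq_integral) auto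
  also have "\<dots> \<le> (\<Sum>n. ennreal (sqrt K * q ^ n))"
    by (intro suminf_le ennreal_leI le) auto
  also have "\<dots> = ennreal (\<Sum>n. sqrt K * q ^ n)"
    using q K by (intro suminf_ennreal2) (auto intro!: summable_mult summable_geometric)
  finally have "(\<integral>\<^sup>+\<omega>. (\<Sum>n. ennreal (norm (D n \<omega> - D (Suc n) \<omega>))) \<partial>M) < \<infinity>"
    by (rule le_less_trans) simp
  then have "AE \<omega> in M. (\<Sum>n. ennreal (norm (D n \<omega> - D (Suc n) \<omega>))) \<noteq> \<infinity>"
    by (intro nn_integral_PInf_AE) auto
  then show ?thesis
  proof eventually_elim
    case (elim \<omega>)
    then have "summable (\<lambda>n. norm (D n \<omega> - D (Suc n) \<omega>))"
      by (intro summable_suminf_not_top) auto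
    then have "summable (\<lambda>n. D n \<omega> - D (Suc n) \<omega>)" by (rule summable_norm_cancel)
    then have "convergent (\<lambda>n. \<Sum>k<n. D k \<omega> - D (Suc k) \<omega>)" by (simp add: summable_iff_convergent)
    then obtain c where "(\<lambda>n. \<Sum>k<n. D k \<omega> - D (Suc k) \<omega>) \<longlonglongrightarrow> c" by (auto simp: convergent_def)
    then have "(\<lambda>n. D 0 \<omega> - D n \<omega>) \<longlonglongrightarrow> c" by (simp only: sum_lessThan_telescope'[of "\<lambda>k. D k \<omega>"])
    from tendsto_diff[OF tendsto_const[of "D 0 \<omega>"] this]
    have lim: "(\<lambda>n. D n \<omega>) \<longlonglongrightarrow> D 0 \<omega> - c" by simp
    have "\<eta> \<omega> = lim (\<lambda>n. D n \<omega>)" by (simp add: \<eta>_def D_def)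
    then have "\<eta> \<omega> = D 0 \<omega> - c" using limI[OF lim] by simp
    then show ?case using lim by (simp add: D_def)
  qed
qed

text \<open>The difference from \<open>flow A t\<close> of the \<open>n\<close>-th approximation of
  \<eta> is \<open>flow A L\<close> of the noise since time \<open>- n\<close>. The bound for it is
  uniform in \<open>n\<close>, and Fatou's lemma carries it to the limit.\<close>

lemma Xc_eta_bound:
  obtains K \<alpha> where "K > 0" "\<alpha> > 0"
    "\<And>j u r. u \<ge> 0 \<Longrightarrow> norm (flow A u (column j (g r))) \<le> K * exp (- \<alpha> * u)"
    "\<And>t L. L \<ge> 0 \<Longrightarrow> square_integrable M (\<lambda>\<omega>. flow A L (Xc (t - L) \<omega>) - flow A t (\<eta> \<omega>))"
    "\<And>t L. L \<ge> 0 \<Longrightarrow>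
      expectation (\<lambda>\<omega>. (norm (flow A L (Xc (t - L) \<omega>) - flow A t (\<eta> \<omega>)))\<^sup>2) \<le> K * exp (- \<alpha> * L)"
proof -
  obtain K \<alpha> where K: "K > 0" "\<alpha> > 0"
    and decay: "\<And>j u r. u \<ge> 0 \<Longrightarrow> norm (flow A u (column j (g r))) \<le> K * exp (- \<alpha> * u)"
    and JK: "\<And>s t L. L \<ge> 0 \<Longrightarrow> s \<le> t - L \<Longrightarrow> expectation (\<lambda>\<omega>. (norm (flow A L (J s (t - L) \<omega>)))\<^sup>2) \<le> K * exp (- \<alpha> * L)"
    using flow_J_bound by metis
  have nn: "(\<integral>\<^sup>+\<omega>. ennreal ((norm (flow A L (Xc (t - L) \<omega>) - flow A t (\<eta> \<omega>)))\<^sup>2) \<partial>M) \<le> ennreal (K * exp (- \<alpha> * L))"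
    if L: "L \<ge> 0" for t L
  proof -
    define D where "D n \<omega> = flow A L (Xc (t - L) \<omega>) - flow A t (flow A (real n) (Xc (- real n) \<omega>))" for n \<omega>
    have [measurable]: "D n \<in> borel_measurable M" for n
    proof -
      have [measurable]: "(\<lambda>\<omega>. flow A t (flow A (real n) (Xc (- real n) \<omega>))) \<in> borel_measurable M"
        unfolding flow_add[symmetric] by measurable
      show ?thesis unfolding D_def by measurable
    qed
    have D_eq: "D n \<omega> = flow A L (J (- real n) (t - L) \<omega>)" if "- real n \<le> t - L" for n \<omega>
      using J_Xc[OF that, of \<omega>] by (simp add: D_def linear_diff[OF linear_flow] flow_add[symmetric] add.commute)
    have D_le: "(\<integral>\<^sup>+\<omega>. ennreal ((norm (D n \<omega>))\<^sup>2) \<partial>M) \<le> ennreal (K * exp (- \<alpha> * L))" if "- real n \<le> t - L" for n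
    proof -
      have "square_integrable M (D n)"
        unfolding D_eq[OF that, abs_def] by (intro square_integrable_linear[OF J_square_integrable] linear_flow)
      then have "(\<integral>\<^sup>+\<omega>. ennreal ((norm (D n \<omega>))\<^sup>2) \<partial>M) = ennreal (expectation (\<lambda>\<omega>. (norm (D n \<omega>))\<^sup>2))"
        unfolding square_integrable_def by (intro nn_integral_eq_integral) auto
      then show ?thesis unfolding D_eq[OF that] using JK[OF L that] by (simp add: ennreal_leI)
    qed
    have "(\<integral>\<^sup>+\<omega>. ennreal ((norm (flow A L (Xc (t - L) \<omega>) - flow A t (\<eta> \<omega>)))\<^sup>2) \<partial>M)
        = (\<integral>\<^sup>+\<omega>. liminf (\<lambda>n. ennreal ((norm (D n \<omega>))\<^sup>2)) \<partial>M)"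
    proof (rule nn_integral_cong_AE)
      show "AE \<omega> in M. ennreal ((norm (flow A L (Xc (t - L) \<omega>) - flow A t (\<eta> \<omega>)))\<^sup>2) = liminf (\<lambda>n. ennreal ((norm (D n \<omega>))\<^sup>2))"
        using AE_lim_\<eta>
      proof eventually_elim
        case (elim \<omega>)
        have "(\<lambda>n. ennreal ((norm (D n \<omega>))\<^sup>2)) \<longlonglongrightarrow> ennreal ((norm (flow A L (Xc (t - L) \<omega>) - flow A t (\<eta> \<omega>)))\<^sup>2)"
          unfolding D_def
          by (intro tendsto_ennrealI tendsto_intros bounded_linear.tendsto[OF bounded_linear_flow elim])
        then show ?case using lim_imp_Liminf[OF sequentially_bot] by metis
      qed
    qed
    also have "\<dots> \<le> liminf (\<lambda>n. \<integral>\<^sup>+\<omega>. ennreal ((norm (D n \<omega>))\<^sup>2) \<partial>M)"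
      by (rule nn_integral_liminf) measurable
    also have "\<dots> \<le> ennreal (K * exp (- \<alpha> * L))"
    proof (rule Liminf_le)
      obtain N :: nat where "L - t \<le> real N" using real_arch_simple by blast
      then have "- real n \<le> t - L" if "n \<ge> N" for n using that by linarith
      then show "eventually (\<lambda>n. (\<integral>\<^sup>+\<omega>. ennreal ((norm (D n \<omega>))\<^sup>2) \<partial>M) \<le> ennreal (K * exp (- \<alpha> * L))) sequentially"
        using D_le unfolding eventually_sequentially by blast
    qed simp
    finally show ?thesis .
  qed
  have sq: "square_integrable M (\<lambda>\<omega>. flow A L (Xc (t - L) \<omega>) - flow A t (\<eta> \<omega>))" if "L \<ge> 0" for t L
    unfolding square_integrable_def
  proof
    show "integrable M (\<lambda>\<omega>. (norm (flow A L (Xc (t - L) \<omega>) - flow A t (\<eta> \<omega>)))\<^sup>2)"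
    proof (rule integrableI_bounded)
      have "(\<integral>\<^sup>+\<omega>. ennreal (norm ((norm (flow A L (Xc (t - L) \<omega>) - flow A t (\<eta> \<omega>)))\<^sup>2)) \<partial>M) \<le> ennreal (K * exp (- \<alpha> * L))"
        using nn[OF that, of t] by simp
      also have "\<dots> < \<infinity>" by simp
      finally show "(\<integral>\<^sup>+\<omega>. ennreal (norm ((norm (flow A L (Xc (t - L) \<omega>) - flow A t (\<eta> \<omega>)))\<^sup>2)) \<partial>M) < \<infinity>" .
    qed measurable
  qed measurable
  show ?thesis
  proof (rule that[OF K decay sq])
    fix t L :: real assume L: "L \<ge> 0"
    have "(\<integral>\<^sup>+\<omega>. ennreal ((norm (flow A L (Xc (t - L) \<omega>) - flow A t (\<eta> \<omega>)))\<^sup>2) \<partial>M)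
        = ennreal (expectation (\<lambda>\<omega>. (norm (flow A L (Xc (t - L) \<omega>) - flow A t (\<eta> \<omega>)))\<^sup>2))"
      using sq[OF L, of t] unfolding square_integrable_def by (intro nn_integral_eq_integral) simp_all
    then have "ennreal (expectation (\<lambda>\<omega>. (norm (flow A L (Xc (t - L) \<omega>) - flow A t (\<eta> \<omega>)))\<^sup>2)) \<le> ennreal (K * exp (- \<alpha> * L))"
      using nn[OF L, of t] by (simp only:)
    then show "expectation (\<lambda>\<omega>. (norm (flow A L (Xc (t - L) \<omega>) - flow A t (\<eta> \<omega>)))\<^sup>2) \<le> K * exp (- \<alpha> * L)"
      using K by (simp add: ennreal_le_iff)
  qed
qed

text \<open>The case \<open>L = 0\<close> of the previous bound compares
  \<open>flow A t (\<eta> \<omega>)\<close> with the centred solution at time \<open>t\<close>,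
  whose moments are bounded. It matters that \<open>t\<close> runs through the whole real
  line.\<close>

lemma flow_\<eta>_moment:
  shows "square_integrable M (\<lambda>\<omega>. flow A t (\<eta> \<omega>))"
    and "\<exists>K. \<forall>t. expectation (\<lambda>\<omega>. (norm (flow A t (\<eta> \<omega>)))\<^sup>2) \<le> K"
proof -
  obtain K \<alpha> where "K > 0" "\<alpha> > 0"
    "\<And>j u r. u \<ge> 0 \<Longrightarrow> norm (flow A u (column j (g r))) \<le> K * exp (- \<alpha> * u)"
    and sq0: "\<And>t L. L \<ge> 0 \<Longrightarrow> square_integrable M (\<lambda>\<omega>. flow A L (Xc (t - L) \<omega>) - flow A t (\<eta> \<omega>))"
    and le0: "\<And>t L. L \<ge> 0 \<Longrightarrow> expectation (\<lambda>\<omega>. (norm (flow A L (Xc (t - L) \<omega>) - flow A t (\<eta> \<omega>)))\<^sup>2) \<le> K * exp (- \<alpha> * L)"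
    by (rule Xc_eta_bound) (rule that)
  have sq': "square_integrable M (\<lambda>\<omega>. Xc t \<omega> - flow A t (\<eta> \<omega>))" for t using sq0[of 0 t] by simp
  have le': "expectation (\<lambda>\<omega>. (norm (Xc t \<omega> - flow A t (\<eta> \<omega>)))\<^sup>2) \<le> K" for t using le0[of 0 t] by simp
  have neg: "square_integrable M (\<lambda>\<omega>. - (Xc t \<omega> - flow A t (\<eta> \<omega>)))" for t
    by (rule square_integrable_linear[OF sq', of uminus]) (simp add: linear_iff)
  show sq: "square_integrable M (\<lambda>\<omega>. flow A t (\<eta> \<omega>))" for t
    using square_integrable_add[OF Xc_square_integrable neg, of t t] by simp
  have "expectation (\<lambda>\<omega>. (norm (flow A t (\<eta> \<omega>)))\<^sup>2) \<le> 2 * (4 * moment) + 2 * K" for t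
  proof -
    have "expectation (\<lambda>\<omega>. (norm (flow A t (\<eta> \<omega>)))\<^sup>2)
        \<le> expectation (\<lambda>\<omega>. 2 * (norm (Xc t \<omega>))\<^sup>2 + 2 * (norm (Xc t \<omega> - flow A t (\<eta> \<omega>)))\<^sup>2)"
    proof (rule integral_mono)
      show "(norm (flow A t (\<eta> \<omega>)))\<^sup>2 \<le> 2 * (norm (Xc t \<omega>))\<^sup>2 + 2 * (norm (Xc t \<omega> - flow A t (\<eta> \<omega>)))\<^sup>2" for \<omega>
        using norm_sum_sq_le[of "Xc t \<omega>" "- (Xc t \<omega> - flow A t (\<eta> \<omega>))"] by (simp add: norm_minus_commute)
    qed (use sq sq' Xc_square_integrable in \<open>auto simp: square_integrable_def\<close>)
    also have "\<dots> = 2 * expectation (\<lambda>\<omega>. (norm (Xc t \<omega>))\<^sup>2) + 2 * expectation (\<lambda>\<omega>. (norm (Xc t \<omega> - flow A t (\<eta> \<omega>)))\<^sup>2)"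
      using sq' Xc_square_integrable by (simp add: square_integrable_def)
    also have "\<dots> \<le> 2 * (4 * moment) + 2 * K" by (intro add_mono mult_left_mono Xc_moment le') auto
    finally show ?thesis .
  qed
  then show "\<exists>K. \<forall>t. expectation (\<lambda>\<omega>. (norm (flow A t (\<eta> \<omega>)))\<^sup>2) \<le> K" by blast
qed

lemma \<eta>_square_integrable: "square_integrable M \<eta>"
  using flow_\<eta>_moment(1)[of 0] by simp

text \<open>The range of the covariance matrix of \<open>\<eta>\<close> consists of vectors with bounded orbits, and
  \<open>\<eta>\<close> almost surely lies in this range.\<close>

lemma \<eta>_in_bounded_orbits:
  obtains P :: "real^'d \<Rightarrow> real^'d" where "linear P" "\<And>v. bounded (range (\<lambda>t. flow A t (P v)))"
    "AE \<omega> in M. \<eta> \<omega> = P (\<eta> \<omega>)"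
proof -
  define B where "B = {v. bounded (range (\<lambda>t. flow A t v))}"
  have sub: "subspace B"
  proof (rule subspaceI)
    show "0 \<in> B" by (simp add: B_def linear_0[OF linear_flow])
    show "x + y \<in> B" if "x \<in> B" "y \<in> B" for x y
      using bounded_plus_comp[of "\<lambda>t. flow A t x" UNIV "\<lambda>t. flow A t y"] that
      by (simp add: B_def linear_add[OF linear_flow])
    show "c *\<^sub>R x \<in> B" if "x \<in> B" for c x
      using bounded_scaleR_comp[of "\<lambda>t. flow A t x" UNIV c] that
      by (simp add: B_def linear_cmul[OF linear_flow])
  qed
  obtain K where K: "\<And>t. expectation (\<lambda>\<omega>. (norm (flow A t (\<eta> \<omega>)))\<^sup>2) \<le> K"
    using flow_\<eta>_moment(2) by blast
  have sq_in: "square_integrable M (\<lambda>\<omega>. \<theta> \<bullet> \<eta> \<omega>)" for \<theta>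
    by (rule square_integrable_linear[OF \<eta>_square_integrable]) (simp add: bounded_linear.linear bounded_linear_inner_right)
  define cov where "cov \<theta> = expectation (\<lambda>\<omega>. (\<theta> \<bullet> \<eta> \<omega>) *\<^sub>R \<eta> \<omega>)" for \<theta>
  have young: "\<bar>\<theta> \<bullet> \<eta> \<omega>\<bar> * norm (flow A t (\<eta> \<omega>)) \<le> (\<theta> \<bullet> \<eta> \<omega>)\<^sup>2 + (norm (flow A t (\<eta> \<omega>)))\<^sup>2" for \<theta> t \<omega>
  proof -
    have "2 * (\<bar>\<theta> \<bullet> \<eta> \<omega>\<bar> * norm (flow A t (\<eta> \<omega>))) \<le> \<bar>\<theta> \<bullet> \<eta> \<omega>\<bar>\<^sup>2 + (norm (flow A t (\<eta> \<omega>)))\<^sup>2"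
      using zero_le_power2[of "\<bar>\<theta> \<bullet> \<eta> \<omega>\<bar> - norm (flow A t (\<eta> \<omega>))"] by (simp add: power2_diff)
    moreover have "0 \<le> \<bar>\<theta> \<bullet> \<eta> \<omega>\<bar> * norm (flow A t (\<eta> \<omega>))" by simp
    ultimately show ?thesis unfolding power2_abs by linarith
  qed
  have isum: "integrable M (\<lambda>\<omega>. (\<theta> \<bullet> \<eta> \<omega>)\<^sup>2 + (norm (flow A t (\<eta> \<omega>)))\<^sup>2)" for \<theta> t
    using sq_in flow_\<eta>_moment(1) by (auto simp: square_integrable_def)
  have iflow: "integrable M (\<lambda>\<omega>. (\<theta> \<bullet> \<eta> \<omega>) *\<^sub>R flow A t (\<eta> \<omega>))" for \<theta> t
    by (rule Bochner_Integration.integrable_bound[OF isum[of \<theta> t]]) (auto intro!: AE_I2 order_trans[OF young])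
  have cov_B: "cov \<theta> \<in> B" for \<theta>
  proof -
    have "norm (flow A t (cov \<theta>)) \<le> expectation (\<lambda>\<omega>. (\<theta> \<bullet> \<eta> \<omega>)\<^sup>2) + K" for t
    proof -
      have "flow A t (cov \<theta>) = expectation (\<lambda>\<omega>. flow A t ((\<theta> \<bullet> \<eta> \<omega>) *\<^sub>R \<eta> \<omega>))"
        unfolding cov_def using iflow[of \<theta> 0]
        by (intro integral_bounded_linear[symmetric] bounded_linear_flow) simp
      also have "\<dots> = expectation (\<lambda>\<omega>. (\<theta> \<bullet> \<eta> \<omega>) *\<^sub>R flow A t (\<eta> \<omega>))"
        by (simp add: linear_cmul[OF linear_flow])
      also have "norm \<dots> \<le> expectation (\<lambda>\<omega>. norm ((\<theta> \<bullet> \<eta> \<omega>) *\<^sub>R flow A t (\<eta> \<omega>)))" by (rule integral_norm_bound)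
      also have "\<dots> \<le> expectation (\<lambda>\<omega>. (\<theta> \<bullet> \<eta> \<omega>)\<^sup>2 + (norm (flow A t (\<eta> \<omega>)))\<^sup>2)"
        using young by (intro integral_mono integrable_norm iflow isum) simp
      also have "\<dots> = expectation (\<lambda>\<omega>. (\<theta> \<bullet> \<eta> \<omega>)\<^sup>2) + expectation (\<lambda>\<omega>. (norm (flow A t (\<eta> \<omega>)))\<^sup>2)"
        using sq_in flow_\<eta>_moment(1) by (simp add: square_integrable_def)
      also have "\<dots> \<le> expectation (\<lambda>\<omega>. (\<theta> \<bullet> \<eta> \<omega>)\<^sup>2) + K" using K by simp
      finally show ?thesis .
    qed
    then show ?thesis unfolding B_def bounded_iff by blast
  qed
  \<comment> \<open>The second moment of \<open>\<theta> \<bullet> \<eta>\<close> equals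
    \<open>\<theta> \<bullet> cov \<theta>\<close>, and \<open>cov \<theta>\<close> has a bounded
    orbit.\<close>
  have orth: "AE \<omega> in M. \<theta> \<bullet> \<eta> \<omega> = 0" if "\<And>b. b \<in> B \<Longrightarrow> \<theta> \<bullet> b = 0" for \<theta>
  proof -
    have "expectation (\<lambda>\<omega>. (\<theta> \<bullet> \<eta> \<omega>)\<^sup>2) = expectation (\<lambda>\<omega>. \<theta> \<bullet> ((\<theta> \<bullet> \<eta> \<omega>) *\<^sub>R \<eta> \<omega>))"
      by (simp add: power2_eq_square)
    also have "\<dots> = \<theta> \<bullet> cov \<theta>"
      unfolding cov_def using iflow[of \<theta> 0] by (intro integral_inner_right) simp
    also have "\<dots> = 0" by (rule that[OF cov_B])
    finally have "AE \<omega> in M. (\<theta> \<bullet> \<eta> \<omega>)\<^sup>2 = 0"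
      using sq_in by (subst (asm) integral_nonneg_eq_0_iff_AE) (auto simp: square_integrable_def)
    then show ?thesis by simp
  qed
  obtain S where S: "S \<subseteq> B" "pairwise orthogonal S" "\<And>x. x \<in> S \<Longrightarrow> norm x = 1" "independent S" "span S = B"
    using orthonormal_basis_subspace[OF sub] by metis
  have fin: "finite S" using S(4) by (rule independent_imp_finite)
  \<comment> \<open>The orthogonal projection onto the space of vectors with bounded orbits.\<close>
  define P where "P v = (\<Sum>b\<in>S. (b \<bullet> v) *\<^sub>R b)" for v
  have P_lin: "linear P"
    unfolding P_def by (intro linear_compose_sum ballI) (auto intro!: linearI simp: inner_add_right scaleR_add_left)
  have P_B: "P v \<in> B" for v
    unfolding P_def using S(1) by (intro subspace_sum[OF sub] subspace_scale[OF sub]) auto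
  have P_b: "b \<bullet> (v - P v) = 0" if "b \<in> S" for b v
  proof -
    have "b \<bullet> P v = (\<Sum>c\<in>S. (c \<bullet> v) * (b \<bullet> c))" by (simp add: P_def inner_sum_right)
    also have "\<dots> = (\<Sum>c\<in>S. if c = b then b \<bullet> v else 0)"
    proof (rule sum.cong)
      fix c assume "c \<in> S"
      then show "(c \<bullet> v) * (b \<bullet> c) = (if c = b then b \<bullet> v else 0)"
        using S(2,3) that by (auto simp: pairwise_def orthogonal_def dot_square_norm)
    qed simp
    finally show ?thesis using fin that by (simp add: inner_diff_right)
  qed
  have P_self: "x \<bullet> P y = P x \<bullet> y" for x y
    by (simp add: P_def inner_sum_right inner_sum_left mult.commute inner_commute)
  have P_orth: "(v - P v) \<bullet> b = 0" if "b \<in> B" for v b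
  proof -
    have "orthogonal (v - P v) b"
      using that P_b unfolding S(5)[symmetric]
      by (intro orthogonal_to_span[of b S]) (auto simp: orthogonal_def inner_commute)
    then show ?thesis by (simp add: orthogonal_def)
  qed
  have "AE \<omega> in M. \<forall>i\<in>UNIV. (axis i 1 - P (axis i 1)) \<bullet> \<eta> \<omega> = 0"
    by (intro AE_finite_allI orth P_orth) auto
  then have "AE \<omega> in M. \<eta> \<omega> = P (\<eta> \<omega>)"
  proof eventually_elim
    case (elim \<omega>)
    have "\<eta> \<omega> $ i = P (\<eta> \<omega>) $ i" for i
    proof -
      have "axis i 1 \<bullet> \<eta> \<omega> = axis i 1 \<bullet> P (\<eta> \<omega>)" using elim by (simp add: inner_diff_left P_self)
      then show ?thesis by (simp add: inner_axis')
    qed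
    then show ?case by (simp add: vec_eq_iff)
  qed
  then show ?thesis using that[OF P_lin] P_B by (simp add: B_def)
qed

end

section \<open>Almost periodicity of the characteristic functions\<close>

lemma norm_triple_product_diff_le:
  fixes a b c a' b' c' :: complex
  assumes "norm a \<le> 1" "norm b \<le> 1" "norm c \<le> 1" "norm a' \<le> 1" "norm b' \<le> 1" "norm c' \<le> 1"
  shows "norm (a * b * c - a' * b' * c') \<le> norm (a - a') + norm (b - b') + norm (c - c')"
proof -
  have "a * b * c - a' * b' * c' = (a - a') * (b * c) + ((b - b') * (a' * c) + (c - c') * (a' * b'))"
    by (simp add: algebra_simps)
  also have "norm \<dots> \<le> norm (a - a') * 1 + (norm (b - b') * 1 + norm (c - c') * 1)"
    using assms
    by (intro norm_triangle_mono) (auto simp: norm_mult intro!: mult_left_le mult_le_one)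
  finally show ?thesis by simp
qed

lemma exp_minus_diff_le:
  fixes x y :: real
  assumes "0 \<le> x" "0 \<le> y"
  shows "\<bar>exp (- x) - exp (- y)\<bar> \<le> \<bar>x - y\<bar>"
proof -
  have le: "\<bar>exp (- x) - exp (- y)\<bar> \<le> y - x" if "0 \<le> x" "x \<le> y" for x y :: real
  proof -
    have "exp (- x) - exp (- y) = exp (- x) * (1 - exp (- (y - x)))"
      by (simp add: right_diff_distrib exp_add[symmetric])
    also have "\<dots> \<le> 1 * (y - x)"
    proof (intro mult_mono)
      show "1 - exp (- (y - x)) \<le> y - x"
        using exp_ge_add_one_self[of "x - y"] unfolding minus_diff_eq by linarith
    qed (use that in auto)
    finally show ?thesis using that by simp
  qed
  show ?thesis
    using le[of x y] le[of y x] assms by (cases "x \<le> y") (auto simp: abs_minus_commute)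
qed

lemma norm_column_le: "norm (column j B) \<le> norm (B :: real^'m^'d)"
proof -
  have "norm (column j B) = L2_set (\<lambda>i. norm (B $ i $ j)) UNIV"
    by (simp add: norm_vec_def column_def)
  also have "\<dots> \<le> L2_set (\<lambda>i. norm (B $ i)) UNIV"
    by (intro L2_set_mono) (auto intro: component_le_norm_cart)
  also have "\<dots> = norm B" by (simp only: norm_vec_def[of B])
  finally show ?thesis .
qed

lemma periods_mono: "d \<le> d' \<Longrightarrow> periods h d \<subseteq> periods h d'"
  by (auto simp: periods_def intro: order_trans)

context L2_bounded_solution
begin

definition char_fun :: "real^'d \<Rightarrow> real \<Rightarrow> complex" where
  "char_fun \<theta> t = expectation (\<lambda>\<omega>. cis (\<theta> \<bullet> X t \<omega>))"

text \<open>The split is at time \<open>t - L\<close>: the propagated centred state belongs to the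
  past, the noise since then gives the Gaussian factor, and the mean carries all of the forcing.
  \<open>L\<close> is chosen later, independently of \<open>t\<close>.\<close>

lemma char_fun_factorization:
  assumes "L \<ge> 0"
  shows "char_fun \<theta> t = cis (\<theta> \<bullet> m t) * expectation (\<lambda>\<omega>. cis (\<theta> \<bullet> flow A L (Xc (t - L) \<omega>)))
    * of_real (exp (- (energy A g \<theta> t L / 2)))"
proof -
  define Z where "Z \<omega> = cis (\<theta> \<bullet> flow A L (Xc (t - L) \<omega>))" for \<omega>
  have Z_meas: "Z \<in> borel_measurable (F (t - L))"
  proof -
    note [measurable] = X_F_measurable[of "t - L"]
    have "Xc (t - L) \<in> borel_measurable (F (t - L))" unfolding Xc_def by measurable
    then have [measurable]: "(\<lambda>\<omega>. flow A L (Xc (t - L) \<omega>)) \<in> borel_measurable (F (t - L))"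
      by (rule borel_measurable_continuous_on[OF linear_continuous_on[OF bounded_linear_flow]])
    show ?thesis unfolding Z_def by measurable
  qed
  have split: "cis (\<theta> \<bullet> X t \<omega>) = cis (\<theta> \<bullet> m t) * (Z \<omega> * cis (\<theta> \<bullet> J (t - L) t \<omega>))" for \<omega>
    using assms by (subst J_Xc) (simp_all add: Z_def cis_mult Xc_def inner_diff_right)
  have "expectation (\<lambda>\<omega>. Z \<omega> * cis (\<theta> \<bullet> J (t - L) t \<omega>)) = expectation Z * of_real (exp (- energy A g \<theta> t (t - (t - L)) / 2))"
    by (rule weak_solution_mild_noise_cis[OF solution cont_f cont_g _ Z_meas]) (use assms in \<open>auto simp: Z_def\<close>)
  then show ?thesis unfolding char_fun_def split by (simp add: Z_def[abs_def])
qed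

text \<open>In each difference of squares the sum is bounded by the decay constant \<open>K\<close>,
  the difference by the crude growth of the flow over \<open>[0, L]\<close>. The growth is harmless
  because \<open>L\<close> is fixed before \<sigma>.\<close>

lemma energy_diff_le:
  assumes L: "L \<ge> 0" and K: "\<And>j u r. u \<ge> 0 \<Longrightarrow> norm (flow A u (column j (g r))) \<le> K"
    and d: "\<And>r. norm (g (r + \<sigma>) - g r) \<le> d"
  shows "\<bar>energy A g \<theta> (t + \<sigma>) L - energy A g \<theta> t L\<bar>
    \<le> 2 * (real CARD('m) * (norm \<theta> * K) * (norm \<theta> * exp (L * norm (endo_of_matrix A)))) * d * L"
proof -
  let ?h = "\<lambda>t u. \<Sum>j\<in>UNIV. (\<theta> \<bullet> flow A u (column j (g (t - u))))\<^sup>2"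
  let ?a = "exp (L * norm (endo_of_matrix A))"
  have "\<bar>energy A g \<theta> (t + \<sigma>) L - energy A g \<theta> t L\<bar> = norm (integral {0..L} (\<lambda>u. ?h (t + \<sigma>) u - ?h t u))"
    unfolding energy_def
    by (subst Henstock_Kurzweil_Integration.integral_diff) (auto intro!: energy_integrand_integrable cont_g)
  also have "\<dots> \<le> real CARD('m) * ((norm \<theta> * ?a * d) * (2 * (norm \<theta> * K))) * (L - 0)"
  proof (rule integral_bound)
    show "continuous_on {0..L} (\<lambda>u. ?h (t + \<sigma>) u - ?h t u)"
      by (intro continuous_intros continuous_on_compose2[OF cont_g]) auto
    fix u assume u: "u \<in> {0..L}"
    have "\<bar>(\<theta> \<bullet> flow A u (column j (g (t + \<sigma> - u))))\<^sup>2 - (\<theta> \<bullet> flow A u (column j (g (t - u))))\<^sup>2\<bar>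
        \<le> (norm \<theta> * ?a * d) * (2 * (norm \<theta> * K))" for j
    proof -
      define x where "x = flow A u (column j (g (t + \<sigma> - u)))"
      define y where "y = flow A u (column j (g (t - u)))"
      have sum: "\<bar>\<theta> \<bullet> x + \<theta> \<bullet> y\<bar> \<le> 2 * (norm \<theta> * K)"
      proof -
        have "\<bar>\<theta> \<bullet> x\<bar> \<le> norm \<theta> * K" "\<bar>\<theta> \<bullet> y\<bar> \<le> norm \<theta> * K"
          using u by (auto simp: x_def y_def intro!: order_trans[OF Cauchy_Schwarz_ineq2] mult_left_mono K)
        then show ?thesis by linarith
      qed
      have "x - y = flow A u (column j (g ((t - u) + \<sigma>) - g (t - u)))"
      proof -
        have "column j (g (t + \<sigma> - u)) - column j (g (t - u)) = column j (g ((t - u) + \<sigma>) - g (t - u))"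
          by (simp add: column_def vec_eq_iff algebra_simps)
        then show ?thesis by (simp add: x_def y_def linear_diff[OF linear_flow, symmetric])
      qed
      then have "norm (x - y) \<le> exp (\<bar>u\<bar> * norm (endo_of_matrix A)) * norm (column j (g ((t - u) + \<sigma>) - g (t - u)))"
        by (simp only: norm_flow)
      also have "\<dots> \<le> ?a * d"
        using u by (intro mult_mono order_trans[OF norm_column_le d]) (auto intro!: mult_right_mono)
      finally have "norm \<theta> * norm (x - y) \<le> norm \<theta> * ?a * d" by (simp add: mult.assoc mult_left_mono)
      then have diff: "\<bar>\<theta> \<bullet> x - \<theta> \<bullet> y\<bar> \<le> norm \<theta> * ?a * d"
        using Cauchy_Schwarz_ineq2[of \<theta> "x - y"] by (simp add: inner_diff_right)
      have "(\<theta> \<bullet> x)\<^sup>2 - (\<theta> \<bullet> y)\<^sup>2 = (\<theta> \<bullet> x - \<theta> \<bullet> y) * (\<theta> \<bullet> x + \<theta> \<bullet> y)"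
        by (simp add: power2_eq_square algebra_simps)
      then have "\<bar>(\<theta> \<bullet> x)\<^sup>2 - (\<theta> \<bullet> y)\<^sup>2\<bar> = \<bar>\<theta> \<bullet> x - \<theta> \<bullet> y\<bar> * \<bar>\<theta> \<bullet> x + \<theta> \<bullet> y\<bar>"
        by (simp only: abs_mult)
      also have "\<dots> \<le> (norm \<theta> * ?a * d) * (2 * (norm \<theta> * K))"
        using diff order_trans[OF abs_ge_zero diff] by (intro mult_mono sum) auto
      finally show ?thesis by (simp add: x_def y_def)
    qed
    then have "(\<Sum>j\<in>UNIV. \<bar>(\<theta> \<bullet> flow A u (column j (g (t + \<sigma> - u))))\<^sup>2 - (\<theta> \<bullet> flow A u (column j (g (t - u))))\<^sup>2\<bar>)
        \<le> real CARD('m) * ((norm \<theta> * ?a * d) * (2 * (norm \<theta> * K)))"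
      by (intro sum_bounded_above)
    then show "norm (?h (t + \<sigma>) u - ?h t u) \<le> real CARD('m) * ((norm \<theta> * ?a * d) * (2 * (norm \<theta> * K)))"
      unfolding sum_subtractf[symmetric] real_norm_def by (rule order_trans[OF sum_abs])
  qed (rule L)
  finally show ?thesis by (simp add: mult_ac)
qed

text \<open>\<open>H\<close> collects everything on which the law of \<open>X t\<close> depends almost periodically; a common
  \<open>H\<close> for all \<open>\<theta>\<close> is needed because almost periods of different functions need not coincide.\<close>

lemma char_fun_control:
  obtains H :: "real \<Rightarrow> (real^'m^'d) \<times> (real^'d) \<times> ((real^'d)^'d)" where "bochner_ap H"
    "\<And>\<theta> e. e > 0 \<Longrightarrow> \<exists>d>0. \<forall>\<sigma>\<in>periods H d. \<forall>t. norm (char_fun \<theta> (t + \<sigma>) - char_fun \<theta> t) \<le> e"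
proof -
  obtain P where P: "linear P" "\<And>v. bounded (range (\<lambda>t. flow A t (P v)))" "AE \<omega> in M. \<eta> \<omega> = P (\<eta> \<omega>)"
    using \<eta>_in_bounded_orbits by blast
  \<comment> \<open>By linearity the orbits of the projected basis vectors determine
    \<open>flow A t \<circ> P\<close>; they are bounded solutions of the homogeneous equation, hence
    almost periodic.\<close>
  define R :: "real \<Rightarrow> (real^'d)^'d" where "R t = (\<chi> i. flow A t (P (axis i 1)))" for t
  have ap_R: "bochner_ap R"
  proof (rule bochner_ap_vec)
    fix i
    have "bochner_ap (\<lambda>t. flow A t (P (axis i 1)))"
    proof (rule bochner_ap_bounded_ode_solution)
      show "((\<lambda>t. flow A t (P (axis i 1))) has_vector_derivative A *v flow A t (P (axis i 1)) + 0) (at t)" for t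
        using has_vector_derivative_flow[of A "P (axis i 1)" t UNIV] by simp
      show "bochner_ap (\<lambda>_. 0 :: real^'d)"
        using bochner_ap_bounded_linear[OF ap_f, of "\<lambda>_. 0 :: real^'d"] by simp
    qed (rule P(2))
    then show "bochner_ap (\<lambda>t. R t $ i)" by (simp add: R_def)
  qed
  have flow_P: "flow A t (P v) = (\<Sum>i\<in>UNIV. v $ i *\<^sub>R R t $ i)" for t v
  proof -
    have "v = (\<Sum>i\<in>UNIV. v $ i *\<^sub>R axis i 1)"
      using basis_expansion[of v] by (simp add: scalar_mult_eq_scaleR)
    then have "flow A t (P v) = flow A t (P (\<Sum>i\<in>UNIV. v $ i *\<^sub>R axis i 1))" by simp
    also have "\<dots> = (\<Sum>i\<in>UNIV. v $ i *\<^sub>R R t $ i)"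
      by (simp add: linear_sum[OF P(1)] linear_sum[OF linear_flow] linear_cmul[OF P(1)] linear_cmul[OF linear_flow] R_def)
    finally show ?thesis .
  qed
  obtain K \<alpha> where K: "K > 0" "\<alpha> > 0"
    and decay: "\<And>j u r. u \<ge> 0 \<Longrightarrow> norm (flow A u (column j (g r))) \<le> K * exp (- \<alpha> * u)"
    and sq: "\<And>t L. L \<ge> 0 \<Longrightarrow> square_integrable M (\<lambda>\<omega>. flow A L (Xc (t - L) \<omega>) - flow A t (\<eta> \<omega>))"
    and close: "\<And>t L. L \<ge> 0 \<Longrightarrow> expectation (\<lambda>\<omega>. (norm (flow A L (Xc (t - L) \<omega>) - flow A t (\<eta> \<omega>)))\<^sup>2) \<le> K * exp (- \<alpha> * L)"
    by (rule Xc_eta_bound) (rule that)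
  have decay': "norm (flow A u (column j (g r))) \<le> K" if "u \<ge> 0" for j u r
  proof -
    have "K * exp (- \<alpha> * u) \<le> K * 1" using K that by (intro mult_left_mono) auto
    then show ?thesis using decay[OF that, of j r] by simp
  qed
  define H where "H t = (g t, m t, R t)" for t
  have ap_H: "bochner_ap H"
    unfolding H_def by (intro bochner_ap_Pair ap_g ap_m ap_R)
  have periods_H: "norm (g (t + \<sigma>) - g t) \<le> d" "norm (m (t + \<sigma>) - m t) \<le> d" "norm (R (t + \<sigma>) $ i - R t $ i) \<le> d"
    if "\<sigma> \<in> periods H d" for \<sigma> d t i
  proof -
    note p = periodsD[OF that, of t, unfolded H_def]
    from order_trans[OF dist_fst_le p] show "norm (g (t + \<sigma>) - g t) \<le> d" by (simp add: dist_norm)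
    note q = order_trans[OF dist_snd_le p, simplified]
    from order_trans[OF dist_fst_le q] show "norm (m (t + \<sigma>) - m t) \<le> d" by (simp add: dist_norm)
    from order_trans[OF dist_snd_le q] have "dist (R (t + \<sigma>)) (R t) \<le> d" by simp
    then show "norm (R (t + \<sigma>) $ i - R t $ i) \<le> d"
      using dist_vec_nth_le[of "R (t + \<sigma>)" i "R t"] by (simp add: dist_norm)
  qed
  have i\<eta>: "integrable M (\<lambda>\<omega>. \<bar>\<eta> \<omega> $ i\<bar>)" for i
  proof (rule Bochner_Integration.integrable_bound[OF square_integrable_imp_integrable(2)[OF \<eta>_square_integrable]])
    have "(\<lambda>\<omega>. axis i 1 \<bullet> \<eta> \<omega>) \<in> borel_measurable M" by measurable
    then show "(\<lambda>\<omega>. \<bar>\<eta> \<omega> $ i\<bar>) \<in> borel_measurable M" by (simp add: inner_axis')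
  qed (simp add: component_le_norm_cart)
  define S where "S = (\<Sum>i\<in>UNIV. expectation (\<lambda>\<omega>. \<bar>\<eta> \<omega> $ i\<bar>))"
  have S: "S \<ge> 0" unfolding S_def by (intro sum_nonneg integral_nonneg_AE) auto
  have ic: "integrable M (\<lambda>\<omega>. cis (h \<omega>))" if "h \<in> borel_measurable M" for h
    by (rule integrable_bounded[OF finite_measure_axioms, of _ 1]) (use that in auto)
  have cis_diff: "norm (expectation (\<lambda>\<omega>. cis (\<theta> \<bullet> Y \<omega>)) - expectation (\<lambda>\<omega>. cis (\<theta> \<bullet> Y' \<omega>)))
      \<le> norm \<theta> * expectation (\<lambda>\<omega>. norm (Y \<omega> - Y' \<omega>))"
    if [measurable]: "Y \<in> borel_measurable M" "Y' \<in> borel_measurable M" and i: "integrable M (\<lambda>\<omega>. norm (Y \<omega> - Y' \<omega>))"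
    for \<theta> and Y Y' :: "'w \<Rightarrow> real^'d"
  proof -
    have i1: "integrable M (\<lambda>\<omega>. cis (\<theta> \<bullet> Y \<omega>))" and i2: "integrable M (\<lambda>\<omega>. cis (\<theta> \<bullet> Y' \<omega>))"
      by (rule ic, measurable)+
    have "norm (expectation (\<lambda>\<omega>. cis (\<theta> \<bullet> Y \<omega>)) - expectation (\<lambda>\<omega>. cis (\<theta> \<bullet> Y' \<omega>)))
        = norm (expectation (\<lambda>\<omega>. cis (\<theta> \<bullet> Y \<omega>) - cis (\<theta> \<bullet> Y' \<omega>)))" using i1 i2 by simp
    also have "\<dots> \<le> expectation (\<lambda>\<omega>. norm (cis (\<theta> \<bullet> Y \<omega>) - cis (\<theta> \<bullet> Y' \<omega>)))" by (rule integral_norm_bound)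
    also have "\<dots> \<le> expectation (\<lambda>\<omega>. norm \<theta> * norm (Y \<omega> - Y' \<omega>))"
    proof (rule integral_mono)
      show "norm (cis (\<theta> \<bullet> Y \<omega>) - cis (\<theta> \<bullet> Y' \<omega>)) \<le> norm \<theta> * norm (Y \<omega> - Y' \<omega>)" for \<omega>
        using norm_cis_diff_le[of "\<theta> \<bullet> Y \<omega>" "\<theta> \<bullet> Y' \<omega>"] Cauchy_Schwarz_ineq2[of \<theta> "Y \<omega> - Y' \<omega>"]
        by (simp add: inner_diff_right)
    qed (use i1 i2 i in auto)
    finally show ?thesis by simp
  qed
  have one: "norm (expectation (\<lambda>\<omega>. cis (h \<omega>))) \<le> 1" for h
    using integral_norm_bound[of M "\<lambda>\<omega>. cis (h \<omega>)"] by (simp add: prob_space)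
  show ?thesis
  proof (rule that[OF ap_H])
    fix \<theta> :: "real^'d" and e :: real assume "e > 0"
    have "(\<lambda>n. norm \<theta> * sqrt (K * exp (- \<alpha> * real n))) \<longlonglongrightarrow> norm \<theta> * sqrt (K * 0)"
    proof (intro tendsto_intros)
      show "(\<lambda>n. exp (- \<alpha> * real n)) \<longlonglongrightarrow> 0" using K by real_asymp
    qed
    then have "eventually (\<lambda>n. norm \<theta> * sqrt (K * exp (- \<alpha> * real n)) < e / 8) sequentially"
      using \<open>e > 0\<close> by (intro order_tendstoD(2)) auto
    then obtain n where n: "norm \<theta> * sqrt (K * exp (- \<alpha> * real n)) < e / 8"
      unfolding eventually_sequentially by blast
    define L where "L = real n"
    have L: "L \<ge> 0" by (simp add: L_def)
    \<comment> \<open>The approximant in which the propagated state is replaced by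
      \<open>flow A t (\<eta> \<omega>)\<close>. \<open>L\<close> is large enough for an error of
      \<open>e / 8\<close> at every \<open>t\<close>.\<close>
    define \<psi> where "\<psi> t = cis (\<theta> \<bullet> m t) * expectation (\<lambda>\<omega>. cis (\<theta> \<bullet> flow A t (\<eta> \<omega>)))
      * of_real (exp (- (energy A g \<theta> t L / 2)))" for t
    have e0: "0 \<le> energy A g \<theta> t L" for t by (rule energy_nonneg[OF cont_g])
    have near: "norm (char_fun \<theta> t - \<psi> t) \<le> e / 8" for t
    proof -
      have "norm (char_fun \<theta> t - \<psi> t) \<le> norm (cis (\<theta> \<bullet> m t) - cis (\<theta> \<bullet> m t))
          + norm (expectation (\<lambda>\<omega>. cis (\<theta> \<bullet> flow A L (Xc (t - L) \<omega>))) - expectation (\<lambda>\<omega>. cis (\<theta> \<bullet> flow A t (\<eta> \<omega>))))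
          + norm (complex_of_real (exp (- (energy A g \<theta> t L / 2))) - of_real (exp (- (energy A g \<theta> t L / 2))))"
        unfolding char_fun_factorization[OF L] \<psi>_def
        by (intro norm_triple_product_diff_le one) (auto simp: e0 simp del: of_real_exp)
      also have "\<dots> = norm (expectation (\<lambda>\<omega>. cis (\<theta> \<bullet> flow A L (Xc (t - L) \<omega>))) - expectation (\<lambda>\<omega>. cis (\<theta> \<bullet> flow A t (\<eta> \<omega>))))"
        by simp
      also have "\<dots> \<le> norm \<theta> * expectation (\<lambda>\<omega>. norm (flow A L (Xc (t - L) \<omega>) - flow A t (\<eta> \<omega>)))"
        by (intro cis_diff square_integrable_imp_integrable(2)[OF sq[OF L]]) measurable
      also have "\<dots> \<le> norm \<theta> * sqrt (K * exp (- \<alpha> * L))"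
        by (intro mult_left_mono order_trans[OF square_integrable_imp_integrable(3)[OF sq[OF L]]]
            real_sqrt_le_mono close L) auto
      finally show ?thesis using n by (simp add: L_def)
    qed
    define C where "C = real CARD('m) * (norm \<theta> * K) * (norm \<theta> * exp (L * norm (endo_of_matrix A))) * L"
    have C: "C \<ge> 0" using K L by (simp add: C_def)
    define q where "q = norm \<theta> + norm \<theta> * S + C + 1"
    have q: "q > 0" "norm \<theta> + norm \<theta> * S + C \<le> q" using C S by (auto simp: q_def intro!: add_nonneg_pos)
    define d where "d = e / (2 * q)"
    have d: "d > 0" "(norm \<theta> + norm \<theta> * S + C) * d \<le> e / 2"
    proof -
      show "d > 0" using q \<open>e > 0\<close> by (simp add: d_def)
      have "(norm \<theta> + norm \<theta> * S + C) * d \<le> q * d" using q \<open>d > 0\<close> by (intro mult_right_mono) auto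
      also have "\<dots> = e / 2" using q by (simp add: d_def)
      finally show "(norm \<theta> + norm \<theta> * S + C) * d \<le> e / 2" .
    qed
    show "\<exists>d>0. \<forall>\<sigma>\<in>periods H d. \<forall>t. norm (char_fun \<theta> (t + \<sigma>) - char_fun \<theta> t) \<le> e"
    proof (intro exI[of _ d] conjI ballI allI)
      fix \<sigma> t assume \<sigma>: "\<sigma> \<in> periods H d"
      note p = periods_H[OF \<sigma>]
      have a: "norm (cis (\<theta> \<bullet> m (t + \<sigma>)) - cis (\<theta> \<bullet> m t)) \<le> norm \<theta> * d"
      proof -
        have "norm (cis (\<theta> \<bullet> m (t + \<sigma>)) - cis (\<theta> \<bullet> m t)) \<le> \<bar>\<theta> \<bullet> (m (t + \<sigma>) - m t)\<bar>"
          using norm_cis_diff_le[of "\<theta> \<bullet> m (t + \<sigma>)" "\<theta> \<bullet> m t"] by (simp add: inner_diff_right)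
        also have "\<dots> \<le> norm \<theta> * norm (m (t + \<sigma>) - m t)" by (rule Cauchy_Schwarz_ineq2)
        also have "\<dots> \<le> norm \<theta> * d" by (intro mult_left_mono p) auto
        finally show ?thesis .
      qed
      \<comment> \<open>For a projected vector the change of the flow is a combination of changes of
        the \<open>R t $ i\<close> with coefficients \<open>\<eta> \<omega> $ i\<close>;
        \<open>S\<close> sums the means of their absolute values.\<close>
      have b: "norm (expectation (\<lambda>\<omega>. cis (\<theta> \<bullet> flow A (t + \<sigma>) (\<eta> \<omega>))) - expectation (\<lambda>\<omega>. cis (\<theta> \<bullet> flow A t (\<eta> \<omega>))))
          \<le> norm \<theta> * (S * d)"
      proof -
        have isum: "integrable M (\<lambda>\<omega>. \<Sum>i\<in>UNIV. \<bar>\<eta> \<omega> $ i\<bar> * d)"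
          using i\<eta> by auto
        have le: "AE \<omega> in M. norm (flow A (t + \<sigma>) (\<eta> \<omega>) - flow A t (\<eta> \<omega>)) \<le> (\<Sum>i\<in>UNIV. \<bar>\<eta> \<omega> $ i\<bar> * d)"
          using P(3)
        proof eventually_elim
          case (elim \<omega>)
          have "flow A (t + \<sigma>) (\<eta> \<omega>) - flow A t (\<eta> \<omega>) = (\<Sum>i\<in>UNIV. \<eta> \<omega> $ i *\<^sub>R (R (t + \<sigma>) $ i - R t $ i))"
            using flow_P[of "t + \<sigma>" "\<eta> \<omega>"] flow_P[of t "\<eta> \<omega>"] elim
            by (simp add: scaleR_diff_right sum_subtractf)
          also have "norm \<dots> \<le> (\<Sum>i\<in>UNIV. \<bar>\<eta> \<omega> $ i\<bar> * d)"
            by (intro sum_norm_le) (auto intro!: mult_left_mono p)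
          finally show ?case .
        qed
        have i: "integrable M (\<lambda>\<omega>. norm (flow A (t + \<sigma>) (\<eta> \<omega>) - flow A t (\<eta> \<omega>)))"
          by (rule Bochner_Integration.integrable_bound[OF isum]) (measurable, use le in \<open>auto intro: order_trans\<close>)
        have "expectation (\<lambda>\<omega>. norm (flow A (t + \<sigma>) (\<eta> \<omega>) - flow A t (\<eta> \<omega>))) \<le> expectation (\<lambda>\<omega>. \<Sum>i\<in>UNIV. \<bar>\<eta> \<omega> $ i\<bar> * d)"
          by (rule integral_mono_AE[OF i isum le])
        also have "\<dots> = S * d" using i\<eta> by (simp add: S_def sum_distrib_right)
        finally show ?thesis
          by (intro order_trans[OF cis_diff[OF _ _ i]] mult_left_mono) auto
      qed
      have c: "norm (complex_of_real (exp (- (energy A g \<theta> (t + \<sigma>) L / 2))) - of_real (exp (- (energy A g \<theta> t L / 2)))) \<le> C * d"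
      proof -
        have "norm (complex_of_real (exp (- (energy A g \<theta> (t + \<sigma>) L / 2))) - of_real (exp (- (energy A g \<theta> t L / 2))))
            = \<bar>exp (- (energy A g \<theta> (t + \<sigma>) L / 2)) - exp (- (energy A g \<theta> t L / 2))\<bar>"
          by (simp only: of_real_diff[symmetric] norm_of_real)
        also have "\<dots> \<le> \<bar>energy A g \<theta> (t + \<sigma>) L / 2 - energy A g \<theta> t L / 2\<bar>"
          using e0 by (intro exp_minus_diff_le) auto
        also have "\<dots> = \<bar>energy A g \<theta> (t + \<sigma>) L - energy A g \<theta> t L\<bar> / 2" by (simp add: diff_divide_distrib[symmetric])
        also have "\<dots> \<le> C * d"
          using energy_diff_le[OF L decay' p(1), of \<theta> t] by (simp add: C_def mult_ac)
        finally show ?thesis .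
      qed
      have "norm (\<psi> (t + \<sigma>) - \<psi> t) \<le> norm (cis (\<theta> \<bullet> m (t + \<sigma>)) - cis (\<theta> \<bullet> m t))
          + norm (expectation (\<lambda>\<omega>. cis (\<theta> \<bullet> flow A (t + \<sigma>) (\<eta> \<omega>))) - expectation (\<lambda>\<omega>. cis (\<theta> \<bullet> flow A t (\<eta> \<omega>))))
          + norm (complex_of_real (exp (- (energy A g \<theta> (t + \<sigma>) L / 2))) - of_real (exp (- (energy A g \<theta> t L / 2))))"
        unfolding \<psi>_def by (intro norm_triple_product_diff_le one) (auto simp: e0 simp del: of_real_exp)
      also have "\<dots> \<le> norm \<theta> * d + norm \<theta> * (S * d) + C * d" by (intro add_mono a b c)
      also have "\<dots> = (norm \<theta> + norm \<theta> * S + C) * d" by (simp add: algebra_simps)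
      also note d(2)
      finally have "norm (\<psi> (t + \<sigma>) - \<psi> t) \<le> e / 2" .
      moreover have "norm (char_fun \<theta> (t + \<sigma>) - char_fun \<theta> t)
          \<le> norm (char_fun \<theta> (t + \<sigma>) - \<psi> (t + \<sigma>)) + norm (\<psi> (t + \<sigma>) - \<psi> t) + norm (char_fun \<theta> t - \<psi> t)"
        using norm_triangle_ineq[of "char_fun \<theta> (t + \<sigma>) - \<psi> (t + \<sigma>)" "\<psi> (t + \<sigma>) - \<psi> t"]
          norm_triangle_ineq[of "char_fun \<theta> (t + \<sigma>) - \<psi> t" "\<psi> t - char_fun \<theta> t"]
        by (simp add: norm_minus_commute[of "\<psi> t"])
      ultimately show "norm (char_fun \<theta> (t + \<sigma>) - char_fun \<theta> t) \<le> e"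
        using near[of "t + \<sigma>"] near[of t] \<open>e > 0\<close> by linarith
    qed (rule d(1))
  qed
qed

section \<open>Almost periodicity in distribution\<close>

definition law :: "real \<Rightarrow> (real^'d) measure" where "law t = distr M borel (X t)"

lemma law_prob: "law t \<in> borel_probabilities"
  by (simp add: borel_probabilities_def law_def prob_space_distr)

lemma law_moment: "integrable (law t) (\<lambda>x. (norm x)\<^sup>2)" "(LINT x|law t. (norm x)\<^sup>2) \<le> moment"
  using X_square_integrable[of t] X_moment[of t]
  by (simp_all add: law_def integrable_distr_eq integral_distr square_integrable_def)

lemma law_char: "(LINT x|law t. cis (\<theta> \<bullet> x)) = char_fun \<theta> t"
  by (simp add: law_def char_fun_def integral_distr)

lemma bl_dist_law_tendsto_0:
  assumes "\<And>\<theta>. (\<lambda>n. char_fun \<theta> (a n) - char_fun \<theta> (b n)) \<longlonglongrightarrow> 0"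
  shows "(\<lambda>n. bl_dist (law (a n)) (law (b n))) \<longlonglongrightarrow> 0"
  using assms by (intro bl_dist_tendsto_0[where B=moment] law_prob law_moment) (simp add: law_char)

lemma char_fun_tendsto:
  assumes "a \<longlonglongrightarrow> t" shows "(\<lambda>n. char_fun \<theta> (a n)) \<longlonglongrightarrow> char_fun \<theta> t"
  unfolding char_fun_def
proof (rule integral_dominated_convergence[where w="\<lambda>_. 1"])
  obtain I where "AE \<omega> in M. continuous_on UNIV (\<lambda>t. I t \<omega>)"
    and "AE \<omega> in M. \<forall>s t. s \<le> t \<longrightarrow> set_integrable lborel {s..t} (\<lambda>r. A *v X r \<omega> + f r) \<and>
      X t \<omega> = X s \<omega> + (LINT r:{s..t}|lborel. A *v X r \<omega> + f r) + (I t \<omega> - I s \<omega>)"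
    using solution unfolding weak_solution_def stochastic_integral_process_def by blast
  then show "AE \<omega> in M. (\<lambda>n. cis (\<theta> \<bullet> X (a n) \<omega>)) \<longlonglongrightarrow> cis (\<theta> \<bullet> X t \<omega>)"
  proof eventually_elim
    case (elim \<omega>)
    have "continuous_on UNIV (\<lambda>r. X r \<omega>)"
      by (rule integral_equation_continuous[OF elim(1)]) (use elim(2) in auto)
    then have "continuous_on UNIV (\<lambda>r. cis (\<theta> \<bullet> X r \<omega>))" by (intro continuous_intros)
    then have "isCont (\<lambda>r. cis (\<theta> \<bullet> X r \<omega>)) t" by (simp add: continuous_on_eq_continuous_at)
    then show ?case using isCont_tendsto_compose[OF _ assms] by blast
  qed
qed auto

lemma law_continuous: "((\<lambda>s. bl_dist (law s) (law t)) \<longlongrightarrow> 0) (at t)"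
  unfolding tendsto_at_iff_sequentially o_def
proof (intro allI impI)
  fix a assume "a \<longlonglongrightarrow> t"
  have "(\<lambda>n. char_fun \<theta> (a n) - char_fun \<theta> t) \<longlonglongrightarrow> 0" for \<theta>
    using char_fun_tendsto[OF \<open>a \<longlonglongrightarrow> t\<close>, of \<theta>] by (simp add: LIM_zero)
  then show "(\<lambda>n. bl_dist (law (a n)) (law t)) \<longlonglongrightarrow> 0" by (rule bl_dist_law_tendsto_0)
qed

text \<open>Convergence in \<open>bl_dist\<close> is available only along sequences, and the
  tolerance \<open>d\<close> depends on \<theta>. Hence the argument by contradiction along periods
  of tolerance \<open>1 / Suc n\<close>, which eventually falls below the \<open>d\<close> of each
  single \<theta>.\<close>

lemma law_periods:
  assumes "e > 0" shows "relatively_dense {\<sigma>. \<forall>t. bl_dist (law (t + \<sigma>)) (law t) \<le> e}"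
proof -
  obtain H :: "real \<Rightarrow> (real^'m^'d) \<times> (real^'d) \<times> ((real^'d)^'d)" where H: "bochner_ap H"
    and control: "\<And>\<theta> e. e > 0 \<Longrightarrow> \<exists>d>0. \<forall>\<sigma>\<in>periods H d. \<forall>t. norm (char_fun \<theta> (t + \<sigma>) - char_fun \<theta> t) \<le> e"
    using char_fun_control by blast
  have "\<exists>n. \<forall>\<sigma>\<in>periods H (1 / real (Suc n)). \<forall>t. bl_dist (law (t + \<sigma>)) (law t) \<le> e"
  proof (rule ccontr)
    assume "\<nexists>n. \<forall>\<sigma>\<in>periods H (1 / real (Suc n)). \<forall>t. bl_dist (law (t + \<sigma>)) (law t) \<le> e"
    then obtain \<sigma> t where \<sigma>: "\<And>n. \<sigma> n \<in> periods H (1 / real (Suc n))"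
      and far: "\<And>n. bl_dist (law (t n + \<sigma> n)) (law (t n)) > e"
      by (metis linorder_not_le)
    have "(\<lambda>n. bl_dist (law (t n + \<sigma> n)) (law (t n))) \<longlonglongrightarrow> 0"
    proof (rule bl_dist_law_tendsto_0, rule LIMSEQ_I)
      fix \<theta> and r :: real assume "r > 0"
      then obtain d where d: "d > 0" "\<And>\<sigma> t. \<sigma> \<in> periods H d \<Longrightarrow> norm (char_fun \<theta> (t + \<sigma>) - char_fun \<theta> t) \<le> r / 2"
        using control[of "r / 2" \<theta>] by auto
      obtain N where N: "1 / real (Suc N) < d" using d(1) by (rule nat_approx_posE)
      have "norm (char_fun \<theta> (t n + \<sigma> n) - char_fun \<theta> (t n) - 0) < r" if "n \<ge> N" for n
      proof -
        have "1 / real (Suc n) \<le> 1 / real (Suc N)" using that by (simp add: field_simps)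
        then have "\<sigma> n \<in> periods H d"
          using \<sigma>[of n] periods_mono[of "1 / real (Suc n)" d H] N by auto
        then show ?thesis using d(2)[of "\<sigma> n" "t n"] \<open>r > 0\<close> by simp
      qed
      then show "\<exists>N. \<forall>n\<ge>N. norm (char_fun \<theta> (t n + \<sigma> n) - char_fun \<theta> (t n) - 0) < r" by blast
    qed
    then have "eventually (\<lambda>n. bl_dist (law (t n + \<sigma> n)) (law (t n)) < e) sequentially"
      using assms by (rule order_tendstoD)
    then show False using far by (auto simp: eventually_sequentially not_less_iff_gr_or_eq dest: less_asym)
  qed
  then obtain n where "\<forall>\<sigma>\<in>periods H (1 / real (Suc n)). \<forall>t. bl_dist (law (t + \<sigma>)) (law t) \<le> e" by blast
  then show ?thesis
    by (intro relatively_dense_mono[OF bochner_ap_periods[OF H, of "1 / real (Suc n)"]]) auto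
qed

theorem almost_periodic_law: "almost_periodic_in_distribution M X"
proof -
  interpret bl: Metric_space "borel_probabilities :: (real^'d) measure set" bl_dist
    by (rule Metric_space_bl_dist)
  show ?thesis
    unfolding almost_periodic_in_distribution_def bl.almost_periodic_def law_def[symmetric]
  proof (intro conjI allI impI)
    show "continuous_map euclideanreal bl.mtopology law"
      unfolding bl.continuous_map_to_metric
    proof (intro ballI allI impI)
      fix t e :: real assume "e > 0"
      then have "eventually (\<lambda>s. bl_dist (law s) (law t) < e) (at t)"
        by (intro order_tendstoD(2)[OF law_continuous])
      then obtain S where S: "open S" "t \<in> S" "\<And>s. s \<in> S \<Longrightarrow> s \<noteq> t \<Longrightarrow> bl_dist (law s) (law t) < e"
        unfolding eventually_at_topological by blast
      have "law s \<in> bl.mball (law t) e" if "s \<in> S" for s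
        using S(3)[OF that] law_prob \<open>e > 0\<close> by (cases "s = t") (auto simp: bl.in_mball bl.commute)
      then show "\<exists>U. openin euclideanreal U \<and> t \<in> U \<and> (\<forall>y\<in>U. law y \<in> bl.mball (law t) e)"
        using S by (intro exI[of _ S]) auto
    qed
    fix e :: real assume "e > 0"
    show "relatively_dense {\<tau>. (SUP t. ereal (bl_dist (law (t + \<tau>)) (law t))) < ereal e}"
    proof (rule relatively_dense_mono[OF law_periods[of "e / 2"]])
      show "{\<sigma>. \<forall>t. bl_dist (law (t + \<sigma>)) (law t) \<le> e / 2} \<subseteq> {\<tau>. (SUP t. ereal (bl_dist (law (t + \<tau>)) (law t))) < ereal e}"
      proof
        fix \<sigma> assume "\<sigma> \<in> {\<sigma>. \<forall>t. bl_dist (law (t + \<sigma>)) (law t) \<le> e / 2}"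
        then have "(SUP t. ereal (bl_dist (law (t + \<sigma>)) (law t))) \<le> ereal (e / 2)"
          by (intro SUP_least) simp
        also have "\<dots> < ereal e" using \<open>e > 0\<close> by simp
        finally show "\<sigma> \<in> {\<tau>. (SUP t. ereal (bl_dist (law (t + \<tau>)) (law t))) < ereal e}" by simp
      qed
    qed (use \<open>e > 0\<close> in simp)
  qed
qed

end

theorem theorem3p14:
  fixes A :: "real^'d^'d" and f :: "real \<Rightarrow> real^'d" and g :: "real \<Rightarrow> real^'m^'d"
    and M :: "'w measure" and F :: "real \<Rightarrow> 'w measure"
    and W :: "real \<Rightarrow> 'w \<Rightarrow> real^'m" and X X\<^sub>0 :: "real \<Rightarrow> 'w \<Rightarrow> real^'d" and \<tau> :: real
  assumes "Metric_space.almost_periodic UNIV dist f"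
    and "Metric_space.almost_periodic UNIV dist g"
    and "filtered_prob_space M F"
    and "brownian_motion M F W"
    and "strong_solution A f g M F X W"
    and "L2_bounded M X"
    and "strong_minimal_solution A f g M F X\<^sub>0 W"
    and "indep_rv M borel (\<lambda>\<omega>. X \<tau> \<omega> - X\<^sub>0 \<tau> \<omega>)
           (borel \<Otimes>\<^sub>M path_algebra) (\<lambda>\<omega>. (X\<^sub>0 \<tau> \<omega>, \<lambda>t. W t \<omega>))"
  shows "almost_periodic_in_distribution M X"
proof -
  interpret L2_bounded_solution A f g M F X W
    using assms(1,2,5,6)
    by unfold_locales (simp_all add: strong_solution_def bochner_ap_of_almost_periodic)
  show ?thesis by (rule almost_periodic_law)
qed

end
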